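(* Let $Q$ be a left rooted quiver with vertex set $V$, and let $\mathsf{E}$ be a Waldhausen category with small coproducts. Denote by $\mathsf{C}$ (resp., $\mathsf{W}$) the class of all cofibrations (resp., weak equivalences) in $\mathsf{E}$. If $(\mathsf{C},\mathsf{C}^{\Box})$ forms a weak factorization system in $\mathsf{E}$, then $\mathsf{Rep}(Q,\mathsf{coE})$ forms a Waldhausen category, where a morphism $f:X\to Y$ is a cofibration (resp., weak equivalence) if the induced morphism $$X_i\sqcup_{\mathsf{L}_i(X)}\mathsf{L}_i(Y)\longrightarrow Y_i$$ lies in $\mathsf{C}$ (resp., $\mathsf{W}$) for each vertex $i\in V$.
   Context: Waldhausen category (no zero object is required): a category $\mathsf{E}$ with an initial object $0$ together with a class $\mathsf{C}$ of morphisms called cofibrations (denoted $\rightarrowtail$) and a class $\mathsf{W}$ of morphisms called weak equivalences, both closed under composition, such that: (C1) all isomorphisms are cofibrations; (C2) for every object $A$ the morphism $0\to A$ is a cofibration; (C3) if $A\rightarrowtail B$ is a cofibration, then for any morphism $A\to C$ the pushout $B\sqcup_A C$ exists and $C\to B\sqcup_A C$ is a cofibration; (W1) all isomorphisms are weak equivalences; (W2) (Gluing Lemma) given a commutative diagram with rows $C\leftarrow A\rightarrowtail B$ and $C'\leftarrow A'\rightarrowtail B'$ (the right-hand horizontal morphisms being cofibrations) and vertical morphisms $C\to C'$, $A\to A'$, $B\to B'$ that are weak equivalences, the induced morphism $B\sqcup_A C\to B'\sqcup_{A'}C'$ is a weak equivalence. Weak factorization systems: $\mathsf{C}^{\Box}$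 is the class of morphisms having the right lifting property with respect to all morphisms in $\mathsf{C}$, and ${}^{\Box}\mathsf{F}$ the class of morphisms having the left lifting property with respect to all morphisms in $\mathsf{F}$. A pair $(\mathsf{C},\mathsf{F})$ is a weak factorization system if $\mathsf{C}^{\Box}=\mathsf{F}$, ${}^{\Box}\mathsf{F}=\mathsf{C}$, and every morphism factors as $f\circ c$ with $c\in\mathsf{C}$, $f\in\mathsf{F}$. Left rooted quivers: let $Q=(V,\Gamma)$ be a quiver with vertex set $V$ and arrow set $\Gamma$; $s(\alpha)$, $t(\alpha)$ are the source and target of an arrow $\alpha$. Define subsets of $V$ by transfinite recursion: $V_0=\emptyset$; $V_{\mu+1}=\{i\in V\mid i$ is not the target of any arrow $\alpha$ with $s(\alpha)\notin\bigcup_{\gamma\le\mu}V_\gamma\}$; $V_\mu=\bigcup_{\gamma<\mu}V_\gamma$ for a limit ordinal $\mu$. The quiver $Q$ is left rooted if $V_\zeta=V$ for some ordinal $\zeta$. Representations: a representation $X$ of $Q$ in $\mathsf{E}$ consists of objects $X_i$ ($i\in V$) and morphisms $X_\alpha:X_{s(\alpha)}\to X_{t(\alpha)}$ ($\alpha\in\Gamma$) of $\mathsf{E}$; a morphism $f:X\to Y$ is a family of morphisms $f_i:X_i\to Y_i$ in $\mathsf{E}$ with $f_{t(\alpha)}X_\alpha=Y_\alpha f_{s(\alpha)}$ for all $\alpha$. These form the category $\mathsf{Rep}(Q,\mathsf{E})$. $\mathsf{coE}$ is the subcategory of $\mathsf{E}$ with the same objects whose morphisms are the cofibrations, and $\mathsf{Rep}(Q,\mathsf{coE})$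 is the full subcategory of $\mathsf{Rep}(Q,\mathsf{E})$ of those $X$ with every $X_\alpha$ a cofibration (the components $f_i$ of morphisms are arbitrary morphisms of $\mathsf{E}$). Latching objects: for $X$ in $\mathsf{Rep}(Q,\mathsf{coE})$ and $i\in V$, put $\mathsf{L}_i(X)=\coprod_{\alpha\in\Gamma,\,t(\alpha)=i}X_{s(\alpha)}$, and for $f:X\to Y$ put $\mathsf{L}_i(f)=\coprod_{\alpha\in\Gamma,\,t(\alpha)=i}f_{s(\alpha)}$. The morphisms $X_\alpha$ induce a morphism $\mathsf{L}_i(X)\to X_i$, which under the hypotheses lies in $\mathsf{C}$, so the pushout $X_i\sqcup_{\mathsf{L}_i(X)}\mathsf{L}_i(Y)$ of it along $\mathsf{L}_i(f)$ exists. The induced morphism $X_i\sqcup_{\mathsf{L}_i(X)}\mathsf{L}_i(Y)\to Y_i$ is the one determined by $f_i:X_i\to Y_i$ and the canonical morphism $\mathsf{L}_i(Y)\to Y_i$.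
   Formalization: The maps L_i(X)→X_i need not lie in C (E = sets, C = injections, Q = two parallel arrows), so the claim is proved for Rep(Q,coE) when they all do, a condition forced by (C2), and unconditionally for the full subcategory of those X for which they do. *)

theory Defs
  imports "HOL-Library.FuncSet" "Graph_Theory.Digraph"
begin

section \<open>Categories\<close>

record ('o, 'm) category =
  Ob :: "'o set"
  Mor :: "'m set"
  Dom :: "'m \<Rightarrow> 'o"
  Cod :: "'m \<Rightarrow> 'o"
  Idm :: "'o \<Rightarrow> 'm"
  Cmp :: "'m \<Rightarrow> 'm \<Rightarrow> 'm" (infixl "\<odot>\<index>" 70)

definition Hom :: "('o, 'm) category \<Rightarrow> 'o \<Rightarrow> 'o \<Rightarrow> 'm set" where
  "Hom E A B = {f \<in> Mor E. Dom E f = A \<and> Cod E f = B}"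

locale category =
  fixes E :: "('o, 'm) category" (structure)
  assumes Dom_in_Ob: "f \<in> Mor E \<Longrightarrow> Dom E f \<in> Ob E"
    and Cod_in_Ob: "f \<in> Mor E \<Longrightarrow> Cod E f \<in> Ob E"
    and Idm_in_Hom: "A \<in> Ob E \<Longrightarrow> Idm E A \<in> Hom E A A"
    and Cmp_in_Hom: "f \<in> Hom E A B \<Longrightarrow> g \<in> Hom E B D \<Longrightarrow> g \<odot> f \<in> Hom E A D"
    and Cmp_Idm: "f \<in> Hom E A B \<Longrightarrow> f \<odot> Idm E A = f"
    and Idm_Cmp: "f \<in> Hom E A B \<Longrightarrow> Idm E B \<odot> f = f"
    and Cmp_assoc: "f \<in> Hom E A B \<Longrightarrow> g \<in> Hom E B D \<Longrightarrow> h \<in> Hom E D F \<Longrightarrow>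
      h \<odot> (g \<odot> f) = (h \<odot> g) \<odot> f"

definition full_subcategory :: "('o, 'm) category \<Rightarrow> 'o set \<Rightarrow> ('o, 'm) category" where
  "full_subcategory E S = E\<lparr>Ob := Ob E \<inter> S, Mor := {f \<in> Mor E. Dom E f \<in> S \<and> Cod E f \<in> S}\<rparr>"

definition is_iso :: "('o, 'm) category \<Rightarrow> 'm \<Rightarrow> bool" where
  "is_iso E f \<longleftrightarrow> f \<in> Mor E \<and>
     (\<exists>g \<in> Hom E (Cod E f) (Dom E f).
        g \<odot>\<^bsub>E\<^esub> f = Idm E (Dom E f) \<and> f \<odot>\<^bsub>E\<^esub> g = Idm E (Cod E f))"

definition is_initial :: "('o, 'm) category \<Rightarrow> 'o \<Rightarrow> bool" where
  "is_initial E Z \<longleftrightarrow> Z \<in> Ob E \<and> (\<forall>A \<in> Ob E. \<exists>!f. f \<in> Hom E Z A)"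

definition is_coproduct ::
  "('o, 'm) category \<Rightarrow> 'i set \<Rightarrow> ('i \<Rightarrow> 'o) \<Rightarrow> 'o \<Rightarrow> ('i \<Rightarrow> 'm) \<Rightarrow> bool" where
  "is_coproduct E I A P \<iota> \<longleftrightarrow> P \<in> Ob E \<and> (\<forall>i\<in>I. \<iota> i \<in> Hom E (A i) P) \<and>
     (\<forall>D \<in> Ob E. \<forall>\<phi>. (\<forall>i\<in>I. \<phi> i \<in> Hom E (A i) D) \<longrightarrow>
        (\<exists>!h. h \<in> Hom E P D \<and> (\<forall>i\<in>I. h \<odot>\<^bsub>E\<^esub> \<iota> i = \<phi> i)))"

text \<open>
  Smallness is relative to a type \<open>'i\<close>: the small index sets are the subsets of \<open>'i\<close>,
  including the empty one.
\<close>

definition has_small_coproducts :: "'i itself \<Rightarrow> ('o, 'm) category \<Rightarrow> bool" where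
  "has_small_coproducts _ E \<longleftrightarrow>
     (\<forall>(I :: 'i set) A. (\<forall>i\<in>I. A i \<in> Ob E) \<longrightarrow> (\<exists>P \<iota>. is_coproduct E I A P \<iota>))"

text \<open>
  The square with sides \<open>f : A \<rightarrow> B\<close>, \<open>g : A \<rightarrow> C\<close>, \<open>p : B \<rightarrow> P\<close>, \<open>q : C \<rightarrow> P\<close> is a pushout.
\<close>

definition is_pushout :: "('o, 'm) category \<Rightarrow> 'm \<Rightarrow> 'm \<Rightarrow> 'm \<Rightarrow> 'm \<Rightarrow> bool" where
  "is_pushout E f g p q \<longleftrightarrow>
     f \<in> Mor E \<and> g \<in> Mor E \<and> p \<in> Mor E \<and> q \<in> Mor E \<and>
     Dom E f = Dom E g \<and> Dom E p = Cod E f \<and> Dom E q = Cod E g \<and> Cod E p = Cod E q \<and>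
     p \<odot>\<^bsub>E\<^esub> f = q \<odot>\<^bsub>E\<^esub> g \<and>
     (\<forall>D \<in> Ob E. \<forall>r \<in> Hom E (Cod E f) D. \<forall>s \<in> Hom E (Cod E g) D.
        r \<odot>\<^bsub>E\<^esub> f = s \<odot>\<^bsub>E\<^esub> g \<longrightarrow>
        (\<exists>!h. h \<in> Hom E (Cod E p) D \<and> h \<odot>\<^bsub>E\<^esub> p = r \<and> h \<odot>\<^bsub>E\<^esub> q = s))"

section \<open>Waldhausen categories\<close>

definition closed_under_composition :: "('o, 'm) category \<Rightarrow> 'm set \<Rightarrow> bool" where
  "closed_under_composition E K \<longleftrightarrow>
     (\<forall>f\<in>K. \<forall>g\<in>K. Cod E f = Dom E g \<longrightarrow> g \<odot>\<^bsub>E\<^esub> f \<in> K)"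

text \<open>
  No zero object is required. The axioms are stated for every choice of
  initial object and of pushouts, none of which is part of the structure.
  In \<open>gluing\<close>, \<open>f : A \<rightarrow> B\<close> and \<open>f' : A' \<rightarrow> B'\<close> are the cofibrations, \<open>g : A \<rightarrow> C\<close> and
  \<open>g' : A' \<rightarrow> C'\<close> the other legs, and \<open>u\<close> is the induced morphism of pushouts.
\<close>

locale waldhausen_category = category E for E :: "('o, 'm) category" (structure) +
  fixes Cof :: "'m set" and W :: "'m set"
  assumes ex_initial: "\<exists>Z. is_initial E Z"
    and Cof_Mor: "Cof \<subseteq> Mor E"
    and W_Mor: "W \<subseteq> Mor E"
    and Cof_Cmp: "closed_under_composition E Cof"
    and W_Cmp: "closed_under_composition E W"
    and iso_Cof: "is_iso E f \<Longrightarrow> f \<in> Cof"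
    and initial_Cof: "is_initial E Z \<Longrightarrow> f \<in> Mor E \<Longrightarrow> Dom E f = Z \<Longrightarrow> f \<in> Cof"
    and ex_pushout: "f \<in> Cof \<Longrightarrow> g \<in> Mor E \<Longrightarrow> Dom E g = Dom E f \<Longrightarrow> \<exists>p q. is_pushout E f g p q"
    and pushout_Cof: "f \<in> Cof \<Longrightarrow> is_pushout E f g p q \<Longrightarrow> q \<in> Cof"
    and iso_W: "is_iso E f \<Longrightarrow> f \<in> W"
    and gluing:
      "\<lbrakk>f \<in> Cof; f' \<in> Cof; is_pushout E f g p q; is_pushout E f' g' p' q';
        a \<in> W; b \<in> W; c \<in> W;
        a \<in> Hom E (Dom E f) (Dom E f'); b \<in> Hom E (Cod E f) (Cod E f');
        c \<in> Hom E (Cod E g) (Cod E g');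
        b \<odot> f = f' \<odot> a; c \<odot> g = g' \<odot> a;
        u \<in> Hom E (Cod E p) (Cod E p'); u \<odot> p = p' \<odot> b; u \<odot> q = q' \<odot> c\<rbrakk> \<Longrightarrow> u \<in> W"

section \<open>Weak factorization systems\<close>

text \<open>\<open>f\<close> has the left lifting property with respect to \<open>g\<close>.\<close>

definition lifts :: "('o, 'm) category \<Rightarrow> 'm \<Rightarrow> 'm \<Rightarrow> bool" where
  "lifts E f g \<longleftrightarrow>
     (\<forall>u \<in> Hom E (Dom E f) (Dom E g). \<forall>v \<in> Hom E (Cod E f) (Cod E g).
        g \<odot>\<^bsub>E\<^esub> u = v \<odot>\<^bsub>E\<^esub> f \<longrightarrow>
        (\<exists>h \<in> Hom E (Cod E f) (Dom E g). h \<odot>\<^bsub>E\<^esub> f = u \<and> g \<odot>\<^bsub>E\<^esub> h = v))"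

definition rlp :: "('o, 'm) category \<Rightarrow> 'm set \<Rightarrow> 'm set" where
  "rlp E L = {g \<in> Mor E. \<forall>f\<in>L. lifts E f g}"

definition llp :: "('o, 'm) category \<Rightarrow> 'm set \<Rightarrow> 'm set" where
  "llp E R = {f \<in> Mor E. \<forall>g\<in>R. lifts E f g}"

definition weak_factorization_system :: "('o, 'm) category \<Rightarrow> 'm set \<Rightarrow> 'm set \<Rightarrow> bool" where
  "weak_factorization_system E L R \<longleftrightarrow>
     rlp E L = R \<and> llp E R = L \<and>
     (\<forall>h \<in> Mor E. \<exists>c\<in>L. \<exists>f\<in>R. Cod E c = Dom E f \<and> f \<odot>\<^bsub>E\<^esub> c = h)"

section \<open>Left rooted quivers\<close>

text \<open>
  A quiver is a \<^const>\<open>wf_digraph\<close>: possibly infinite, with loops and multiple arrows allowed;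
  \<^const>\<open>tail\<close> is the source and \<^const>\<open>head\<close> the target.

  Ordinals are the elements of a well-ordered type. An element \<open>\<nu>\<close> is the successor of \<open>\<mu>\<close> iff
  the elements below \<open>\<nu>\<close> are precisely those \<open>\<le> \<mu>\<close>, so the union in the successor clause is the
  one over all \<open>\<gamma> \<le> \<mu>\<close>. The other clause covers limits, and the least element, where the union
  is empty.
\<close>

function rooted_stage :: "('v, 'e) pre_digraph \<Rightarrow> 'w::wellorder \<Rightarrow> 'v set" where
  "rooted_stage Q \<nu> =
     (if \<exists>\<mu>. {..<\<nu>} = {..\<mu>}
      then {i \<in> verts Q. \<not> (\<exists>\<alpha> \<in> arcs Q. head Q \<alpha> = i \<and> tail Q \<alpha> \<notin> (\<Union>\<gamma>\<in>{..<\<nu>}. rooted_stage Q \<gamma>))}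
      else (\<Union>\<gamma>\<in>{..<\<nu>}. rooted_stage Q \<gamma>))"
  by pat_completeness auto
termination
  by (relation "inv_image {(x, y). x < y} snd") (auto simp: wf)

declare rooted_stage.simps [simp del]

text \<open>
  No single type contains all ordinals. With \<open>'w\<close> a type variable in the hypothesis of a theorem,
  the theorem covers an arbitrary ordinal \<open>\<zeta>\<close>.
\<close>

definition left_rooted :: "'w::wellorder itself \<Rightarrow> ('v, 'e) pre_digraph \<Rightarrow> bool" where
  "left_rooted _ Q \<longleftrightarrow> (\<exists>\<zeta> :: 'w. rooted_stage Q \<zeta> = verts Q)"

section \<open>Representations of a quiver\<close>

record ('v, 'e, 'o, 'm) rep =
  rep_ob :: "'v \<Rightarrow> 'o"
  rep_map :: "'e \<Rightarrow> 'm"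

record ('v, 'e, 'o, 'm) rep_mor =
  rep_dom :: "('v, 'e, 'o, 'm) rep"
  rep_cod :: "('v, 'e, 'o, 'm) rep"
  rep_comp :: "'v \<Rightarrow> 'm"

text \<open>
  The families are extensional (\<^const>\<open>undefined\<close> off the vertices, resp. arrows), so that equality
  in HOL is equality of representations and of their morphisms.
\<close>

definition Rep :: "('v, 'e) pre_digraph \<Rightarrow> ('o, 'm) category \<Rightarrow>
    (('v, 'e, 'o, 'm) rep, ('v, 'e, 'o, 'm) rep_mor) category" where
  "Rep Q E =
     (let obs = {X. rep_ob X \<in> verts Q \<rightarrow>\<^sub>E Ob E \<and>
                    rep_map X \<in> (\<Pi>\<^sub>E \<alpha>\<in>arcs Q. Hom E (rep_ob X (tail Q \<alpha>)) (rep_ob X (head Q \<alpha>)))}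
      in \<lparr>Ob = obs,
          Mor = {f. rep_dom f \<in> obs \<and> rep_cod f \<in> obs \<and>
                    rep_comp f \<in> (\<Pi>\<^sub>E i\<in>verts Q. Hom E (rep_ob (rep_dom f) i) (rep_ob (rep_cod f) i)) \<and>
                    (\<forall>\<alpha>\<in>arcs Q. rep_comp f (head Q \<alpha>) \<odot>\<^bsub>E\<^esub> rep_map (rep_dom f) \<alpha> =
                                rep_map (rep_cod f) \<alpha> \<odot>\<^bsub>E\<^esub> rep_comp f (tail Q \<alpha>))},
          Dom = rep_dom,
          Cod = rep_cod,
          Idm = (\<lambda>X. \<lparr>rep_dom = X, rep_cod = X, rep_comp = (\<lambda>i\<in>verts Q. Idm E (rep_ob X i))\<rparr>),
          Cmp = (\<lambda>g f. \<lparr>rep_dom = rep_dom f, rep_cod = rep_cod g,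
                        rep_comp = (\<lambda>i\<in>verts Q. rep_comp g i \<odot>\<^bsub>E\<^esub> rep_comp f i)\<rparr>)\<rparr>)"

text \<open>For \<open>K\<close> the class of cofibrations this is the category \<open>Rep(Q, coE)\<close>.\<close>

definition Rep_in :: "('v, 'e) pre_digraph \<Rightarrow> ('o, 'm) category \<Rightarrow> 'm set \<Rightarrow>
    (('v, 'e, 'o, 'm) rep, ('v, 'e, 'o, 'm) rep_mor) category" where
  "Rep_in Q E K = full_subcategory (Rep Q E) {X. \<forall>\<alpha>\<in>arcs Q. rep_map X \<alpha> \<in> K}"

section \<open>Latching objects\<close>

definition is_latching_ob :: "('v, 'e) pre_digraph \<Rightarrow> ('o, 'm) category \<Rightarrow>
    ('v, 'e, 'o, 'm) rep \<Rightarrow> 'v \<Rightarrow> 'o \<Rightarrow> ('e \<Rightarrow> 'm) \<Rightarrow> bool" where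
  "is_latching_ob Q E X i L \<iota> \<longleftrightarrow>
     is_coproduct E (in_arcs Q i) (\<lambda>\<alpha>. rep_ob X (tail Q \<alpha>)) L \<iota>"

text \<open>\<open>l\<close> is the morphism from \<open>L\<^sub>i(X) = (L, \<iota>)\<close> to \<open>X\<^sub>i\<close> induced by the \<open>X\<^sub>\<alpha>\<close>.\<close>

definition is_latching_mor :: "('v, 'e) pre_digraph \<Rightarrow> ('o, 'm) category \<Rightarrow>
    ('v, 'e, 'o, 'm) rep \<Rightarrow> 'v \<Rightarrow> 'o \<Rightarrow> ('e \<Rightarrow> 'm) \<Rightarrow> 'm \<Rightarrow> bool" where
  "is_latching_mor Q E X i L \<iota> l \<longleftrightarrow>
     is_latching_ob Q E X i L \<iota> \<and> l \<in> Hom E L (rep_ob X i) \<and>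
     (\<forall>\<alpha> \<in> in_arcs Q i. l \<odot>\<^bsub>E\<^esub> \<iota> \<alpha> = rep_map X \<alpha>)"

text \<open>
  If every \<open>X\<^sub>\<alpha>\<close> lies in \<open>K\<close>, the latching morphisms of \<open>X\<close> still need not: in the category of
  sets with \<open>K\<close> the injections, let two arrows with target \<open>i\<close> both act as the identity of
  a nonempty set \<open>A\<close>; then \<open>L\<^sub>i(X) \<rightarrow> X\<^sub>i\<close> is the fold map from two copies of \<open>A\<close> to \<open>A\<close>.
\<close>

definition latching_mors_in :: "('v, 'e) pre_digraph \<Rightarrow> ('o, 'm) category \<Rightarrow> 'm set \<Rightarrow>
    ('v, 'e, 'o, 'm) rep \<Rightarrow> bool" where
  "latching_mors_in Q E K X \<longleftrightarrow>
     (\<forall>i \<in> verts Q. \<exists>L \<iota> l. is_latching_mor Q E X i L \<iota> l \<and> l \<in> K)"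

text \<open>
  \<open>u\<close> is the morphism from the pushout of \<open>X\<^sub>i\<close> and \<open>L\<^sub>i(Y)\<close> over \<open>L\<^sub>i(X)\<close> to \<open>Y\<^sub>i\<close> induced by
  \<open>f : X \<rightarrow> Y\<close>; here \<open>m = L\<^sub>i(f)\<close>. Coproducts and pushouts are determined up to isomorphism only,
  hence so is \<open>u\<close>; the existential form makes their existence part of the assertion.
\<close>

definition is_relative_latching_mor :: "('v, 'e) pre_digraph \<Rightarrow> ('o, 'm) category \<Rightarrow>
    ('v, 'e, 'o, 'm) rep_mor \<Rightarrow> 'v \<Rightarrow> 'm \<Rightarrow> bool" where
  "is_relative_latching_mor Q E f i u \<longleftrightarrow>
     (\<exists>L \<iota> l L' \<iota>' l' m p q.
        is_latching_mor Q E (rep_dom f) i L \<iota> l \<and>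
        is_latching_mor Q E (rep_cod f) i L' \<iota>' l' \<and>
        m \<in> Hom E L L' \<and>
        (\<forall>\<alpha> \<in> in_arcs Q i. m \<odot>\<^bsub>E\<^esub> \<iota> \<alpha> = \<iota>' \<alpha> \<odot>\<^bsub>E\<^esub> rep_comp f (tail Q \<alpha>)) \<and>
        is_pushout E l m p q \<and>
        u \<in> Hom E (Cod E p) (rep_ob (rep_cod f) i) \<and>
        u \<odot>\<^bsub>E\<^esub> p = rep_comp f i \<and> u \<odot>\<^bsub>E\<^esub> q = l')"

definition latching_class :: "('v, 'e) pre_digraph \<Rightarrow> ('o, 'm) category \<Rightarrow>
    (('v, 'e, 'o, 'm) rep, ('v, 'e, 'o, 'm) rep_mor) category \<Rightarrow> 'm set \<Rightarrow>
    ('v, 'e, 'o, 'm) rep_mor set" where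
  "latching_class Q E R K =
     {f \<in> Mor R. \<forall>i \<in> verts Q. \<exists>u \<in> K. is_relative_latching_mor Q E f i u}"

end

theory Submission
  imports Defs
begin

text \<open>
  At a vertex \<open>i\<close> a representation gives the arrow \<open>L\<^sub>i(X) \<rightarrow> X\<^sub>i\<close>, and a morphism gives a square
  between two such arrows; the classes of \<open>Rep(Q, coE)\<close> ask that its corner map
  \<open>X\<^sub>i \<squnion>\<^bsub>L\<^sub>i(X)\<^esub> L\<^sub>i(Y) \<rightarrow> Y\<^sub>i\<close> lie in \<open>C\<close>, resp. \<open>W\<close>. Pasting and cancelling pushout squares shows
  that such squares compose and that cofibrant ones are stable under cobase change. For the gluing
  lemma, pushouts commute with pushouts, so the corner map of the induced morphism is itself induced
  by the three given corner maps, and the gluing lemma of \<open>E\<close> applies once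
  \<open>A\<^sub>i \<squnion>\<^bsub>L\<^sub>i(A)\<^esub> L\<^sub>i(A') \<rightarrow> B\<^sub>i \<squnion>\<^bsub>L\<^sub>i(B)\<^esub> L\<^sub>i(B')\<close> is known to be a cofibration.
  The functors \<open>L\<^sub>i\<close> preserve pushouts. The weak factorization system makes coproducts of cofibrations
  and coproduct inclusions cofibrations, and the quiver being left rooted, induction along the arrows
  then shows that a cofibration of representations is a cofibration at every vertex. Hence pushouts
  along it are computed vertexwise.
\<close>

section \<open>Pushouts\<close>

context category
begin

text \<open>Cofibrations \<open>X_\<alpha>\<close> do not force L_i(X) -> X_i into C, since the
  morphism induced out of a coproduct may fold. All axioms are therefore proved for the full
  subcategory \<open>R\<close> of the representations whose latching morphisms lie in C; when every
  object of \<open>Rep_in Q E Cof\<close> is of this kind, that category equals \<open>R\<close>.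
  Latching objects and corner maps are moreover fixed up to isomorphism only, while
  \<open>latching_class\<close> asserts the existence of some choice. Fixing one choice turns
  latching into functions \<open>lat\<close> and \<open>Lmap\<close>, and
  \<open>latching_class_iff\<close> settles once that the choice does not matter. Composition and
  isomorphisms are handled for C and W at the same time through \<open>corner_class\<close>: its
  exchange property comes from cancelling pushouts in the case of C and from the gluing lemma with
  two identities in the case of W. One circularity has to be avoided: the vertexwise pushout of
  representations is shown to lie in \<open>R\<close> by means of its corner maps, so these are
  computed in \<open>Rep Q E\<close>, before membership in \<open>R\<close> is known.\<close>

lemma Hom_iff: "f \<in> Hom E A B \<longleftrightarrow> f \<in> Mor E \<and> Dom E f = A \<and> Cod E f = B"
  by (simp add: Hom_def)

lemma Hom_Ob:
  assumes "f \<in> Hom E A B"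
  shows "A \<in> Ob E" "B \<in> Ob E"
  using assms Dom_in_Ob Cod_in_Ob by (auto simp: Hom_iff)

lemma Mor_Hom: "f \<in> Mor E \<Longrightarrow> f \<in> Hom E (Dom E f) (Cod E f)"
  by (simp add: Hom_iff)

lemma Cmp_Mor: "f \<in> Mor E \<Longrightarrow> g \<in> Mor E \<Longrightarrow> Cod E f = Dom E g \<Longrightarrow> g \<odot> f \<in> Mor E"
  and Dom_Cmp: "f \<in> Mor E \<Longrightarrow> g \<in> Mor E \<Longrightarrow> Cod E f = Dom E g \<Longrightarrow> Dom E (g \<odot> f) = Dom E f"
  and Cod_Cmp: "f \<in> Mor E \<Longrightarrow> g \<in> Mor E \<Longrightarrow> Cod E f = Dom E g \<Longrightarrow> Cod E (g \<odot> f) = Cod E g"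
  using Cmp_in_Hom[of f "Dom E f" "Cod E f" g "Cod E g"] by (auto simp: Hom_iff)

lemma Cmp_rassoc:
  "\<lbrakk>f \<in> Mor E; g \<in> Mor E; h \<in> Mor E; Cod E f = Dom E g; Cod E g = Dom E h\<rbrakk> \<Longrightarrow>
    (h \<odot> g) \<odot> f = h \<odot> (g \<odot> f)"
  using Cmp_assoc[of f "Dom E f" "Cod E f" g "Cod E g" h "Cod E h"] by (simp add: Hom_iff)

lemma Cmp_Idm_right: "f \<in> Mor E \<Longrightarrow> Dom E f = A \<Longrightarrow> f \<odot> Idm E A = f"
  and Cmp_Idm_left: "f \<in> Mor E \<Longrightarrow> Cod E f = A \<Longrightarrow> Idm E A \<odot> f = f"
  using Cmp_Idm[OF Mor_Hom] Idm_Cmp[OF Mor_Hom] by auto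

lemma Idm_Mor: "A \<in> Ob E \<Longrightarrow> Idm E A \<in> Mor E"
  and Dom_Idm: "A \<in> Ob E \<Longrightarrow> Dom E (Idm E A) = A"
  and Cod_Idm: "A \<in> Ob E \<Longrightarrow> Cod E (Idm E A) = A"
  using Idm_in_Hom by (auto simp: Hom_iff)

lemmas cat_simps = Hom_iff Cmp_Mor Dom_Cmp Cod_Cmp Cmp_rassoc Cmp_Idm_right Cmp_Idm_left
  Idm_Mor Dom_Idm Cod_Idm

text \<open>\<open>cat_simps\<close> nests composites to the right, so \<open>a \<odot> b\<close> is
  no longer a subterm once something is precomposed. This form of an equation
  \<open>a \<odot> b = c\<close> still applies there; it is attached to equations by
  \<open>THEN\<close> or \<open>OF\<close>.\<close>

lemma Cmp_rewrite:
  "\<lbrakk>a \<odot> b = c; a \<in> Mor E; b \<in> Mor E; Cod E b = Dom E a; z \<in> Mor E; Cod E z = Dom E b\<rbrakk> \<Longrightarrow>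
    a \<odot> (b \<odot> z) = c \<odot> z"
  by (auto simp: Cmp_rassoc)

lemma is_isoE:
  assumes "is_iso E f" "f \<in> Hom E A B"
  obtains g where "g \<in> Hom E B A" "g \<odot> f = Idm E A" "f \<odot> g = Idm E B"
  using assms by (auto simp: is_iso_def Hom_iff)

lemma is_isoI:
  assumes "f \<in> Hom E A B" "g \<in> Hom E B A" "g \<odot> f = Idm E A" "f \<odot> g = Idm E B"
  shows "is_iso E f"
  using assms by (auto simp: is_iso_def Hom_iff)

lemma is_iso_Idm: "A \<in> Ob E \<Longrightarrow> is_iso E (Idm E A)"
  using Idm_in_Hom Cmp_Idm by (intro is_isoI[of _ A A "Idm E A"]) auto

section \<open>Universal property, pasting and cancellation of pushouts\<close>

lemma is_pushoutI:
  assumes "f \<in> Hom E A B" "g \<in> Hom E A C" "p \<in> Hom E B P" "q \<in> Hom E C P" "p \<odot> f = q \<odot> g"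
    and ex: "\<And>D r s. r \<in> Hom E B D \<Longrightarrow> s \<in> Hom E C D \<Longrightarrow> r \<odot> f = s \<odot> g \<Longrightarrow>
           \<exists>h. h \<in> Hom E P D \<and> h \<odot> p = r \<and> h \<odot> q = s"
    and uniq: "\<And>D h k. h \<in> Hom E P D \<Longrightarrow> k \<in> Hom E P D \<Longrightarrow> h \<odot> p = k \<odot> p \<Longrightarrow> h \<odot> q = k \<odot> q \<Longrightarrow> h = k"
  shows "is_pushout E f g p q"
proof -
  have "\<exists>!h. h \<in> Hom E P D \<and> h \<odot> p = r \<and> h \<odot> q = s"
    if "r \<in> Hom E B D" "s \<in> Hom E C D" "r \<odot> f = s \<odot> g" for D r s
    using ex[OF that] uniq by metis
  moreover have "Dom E f = A" "Cod E f = B" "Dom E g = A" "Cod E g = C"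
    "Dom E p = B" "Dom E q = C" "Cod E p = P" "Cod E q = P"
    "f \<in> Mor E" "g \<in> Mor E" "p \<in> Mor E" "q \<in> Mor E"
    using assms(1-4) by (auto simp: Hom_iff)
  ultimately show ?thesis
    using assms(5) by (simp add: is_pushout_def)
qed

lemma pushout_Homs:
  assumes "is_pushout E f g p q"
  obtains A B C P where "f \<in> Hom E A B" "g \<in> Hom E A C" "p \<in> Hom E B P" "q \<in> Hom E C P"
  using assms by (auto simp: is_pushout_def Hom_iff)

lemma pushout_commutes: "is_pushout E f g p q \<Longrightarrow> p \<odot> f = q \<odot> g"
  by (simp add: is_pushout_def)

lemma pushout_ex1:
  assumes po: "is_pushout E f g p q" and p: "p \<in> Hom E B P" and q: "q \<in> Hom E C P"
    and r: "r \<in> Hom E B D" and s: "s \<in> Hom E C D" and rs: "r \<odot> f = s \<odot> g"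
  shows "\<exists>!h. h \<in> Hom E P D \<and> h \<odot> p = r \<and> h \<odot> q = s"
proof -
  have "Cod E f = B" "Cod E g = C" "Cod E p = P"
    using po p q by (auto simp: is_pushout_def Hom_iff)
  then have "\<forall>D \<in> Ob E. \<forall>r \<in> Hom E B D. \<forall>s \<in> Hom E C D. r \<odot> f = s \<odot> g \<longrightarrow>
      (\<exists>!h. h \<in> Hom E P D \<and> h \<odot> p = r \<and> h \<odot> q = s)"
    using po unfolding is_pushout_def by (elim conjE) (simp only:)
  then show ?thesis using r s rs Hom_Ob(2)[OF r] by blast
qed

lemma pushout_ex:
  assumes "is_pushout E f g p q" "p \<in> Hom E B P" "q \<in> Hom E C P"
    and "r \<in> Hom E B D" "s \<in> Hom E C D" "r \<odot> f = s \<odot> g"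
  obtains h where "h \<in> Hom E P D" "h \<odot> p = r" "h \<odot> q = s"
  using pushout_ex1[OF assms] by blast

lemma pushout_eqI:
  assumes po: "is_pushout E f g p q" and p: "p \<in> Hom E B P" and h: "h \<in> Hom E P D"
      and k: "k \<in> Hom E P D"
    and "h \<odot> p = k \<odot> p" "h \<odot> q = k \<odot> q"
  shows "h = k"
proof -
  obtain A C where H: "f \<in> Hom E A B" "g \<in> Hom E A C" "q \<in> Hom E C P"
    using po p by (simp add: is_pushout_def Hom_iff)
  have "k \<odot> p \<in> Hom E B D" "k \<odot> q \<in> Hom E C D" "(k \<odot> p) \<odot> f = (k \<odot> q) \<odot> g"
    using H p k pushout_commutes[OF po] by (simp_all add: cat_simps)
  then show ?thesis using pushout_ex1[OF po p H(3)] assms by blast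
qed

lemma pushout_sym:
  assumes po: "is_pushout E f g p q"
  shows "is_pushout E g f q p"
proof -
  obtain A B C P where H: "f \<in> Hom E A B" "g \<in> Hom E A C" "p \<in> Hom E B P" "q \<in> Hom E C P"
    using po by (rule pushout_Homs)
  show ?thesis
  proof (rule is_pushoutI[OF H(2,1,4,3) pushout_commutes[OF po, symmetric]])
    fix D r s assume "r \<in> Hom E C D" "s \<in> Hom E B D" "r \<odot> g = s \<odot> f"
    then show "\<exists>h. h \<in> Hom E P D \<and> h \<odot> q = r \<and> h \<odot> p = s"
      using pushout_ex[OF po H(3,4)] by metis
  next
    fix D h k assume "h \<in> Hom E P D" "k \<in> Hom E P D" "h \<odot> q = k \<odot> q" "h \<odot> p = k \<odot> p"
    then show "h = k" using pushout_eqI[OF po H(3)] by blast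
  qed
qed

text \<open>A cocone on the outer span, restricted along \<open>h\<close>, is a cocone on the first
  span; the morphism \<open>k\<close> which it induces on \<open>P\<close> then forms with
  \<open>y\<close> a cocone on the second span.\<close>

lemma pushout_paste:
  assumes po1: "is_pushout E f g p q" and po2: "is_pushout E q h r s"
  shows "is_pushout E f (h \<odot> g) (r \<odot> p) s"
proof -
  obtain A B C P where H: "f \<in> Hom E A B" "g \<in> Hom E A C" "p \<in> Hom E B P" "q \<in> Hom E C P"
    using po1 by (rule pushout_Homs)
  obtain D R where H': "h \<in> Hom E C D" "r \<in> Hom E P R" "s \<in> Hom E D R"
    using po2 H(4) by (auto simp: is_pushout_def Hom_iff)
  show ?thesis
  proof (rule is_pushoutI)
    show "f \<in> Hom E A B" "h \<odot> g \<in> Hom E A D" "r \<odot> p \<in> Hom E B R" "s \<in> Hom E D R"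
      using H H' Cmp_in_Hom by auto
    show "(r \<odot> p) \<odot> f = s \<odot> (h \<odot> g)"
      using H H' Cmp_rewrite[OF pushout_commutes[OF po2], of g]
      by (simp add: cat_simps pushout_commutes[OF po1])
  next
    fix D' x y assume x: "x \<in> Hom E B D'" and y: "y \<in> Hom E D D'" and xy: "x \<odot> f = y \<odot> (h \<odot> g)"
    have "x \<odot> f = (y \<odot> h) \<odot> g" using xy y H H' by (simp add: cat_simps)
    then obtain k where k: "k \<in> Hom E P D'" "k \<odot> p = x" "k \<odot> q = y \<odot> h"
      using pushout_ex[OF po1 H(3,4) x] Cmp_in_Hom y H' by metis
    then obtain l where l: "l \<in> Hom E R D'" "l \<odot> r = k" "l \<odot> s = y"
      using pushout_ex[OF po2 H'(2,3) k(1) y] by metis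
    then have "l \<odot> (r \<odot> p) = x" using k H H' by (simp add: cat_simps Cmp_rewrite[of l r])
    then show "\<exists>h. h \<in> Hom E R D' \<and> h \<odot> (r \<odot> p) = x \<and> h \<odot> s = y" using l by blast
  next
    fix D' x y assume x: "x \<in> Hom E R D'" and y: "y \<in> Hom E R D'"
      and xy: "x \<odot> (r \<odot> p) = y \<odot> (r \<odot> p)" "x \<odot> s = y \<odot> s"
    have "(x \<odot> r) \<odot> p = (y \<odot> r) \<odot> p" using xy x y H H' by (simp add: cat_simps)
    moreover have "(x \<odot> r) \<odot> q = (y \<odot> r) \<odot> q"
    proof -
      have "(z \<odot> r) \<odot> q = (z \<odot> s) \<odot> h" if "z \<in> Hom E R D'" for z
        using that H H' pushout_commutes[OF po2] by (simp add: cat_simps)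
      then show ?thesis using x y xy by simp
    qed
    moreover have "x \<odot> r \<in> Hom E P D'" "y \<odot> r \<in> Hom E P D'" using x y H' Cmp_in_Hom by auto
    ultimately have "x \<odot> r = y \<odot> r" using pushout_eqI[OF po1 H(3)] by blast
    then show "x = y" using pushout_eqI[OF po2 H'(2) x y] xy by blast
  qed
qed

text \<open>A cocone \<open>(x, y)\<close> on the second span becomes the cocone
  \<open>(x \<odot> p, y)\<close> on the outer one. The morphism \<open>k\<close> induced by it
  satisfies \<open>k \<odot> r = x\<close>, because the two agree on both legs of the first pushout.
  This is how morphisms between pushouts are later recognised as cobase changes.\<close>

lemma pushout_cancel:
  assumes po1: "is_pushout E f g p q" and po2: "is_pushout E f (h \<odot> g) t s"
    and h: "h \<in> Hom E C D" and g: "g \<in> Hom E A C" and r: "r \<in> Hom E (Cod E p) (Cod E t)"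
    and rp: "r \<odot> p = t" and rq: "r \<odot> q = s \<odot> h"
  shows "is_pushout E q h r s"
proof -
  obtain B P where H: "f \<in> Hom E A B" "p \<in> Hom E B P" "q \<in> Hom E C P"
    using po1 g by (auto simp: is_pushout_def Hom_iff)
  have hg: "h \<odot> g \<in> Hom E A D" using h g Cmp_in_Hom by blast
  obtain R where H': "t \<in> Hom E B R" "s \<in> Hom E D R"
    using po2 H(1) hg by (auto simp: is_pushout_def Hom_iff)
  have r': "r \<in> Hom E P R" using r H H' by (simp add: Hom_iff)
  show ?thesis
  proof (rule is_pushoutI)
    show "q \<in> Hom E C P" "h \<in> Hom E C D" "r \<in> Hom E P R" "s \<in> Hom E D R" "r \<odot> q = s \<odot> h"
      by fact+
  next
    fix D' x y assume x: "x \<in> Hom E P D'" and y: "y \<in> Hom E D D'" and xy: "x \<odot> q = y \<odot> h"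
    have "(x \<odot> p) \<odot> f = (x \<odot> q) \<odot> g"
      using x H g pushout_commutes[OF po1] by (simp add: cat_simps)
    also have "\<dots> = y \<odot> (h \<odot> g)" using y g h by (simp add: cat_simps xy)
    finally obtain k where k: "k \<in> Hom E R D'" "k \<odot> t = x \<odot> p" "k \<odot> s = y"
      using pushout_ex[OF po2 H'(1,2) Cmp_in_Hom[OF H(2) x] y] by metis
    have "(k \<odot> r) \<odot> p = x \<odot> p" using k r' H by (simp add: cat_simps rp)
    moreover have "(k \<odot> r) \<odot> q = x \<odot> q" using k(1) r' H H' h xy
      by (simp add: cat_simps rq k(3) Cmp_rewrite[OF k(3)])
    ultimately have "k \<odot> r = x" using pushout_eqI[OF po1 H(2) Cmp_in_Hom[OF r' k(1)] x] by blast
    then show "\<exists>h. h \<in> Hom E R D' \<and> h \<odot> r = x \<and> h \<odot> s = y" using k by blast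
  next
    fix D' x y assume x: "x \<in> Hom E R D'" and y: "y \<in> Hom E R D'"
      and xy: "x \<odot> r = y \<odot> r" "x \<odot> s = y \<odot> s"
    have "x \<odot> t = y \<odot> t" using xy(1) r' H x y
      by (simp add: cat_simps Cmp_rewrite[OF xy(1)] flip: rp)
    then show "x = y" using pushout_eqI[OF po2 H'(1) x y] xy by blast
  qed
qed

lemma pushout_unique:
  assumes po1: "is_pushout E f g p q" and po2: "is_pushout E f g p' q'"
    and \<theta>: "\<theta> \<in> Hom E (Cod E p) (Cod E p')" "\<theta> \<odot> p = p'" "\<theta> \<odot> q = q'"
  shows "is_iso E \<theta>"
proof -
  obtain A B C P where H: "f \<in> Hom E A B" "g \<in> Hom E A C" "p \<in> Hom E B P" "q \<in> Hom E C P"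
    using po1 by (rule pushout_Homs)
  obtain P' where H': "p' \<in> Hom E B P'" "q' \<in> Hom E C P'"
    using po2 H by (auto simp: is_pushout_def Hom_iff)
  obtain \<eta> where \<eta>: "\<eta> \<in> Hom E P' P" "\<eta> \<odot> p' = p" "\<eta> \<odot> q' = q"
    using pushout_ex[OF po2 H' H(3,4) pushout_commutes[OF po1]] .
  have \<theta>': "\<theta> \<in> Hom E P P'" using \<theta> H H' by (simp add: Hom_iff)
  have "\<eta> \<odot> \<theta> = Idm E P"
  proof (rule pushout_eqI[OF po1 H(3)])
    show "\<eta> \<odot> \<theta> \<in> Hom E P P" "Idm E P \<in> Hom E P P"
      using \<theta>' \<eta> Cmp_in_Hom Idm_in_Hom Hom_Ob by blast+
    show "\<eta> \<odot> \<theta> \<odot> p = Idm E P \<odot> p" "\<eta> \<odot> \<theta> \<odot> q = Idm E P \<odot> q"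
      using \<theta>' \<eta> H \<theta>(2,3) by (simp_all add: cat_simps)
  qed
  moreover have "\<theta> \<odot> \<eta> = Idm E P'"
  proof (rule pushout_eqI[OF po2 H'(1)])
    show "\<theta> \<odot> \<eta> \<in> Hom E P' P'" "Idm E P' \<in> Hom E P' P'"
      using \<theta>' \<eta> Cmp_in_Hom Idm_in_Hom Hom_Ob by blast+
    show "\<theta> \<odot> \<eta> \<odot> p' = Idm E P' \<odot> p'" "\<theta> \<odot> \<eta> \<odot> q' = Idm E P' \<odot> q'"
      using \<theta>' \<eta> H' \<theta>(2,3) by (simp_all add: cat_simps)
  qed
  ultimately show ?thesis using is_isoI \<theta>' \<eta>(1) by blast
qed

text \<open>Carries a pushout built by hand over to any other pushout of the same span, once the
  comparison morphism is known to be an isomorphism.\<close>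

lemma pushout_iso_cocone:
  assumes po: "is_pushout E f g p q" and \<theta>: "is_iso E \<theta>" "\<theta> \<in> Hom E P P'" and p: "p \<in> Hom E B P"
  shows "is_pushout E f g (\<theta> \<odot> p) (\<theta> \<odot> q)"
proof -
  obtain A C where H: "f \<in> Hom E A B" "g \<in> Hom E A C" "q \<in> Hom E C P"
    using po p by (simp add: is_pushout_def Hom_iff)
  obtain \<eta> where \<eta>: "\<eta> \<in> Hom E P' P" "\<eta> \<odot> \<theta> = Idm E P" "\<theta> \<odot> \<eta> = Idm E P'"
    using is_isoE[OF \<theta>] .
  show ?thesis
  proof (rule is_pushoutI)
    show "f \<in> Hom E A B" "g \<in> Hom E A C" "\<theta> \<odot> p \<in> Hom E B P'" "\<theta> \<odot> q \<in> Hom E C P'"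
      using H p \<theta> Cmp_in_Hom by auto
    show "\<theta> \<odot> p \<odot> f = \<theta> \<odot> q \<odot> g"
      using H p \<theta> pushout_commutes[OF po] by (simp add: cat_simps)
  next
    fix D x y assume x: "x \<in> Hom E B D" and y: "y \<in> Hom E C D" and xy: "x \<odot> f = y \<odot> g"
    obtain h where h: "h \<in> Hom E P D" "h \<odot> p = x" "h \<odot> q = y"
      using pushout_ex[OF po p H(3) x y xy] .
    have *: "(h \<odot> \<eta>) \<odot> (\<theta> \<odot> z) = h \<odot> z" if z: "z \<in> Hom E F P" for z F
    proof -
      show ?thesis using z h \<eta>(1) \<theta>(2) by (simp add: cat_simps Cmp_rewrite[OF \<eta>(2)])
    qed
    show "\<exists>h. h \<in> Hom E P' D \<and> h \<odot> (\<theta> \<odot> p) = x \<and> h \<odot> (\<theta> \<odot> q) = y"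
      using *[OF p] *[OF H(3)] h \<eta>(1) Cmp_in_Hom by blast
  next
    fix D x y assume x: "x \<in> Hom E P' D" and y: "y \<in> Hom E P' D"
      and xy: "x \<odot> (\<theta> \<odot> p) = y \<odot> (\<theta> \<odot> p)" "x \<odot> (\<theta> \<odot> q) = y \<odot> (\<theta> \<odot> q)"
    have "x \<odot> \<theta> = y \<odot> \<theta>"
    proof (rule pushout_eqI[OF po p])
      show "x \<odot> \<theta> \<in> Hom E P D" "y \<odot> \<theta> \<in> Hom E P D" using x y \<theta> Cmp_in_Hom by auto
      show "x \<odot> \<theta> \<odot> p = y \<odot> \<theta> \<odot> p" "x \<odot> \<theta> \<odot> q = y \<odot> \<theta> \<odot> q"
        using xy x y \<theta>(2) p H by (simp_all add: cat_simps)
    qed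
    then have "x \<odot> \<theta> \<odot> \<eta> = y \<odot> \<theta> \<odot> \<eta>" by simp
    then show "x = y" using x y \<eta> \<theta>(2) by (simp add: cat_simps)
  qed
qed

lemma pushout_of_iso:
  assumes f: "is_iso E f" "f \<in> Hom E A B" and g: "g \<in> Hom E A C"
    and po: "is_pushout E f g p q"
  shows "is_iso E q"
proof -
  obtain \<eta> where \<eta>: "\<eta> \<in> Hom E B A" "\<eta> \<odot> f = Idm E A" "f \<odot> \<eta> = Idm E B"
    using is_isoE[OF f] .
  obtain P where H: "p \<in> Hom E B P" "q \<in> Hom E C P"
    using po f g by (auto simp: is_pushout_def Hom_iff)
  have C: "Idm E C \<in> Hom E C C" using g Idm_in_Hom Hom_Ob by blast
  have g\<eta>: "g \<odot> \<eta> \<in> Hom E B C" using g \<eta> Cmp_in_Hom by blast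
  have "(g \<odot> \<eta>) \<odot> f = Idm E C \<odot> g" using g \<eta> f(2) by (simp add: cat_simps)
  \<comment> \<open>\<open>g \<odot> \<eta>\<close> and the identity of \<open>C\<close> form a
    cocone; the morphism induced by it is the inverse of \<open>q\<close>.\<close>
  then obtain h where h: "h \<in> Hom E P C" "h \<odot> p = g \<odot> \<eta>" "h \<odot> q = Idm E C"
    using pushout_ex[OF po H g\<eta> C] by metis
  have "q \<odot> h = Idm E P"
  proof (rule pushout_eqI[OF po H(1)])
    show "q \<odot> h \<in> Hom E P P" "Idm E P \<in> Hom E P P"
      using h H Cmp_in_Hom Idm_in_Hom Hom_Ob by blast+
    have "q \<odot> h \<odot> p = (q \<odot> g) \<odot> \<eta>" using h H g \<eta>(1) by (simp add: cat_simps)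
    also have "\<dots> = (p \<odot> f) \<odot> \<eta>" using pushout_commutes[OF po] by simp
    also have "\<dots> = Idm E P \<odot> p" using H f(2) \<eta> Hom_Ob(1)[OF H(1)] by (simp add: cat_simps)
    finally show "q \<odot> h \<odot> p = Idm E P \<odot> p" .
    show "q \<odot> h \<odot> q = Idm E P \<odot> q" using h H by (simp add: cat_simps)
  qed
  then show ?thesis using is_isoI[OF H(2) h(1) h(3)] by blast
qed

lemma iso_Cmp:
  assumes "is_iso E f" "f \<in> Hom E A B" "is_iso E g" "g \<in> Hom E B C"
  shows "is_iso E (g \<odot> f)"
proof -
  obtain f' where f': "f' \<in> Hom E B A" "f' \<odot> f = Idm E A" "f \<odot> f' = Idm E B" using assms is_isoE
    by metis
  obtain g' where g': "g' \<in> Hom E C B" "g' \<odot> g = Idm E B" "g \<odot> g' = Idm E C" using assms is_isoE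
    by metis
  show ?thesis
  proof (rule is_isoI)
    show "g \<odot> f \<in> Hom E A C" "f' \<odot> g' \<in> Hom E C A" using assms f' g' Cmp_in_Hom by auto
    show "f' \<odot> g' \<odot> (g \<odot> f) = Idm E A" 
      using assms(2,4) f' g' by (simp add: cat_simps Cmp_rewrite[OF g'(2)])
    show "g \<odot> f \<odot> (f' \<odot> g') = Idm E C"
      using assms(2,4) f' g' by (simp add: cat_simps Cmp_rewrite[OF f'(3)])
  qed
qed

lemma iso_cancel_right:
  assumes p: "is_iso E p" "p \<in> Hom E A B" and u: "u \<in> Hom E B C" and up: "is_iso E (u \<odot> p)"
  shows "is_iso E u"
proof -
  obtain p' where p': "p' \<in> Hom E B A" "p' \<odot> p = Idm E A" "p \<odot> p' = Idm E B" using is_isoE[OF p] .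
  have "is_iso E p'" using is_isoI[OF p'(1) p(2) p'(3,2)] .
  moreover have "u \<odot> p \<in> Hom E A C" using p u Cmp_in_Hom by auto
  ultimately have "is_iso E ((u \<odot> p) \<odot> p')" using iso_Cmp[OF _ p'(1) up] by blast
  then show ?thesis using u p(2) p' by (simp add: cat_simps)
qed

text \<open>Colimits commute with colimits. The names anticipate the situation at one vertex:
  \<open>lA\<close>, \<open>lB\<close>, \<open>lC\<close>, \<open>lP\<close> are latching morphisms,
  \<open>La\<close>, \<open>Lb\<close>, \<open>Lc\<close>, \<open>Le\<close> lead to the latching
  objects of the primed representations, and \<open>SA\<close> is the pushout of \<open>A\<close>
  and \<open>LA'\<close> over \<open>LA\<close>, likewise \<open>SB\<close>, \<open>SC\<close>,
  \<open>SP\<close>. A cocone on the span of \<open>sF\<close> and \<open>sG\<close> yields one on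
  the span of \<open>F\<close> and \<open>G\<close> and one on that of \<open>LF'\<close> and
  \<open>LG'\<close>; the morphisms \<open>h1\<close>, \<open>h2\<close> induced by these glue to
  one out of \<open>SP\<close>.\<close>

lemma pushout_of_pushouts:
  assumes poA: "is_pushout E lA La pA qA" and poB: "is_pushout E lB Lb pB qB"
    and poC: "is_pushout E lC Lc pC qC" and poP: "is_pushout E lP Le pP qP"
    and poL: "is_pushout E LF LG LH LK" and poL': "is_pushout E LF' LG' LH' LK'"
    and po: "is_pushout E F G H K"
    and homs: "pA \<in> Hom E A SA" "pB \<in> Hom E B SB" "pC \<in> Hom E C SC" "pP \<in> Hom E P SP"
      "qA \<in> Hom E LA' SA" "qB \<in> Hom E LB' SB" "qC \<in> Hom E LC' SC" "qP \<in> Hom E LP' SP"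
      "F \<in> Hom E A B" "G \<in> Hom E A C" "H \<in> Hom E B P" "K \<in> Hom E C P"
      "LF' \<in> Hom E LA' LB'" "LG' \<in> Hom E LA' LC'" "LH' \<in> Hom E LB' LP'" "LK' \<in> Hom E LC' LP'"
      "LH \<in> Hom E LB LP" "LK \<in> Hom E LC LP"
      "lB \<in> Hom E LB B" "lC \<in> Hom E LC C" "lP \<in> Hom E LP P"
      "Lb \<in> Hom E LB LB'" "Lc \<in> Hom E LC LC'" "Le \<in> Hom E LP LP'"
      "sF \<in> Hom E SA SB" "sG \<in> Hom E SA SC" "sH \<in> Hom E SB SP" "sK \<in> Hom E SC SP"
    and eqs: "sF \<odot> pA = pB \<odot> F" "sF \<odot> qA = qB \<odot> LF'" "sG \<odot> pA = pC \<odot> G" "sG \<odot> qA = qC \<odot> LG'"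
      "sH \<odot> pB = pP \<odot> H" "sH \<odot> qB = qP \<odot> LH'" "sK \<odot> pC = pP \<odot> K" "sK \<odot> qC = qP \<odot> LK'"
      "lP \<odot> LH = H \<odot> lB" "lP \<odot> LK = K \<odot> lC" "Le \<odot> LH = LH' \<odot> Lb" "Le \<odot> LK = LK' \<odot> Lc"
  shows "is_pushout E sF sG sH sK"
proof -
  note com = pushout_commutes[OF po] pushout_commutes[OF poL'] pushout_commutes[OF poB]
      pushout_commutes[OF poC]
  note rw = eqs com eqs[THEN Cmp_rewrite] com[THEN Cmp_rewrite]
  note H = homs[unfolded Hom_iff]
  show ?thesis
  proof (rule is_pushoutI)
    show "sF \<in> Hom E SA SB" "sG \<in> Hom E SA SC" "sH \<in> Hom E SB SP" "sK \<in> Hom E SC SP" by fact+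
    show "sH \<odot> sF = sK \<odot> sG"
    proof (rule pushout_eqI[OF poA homs(1)])
      show "sH \<odot> sF \<in> Hom E SA SP" "sK \<odot> sG \<in> Hom E SA SP" using H by (simp_all add: cat_simps)
      show "sH \<odot> sF \<odot> pA = sK \<odot> sG \<odot> pA" "sH \<odot> sF \<odot> qA = sK \<odot> sG \<odot> qA"
        using H by (simp_all add: cat_simps rw)
    qed
  next
    fix D x y assume x: "x \<in> Hom E SB D" and y: "y \<in> Hom E SC D" and xy: "x \<odot> sF = y \<odot> sG"
    note H = H x[unfolded Hom_iff] y[unfolded Hom_iff]
    have "(x \<odot> pB) \<odot> F = (y \<odot> pC) \<odot> G"
    proof -
      have "(x \<odot> pB) \<odot> F = (x \<odot> sF) \<odot> pA" using H by (simp add: cat_simps eqs(1))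
      also have "\<dots> = (y \<odot> pC) \<odot> G" unfolding xy using H by (simp add: cat_simps eqs)
      finally show ?thesis .
    qed
    moreover have "x \<odot> pB \<in> Hom E B D" "y \<odot> pC \<in> Hom E C D" using H by (simp_all add: cat_simps)
    ultimately obtain h1 where h1: "h1 \<in> Hom E P D" "h1 \<odot> H = x \<odot> pB" "h1 \<odot> K = y \<odot> pC"
      using pushout_ex[OF po homs(11,12)] by metis
    have "(x \<odot> qB) \<odot> LF' = (y \<odot> qC) \<odot> LG'"
    proof -
      have "(x \<odot> qB) \<odot> LF' = (x \<odot> sF) \<odot> qA" using H by (simp add: cat_simps eqs(2))
      also have "\<dots> = (y \<odot> qC) \<odot> LG'" unfolding xy using H by (simp add: cat_simps eqs)
      finally show ?thesis .
    qed
    moreover have "x \<odot> qB \<in> Hom E LB' D" "y \<odot> qC \<in> Hom E LC' D" using H by (simp_all add: cat_simps)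
    ultimately obtain h2 where h2: "h2 \<in> Hom E LP' D" "h2 \<odot> LH' = x \<odot> qB" "h2 \<odot> LK' = y \<odot> qC"
      using pushout_ex[OF poL' homs(15,16)] by metis
    note H = H h1(1)[unfolded Hom_iff] h2(1)[unfolded Hom_iff]
    note rw' = rw h1(2,3) h1(2,3)[THEN Cmp_rewrite] h2(2,3) h2(2,3)[THEN Cmp_rewrite]
    \<comment> \<open>\<open>LP\<close> is itself a pushout, so it suffices to compare on
      \<open>LB\<close> and \<open>LC\<close>, where both sides come from \<open>x\<close>, resp.
      \<open>y\<close>.\<close>
    have "h1 \<odot> lP = h2 \<odot> Le"
    proof (rule pushout_eqI[OF poL homs(17)])
      show "h1 \<odot> lP \<in> Hom E LP D" "h2 \<odot> Le \<in> Hom E LP D" using H by (simp_all add: cat_simps)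
      show "h1 \<odot> lP \<odot> LH = h2 \<odot> Le \<odot> LH" "h1 \<odot> lP \<odot> LK = h2 \<odot> Le \<odot> LK"
        using H by (simp_all add: cat_simps rw')
    qed
    then obtain h where h: "h \<in> Hom E SP D" "h \<odot> pP = h1" "h \<odot> qP = h2"
      using pushout_ex[OF poP homs(4,8) h1(1) h2(1)] by metis
    note H = H h(1)[unfolded Hom_iff]
    note rw' = rw' h(2,3) h(2,3)[THEN Cmp_rewrite]
    have "h \<odot> sH = x"
    proof (rule pushout_eqI[OF poB homs(2) _ x])
      show "h \<odot> sH \<in> Hom E SB D" using H by (simp add: cat_simps)
      show "h \<odot> sH \<odot> pB = x \<odot> pB" "h \<odot> sH \<odot> qB = x \<odot> qB" using H by (simp_all add: cat_simps rw')
    qed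
    moreover have "h \<odot> sK = y"
    proof (rule pushout_eqI[OF poC homs(3) _ y])
      show "h \<odot> sK \<in> Hom E SC D" using H by (simp add: cat_simps)
      show "h \<odot> sK \<odot> pC = y \<odot> pC" "h \<odot> sK \<odot> qC = y \<odot> qC" using H by (simp_all add: cat_simps rw')
    qed
    ultimately show "\<exists>h. h \<in> Hom E SP D \<and> h \<odot> sH = x \<and> h \<odot> sK = y" using h(1) by blast
  next
    fix D x y assume x: "x \<in> Hom E SP D" and y: "y \<in> Hom E SP D"
      and xy: "x \<odot> sH = y \<odot> sH" "x \<odot> sK = y \<odot> sK"
    note H = H x[unfolded Hom_iff] y[unfolded Hom_iff]
    have *: "x \<odot> (sH \<odot> z) = y \<odot> (sH \<odot> z)" if "z \<in> Mor E" "Cod E z = SB" for z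
      using Cmp_rewrite[OF xy(1), of z] that H by (simp add: cat_simps)
    have **: "x \<odot> (sK \<odot> z) = y \<odot> (sK \<odot> z)" if "z \<in> Mor E" "Cod E z = SC" for z
      using Cmp_rewrite[OF xy(2), of z] that H by (simp add: cat_simps)
    show "x = y"
    proof (rule pushout_eqI[OF poP homs(4) x y])
      show "x \<odot> pP = y \<odot> pP"
      proof (rule pushout_eqI[OF po homs(11)])
        show "x \<odot> pP \<in> Hom E P D" "y \<odot> pP \<in> Hom E P D" using H by (simp_all add: cat_simps)
        show "x \<odot> pP \<odot> H = y \<odot> pP \<odot> H" using *[of pB] H by (simp add: cat_simps rw)
        show "x \<odot> pP \<odot> K = y \<odot> pP \<odot> K" using **[of pC] H by (simp add: cat_simps rw)
      qed
      show "x \<odot> qP = y \<odot> qP"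
      proof (rule pushout_eqI[OF poL' homs(15)])
        show "x \<odot> qP \<in> Hom E LP' D" "y \<odot> qP \<in> Hom E LP' D" using H by (simp_all add: cat_simps)
        show "x \<odot> qP \<odot> LH' = y \<odot> qP \<odot> LH'" using *[of qB] H by (simp add: cat_simps rw)
        show "x \<odot> qP \<odot> LK' = y \<odot> qP \<odot> LK'" using **[of qC] H by (simp add: cat_simps rw)
      qed
    qed
  qed
qed

end

section \<open>Corner maps of squares\<close>

text \<open>
  The square from the arrow \<open>l : L \<rightarrow> X\<close> to \<open>l' : L' \<rightarrow> X'\<close> with sides \<open>m : L \<rightarrow> L'\<close> and \<open>f : X \<rightarrow> X'\<close>
  commutes and its corner map, out of the pushout of \<open>X\<close> and \<open>L'\<close> over \<open>L\<close>, lies in \<open>K\<close>.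
\<close>

definition corner_in :: "('o, 'm) category \<Rightarrow> 'm set \<Rightarrow> 'm \<Rightarrow> 'm \<Rightarrow> 'm \<Rightarrow> 'm \<Rightarrow> bool" where
  "corner_in E K l l' m f \<longleftrightarrow> (\<exists>p q u. is_pushout E l m p q \<and> u \<in> K \<and>
     u \<in> Hom E (Cod E p) (Cod E f) \<and> u \<odot>\<^bsub>E\<^esub> p = f \<and> u \<odot>\<^bsub>E\<^esub> q = l')"

context category
begin

lemma corner_inI:
  assumes "is_pushout E l m p q" "p \<in> Hom E X P" "f \<in> Hom E X X'" "u \<in> Hom E P X'"
    and "u \<in> K" "u \<odot> p = f" "u \<odot> q = l'"
  shows "corner_in E K l l' m f"
  using assms(1,5-7) assms(2-4)[unfolded Hom_iff] unfolding corner_in_def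
  by (intro exI[of _ p] exI[of _ q] exI[of _ u]) (simp add: Hom_iff)

end

section \<open>Corner maps in a Waldhausen category: composition, cobase change, gluing\<close>

context waldhausen_category
begin

lemma Cof_comp: "f \<in> Cof \<Longrightarrow> g \<in> Cof \<Longrightarrow> Cod E f = Dom E g \<Longrightarrow> g \<odot> f \<in> Cof"
  using Cof_Cmp by (auto simp: closed_under_composition_def)

lemma CofD: "f \<in> Cof \<Longrightarrow> f \<in> Mor E"
  using Cof_Mor by blast

lemma pushout_Cof': "g \<in> Cof \<Longrightarrow> is_pushout E f g p q \<Longrightarrow> p \<in> Cof"
  using pushout_Cof pushout_sym by blast

lemma pushout_ofE:
  assumes "f \<in> Cof" "f \<in> Hom E A B" "g \<in> Hom E A C"
  obtains p q P where "is_pushout E f g p q" "p \<in> Hom E B P" "q \<in> Hom E C P"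
proof -
  obtain p q where "is_pushout E f g p q"
    using ex_pushout[OF assms(1), of g] assms(2,3) unfolding Hom_iff by metis
  moreover from this obtain P where "p \<in> Hom E B P" "q \<in> Hom E C P"
    using assms(2,3) by (elim pushout_Homs) (simp add: Hom_iff)
  ultimately show thesis using that by blast
qed

text \<open>
  What cofibrations and weak equivalences have in common: besides closure properties, cobase change
  along \<open>h\<close> of a morphism \<open>u\<close> under the domain of \<open>h\<close> preserves \<open>K\<close>, provided that \<open>u\<close> goes between
  cofibrant objects under that domain.
\<close>

definition corner_class :: "'m set \<Rightarrow> bool" where
  "corner_class K \<longleftrightarrow> K \<subseteq> Mor E \<and> closed_under_composition E K \<and> (\<forall>f. is_iso E f \<longrightarrow> f \<in> K) \<and>
     (\<forall>q u h r s r' s' v. u \<in> K \<longrightarrow> q \<in> Cof \<longrightarrow> Cod E q = Dom E u \<longrightarrow> u \<odot> q \<in> Cof \<longrightarrow>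
        is_pushout E q h r s \<longrightarrow> is_pushout E (u \<odot> q) h r' s' \<longrightarrow> v \<in> Hom E (Cod E r) (Cod E r') \<longrightarrow>
        v \<odot> r = r' \<odot> u \<longrightarrow> v \<odot> s = s' \<longrightarrow> v \<in> K)"

text \<open>Here \<open>v\<close> is a cobase change of \<open>u\<close>: cancelling the pushout of
  \<open>q\<close> from that of \<open>u \<odot> q\<close> leaves a pushout square with the opposite
  sides \<open>u\<close> and \<open>v\<close>.\<close>

lemma corner_class_Cof: "corner_class Cof"
  unfolding corner_class_def
proof (intro conjI allI impI)
  fix q u h r s r' s' v
  assume u: "u \<in> Cof" and q: "q \<in> Cof" and uq: "Cod E q = Dom E u"
    and po: "is_pushout E q h r s" and po': "is_pushout E (u \<odot> q) h r' s'"
    and v: "v \<in> Hom E (Cod E r) (Cod E r')" "v \<odot> r = r' \<odot> u" "v \<odot> s = s'"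
  have "v \<in> Hom E (Cod E s) (Cod E s')" "u \<in> Hom E (Cod E q) (Cod E u)"
      "q \<in> Hom E (Dom E h) (Cod E q)"
    using v po po' uq CofD[OF u] by (auto simp: is_pushout_def Hom_iff)
  then have "is_pushout E r u v r'"
    using pushout_cancel[OF pushout_sym[OF po] pushout_sym[OF po']] v by blast
  then show "v \<in> Cof" using u pushout_Cof' by blast
qed (use Cof_Mor Cof_Cmp iso_Cof in auto)

text \<open>This is the gluing lemma for \<open>u\<close> in the middle of two identities, on
  \<open>Dom E q\<close> and on \<open>Cod E h\<close>. Its two cofibrations are \<open>q\<close>
  and \<open>u \<odot> q\<close>, whence the condition on \<open>u \<odot> q\<close> in
  \<open>corner_class\<close>.\<close>

lemma corner_class_W: "corner_class W"
  unfolding corner_class_def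
proof (intro conjI allI impI)
  fix q u h r s r' s' v
  assume u: "u \<in> W" and q: "q \<in> Cof" and uq: "Cod E q = Dom E u" and uqC: "u \<odot> q \<in> Cof"
    and po: "is_pushout E q h r s" and po': "is_pushout E (u \<odot> q) h r' s'"
    and v: "v \<in> Hom E (Cod E r) (Cod E r')" "v \<odot> r = r' \<odot> u" "v \<odot> s = s'"
  have u': "u \<in> Mor E" using u W_Mor by blast
  have H: "q \<in> Mor E" "h \<in> Mor E" "s \<in> Mor E" "s' \<in> Mor E" "Dom E h = Dom E q"
    "Dom E s = Cod E h" "Dom E s' = Cod E h"
    using po po' by (auto simp: is_pushout_def)
  have Ob: "Dom E q \<in> Ob E" "Cod E h \<in> Ob E" using H Dom_in_Ob Cod_in_Ob by auto
  show "v \<in> W"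
  proof (rule gluing[OF q uqC po po' _ u])
    show "Idm E (Dom E q) \<in> W" "Idm E (Cod E h) \<in> W" using iso_W is_iso_Idm Ob by auto
  qed (use H Ob u' uq v in \<open>simp_all add: cat_simps\<close>)
qed (use W_Mor W_Cmp iso_W in auto)

text \<open>The cobase change \<open>p\<close> of the isomorphism \<open>m\<close> is an
  isomorphism, hence so is the corner map \<open>u\<close>, because \<open>u \<odot> p = f\<close>
  is one.\<close>

lemma corner_in_iso:
  assumes K: "corner_class K" and l: "l \<in> Cof" "l \<in> Hom E L X" and l': "l' \<in> Hom E L' X'"
    and m: "is_iso E m" "m \<in> Hom E L L'" and f: "is_iso E f" "f \<in> Hom E X X'"
    and sq: "f \<odot> l = l' \<odot> m"
  shows "corner_in E K l l' m f"
proof -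
  obtain p q P where po: "is_pushout E l m p q" and H: "p \<in> Hom E X P" "q \<in> Hom E L' P"
    using pushout_ofE[OF l m(2)] .
  obtain u where u: "u \<in> Hom E P X'" "u \<odot> p = f" "u \<odot> q = l'"
    using pushout_ex[OF po H f(2) l' sq] .
  have "is_iso E p" using pushout_of_iso[OF m l(2) pushout_sym[OF po]] .
  then have "is_iso E u" using iso_cancel_right[OF _ H(1) u(1)] u f by simp
  then have "u \<in> K" using K by (simp add: corner_class_def)
  then show ?thesis by (rule corner_inI[OF po H(1) f(2) u(1) _ u(2,3)])
qed

text \<open>\<open>l'\<close> is the cobase change \<open>q\<close> of \<open>l\<close> followed by
  the corner map. This keeps pushouts of representations inside \<open>R\<close>.\<close>

lemma corner_in_target:
  assumes c: "corner_in E Cof l l' m f" and l: "l \<in> Cof"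
  shows "l' \<in> Cof"
proof -
  obtain p q u where po: "is_pushout E l m p q" and u: "u \<in> Cof"
    "u \<in> Hom E (Cod E p) (Cod E f)" "u \<odot> p = f" "u \<odot> q = l'"
    using c by (auto simp: corner_in_def)
  have "q \<in> Cof" using pushout_Cof[OF l po] .
  moreover have "Cod E q = Dom E u" using po u by (simp add: is_pushout_def Hom_iff)
  ultimately show ?thesis using Cof_comp u by metis
qed

text \<open>\<open>f\<close> is the cobase change \<open>p\<close> of \<open>m\<close> followed by
  the corner map. With \<open>m\<close> = L_i(f) this is the inductive step towards vertexwise
  cofibrations.\<close>

lemma corner_in_bottom:
  assumes c: "corner_in E Cof l l' m f" and m: "m \<in> Cof"
  shows "f \<in> Cof"
proof -
  obtain p q u where po: "is_pushout E l m p q" and u: "u \<in> Cof"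
    "u \<in> Hom E (Cod E p) (Cod E f)" "u \<odot> p = f" "u \<odot> q = l'"
    using c by (auto simp: corner_in_def)
  have "p \<in> Cof" using pushout_Cof'[OF m po] .
  moreover have "Cod E p = Dom E u" using po u by (simp add: is_pushout_def Hom_iff)
  ultimately show ?thesis using Cof_comp u by metis
qed

text \<open>\<open>corner_in\<close> names no objects, so the types of the other sides have to be
  recovered from the pushout and the corner map.\<close>

lemma corner_in_Homs:
  assumes "corner_in E K l l' m f" "l \<in> Hom E L X"
  shows "m \<in> Hom E L (Dom E l')" "f \<in> Hom E X (Cod E l')" "l' \<in> Hom E (Cod E m) (Cod E f)"
    "f \<odot> l = l' \<odot> m"
proof -
  obtain p q u where po: "is_pushout E l m p q" and u: 
    "u \<in> Hom E (Cod E p) (Cod E f)" "u \<odot> p = f" "u \<odot> q = l'"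
    using assms by (auto simp: corner_in_def)
  obtain C P where H: "m \<in> Hom E L C" "p \<in> Hom E X P" "q \<in> Hom E C P"
    using po assms(2) by (auto simp: is_pushout_def Hom_iff)
  then have H': "f \<in> Hom E X (Cod E f)" "l' \<in> Hom E C (Cod E f)"
    using Cmp_in_Hom[of p X P u "Cod E f"] Cmp_in_Hom[of q C P u "Cod E f"] u
      by (simp_all add: Hom_iff)
  then show "m \<in> Hom E L (Dom E l')" "f \<in> Hom E X (Cod E l')" "l' \<in> Hom E (Cod E m) (Cod E f)"
    using H by (auto simp: Hom_iff)
  show "f \<odot> l = l' \<odot> m" 
    using Cmp_assoc[OF assms(2) H(2), of u "Cod E f"] Cmp_assoc[OF H(1,3), of u "Cod E f"] u H
      pushout_commutes[OF po] by (simp add: Hom_iff)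
qed

text \<open>The corner map of the composite square factors as \<open>v : T -> S'\<close> followed by
  \<open>u'\<close>, where \<open>T\<close> is the pushout of \<open>X\<close> and
  \<open>L''\<close> over \<open>L\<close>. The morphism \<open>v\<close> is the exchange of
  \<open>u\<close> along \<open>m'\<close>, and the exchange property of \<open>corner_class\<close>
  applies because \<open>u \<odot> q\<close> is the cofibration \<open>l'\<close>.\<close>

lemma corner_in_comp:
  assumes K: "corner_class K" and l: "l \<in> Cof" "l' \<in> Cof"
    and c: "corner_in E K l l' m f" and c': "corner_in E K l' l'' m' f'"
  shows "corner_in E K l l'' (m' \<odot> m) (f' \<odot> f)"
proof -
  obtain p q u where po: "is_pushout E l m p q" and u: "u \<in> K"
    "u \<in> Hom E (Cod E p) (Cod E f)" "u \<odot> p = f" "u \<odot> q = l'"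
    using c by (auto simp: corner_in_def)
  obtain p' q' u' where po': "is_pushout E l' m' p' q'" and u': "u' \<in> K"
    "u' \<in> Hom E (Cod E p') (Cod E f')" "u' \<odot> p' = f'" "u' \<odot> q' = l''"
    using c' by (auto simp: corner_in_def)
  obtain L X L' S where H: "l \<in> Hom E L X" "m \<in> Hom E L L'" "p \<in> Hom E X S" "q \<in> Hom E L' S"
    using po by (rule pushout_Homs)
  have l': "l' \<in> Hom E L' (Cod E f)" and f: "f \<in> Hom E X (Cod E f)"
    using corner_in_Homs[OF c H(1)] H(2) by (auto simp: Hom_iff)
  obtain L'' S' where H': "m' \<in> Hom E L' L''" "p' \<in> Hom E (Cod E f) S'" "q' \<in> Hom E L'' S'"
    using po' l' by (auto simp: is_pushout_def Hom_iff)
  have q: "q \<in> Cof" using pushout_Cof[OF l(1) po] .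
  then obtain r s T where poT: "is_pushout E q m' r s" and T: "r \<in> Hom E S T" "s \<in> Hom E L'' T"
    using pushout_ofE[OF _ H(4) H'(1)] by blast
  have uH: "u \<in> Hom E S (Cod E f)" and u'H: "u' \<in> Hom E S' (Cod E f')" using u u' H H'
    by (simp_all add: Hom_iff)
  have "(p' \<odot> u) \<odot> q = q' \<odot> m'" using uH H H' u(4) pushout_commutes[OF po'] by (simp add: cat_simps)
  then obtain v where v: "v \<in> Hom E T S'" "v \<odot> r = p' \<odot> u" "v \<odot> s = q'"
    using pushout_ex[OF poT T Cmp_in_Hom[OF uH H'(2)] H'(3)] by metis
  have "\<lbrakk>u \<in> K; q \<in> Cof; Cod E q = Dom E u; u \<odot> q \<in> Cof; is_pushout E q m' r s;
      is_pushout E (u \<odot> q) m' p' q'; v \<in> Hom E (Cod E r) (Cod E p'); v \<odot> r = p' \<odot> u; v \<odot> s = q'\<rbrakk> \<Longrightarrow> v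
          \<in> K"
    using K unfolding corner_class_def by blast
  then have "v \<in> K" using u(1,4) q H l(2) poT po' v uH T H' by (simp add: Hom_iff)
  then have "u' \<odot> v \<in> K"
    using K u'(1) u'H v(1) by (auto simp: corner_class_def closed_under_composition_def Hom_iff)
  moreover have "is_pushout E l (m' \<odot> m) (r \<odot> p) s" using pushout_paste[OF po poT] .
  moreover have "u' \<odot> v \<in> Hom E (Cod E (r \<odot> p)) (Cod E (f' \<odot> f))"
    "(u' \<odot> v) \<odot> (r \<odot> p) = f' \<odot> f" "(u' \<odot> v) \<odot> s = l''"
  proof -
    have f': "f' \<in> Hom E (Cod E f) (Cod E f')"
      using corner_in_Homs(2)[OF c' l'] by (auto simp: Hom_iff)
    show "u' \<odot> v \<in> Hom E (Cod E (r \<odot> p)) (Cod E (f' \<odot> f))"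
      using f f' u'H v(1) T H by (simp add: cat_simps)
    show "(u' \<odot> v) \<odot> (r \<odot> p) = f' \<odot> f"
      using f f' u'H v(1) T H uH H' u(3) u'(3)
      by (simp add: cat_simps v Cmp_rewrite[OF v(2)] Cmp_rewrite[OF u'(3)])
    show "(u' \<odot> v) \<odot> s = l''" using u'H v T u'(4) by (simp add: cat_simps)
  qed
  ultimately show ?thesis unfolding corner_in_def by blast
qed

text \<open>The new corner map is a cobase change of the old one.\<close>

lemma corner_in_pushout_square:
  assumes c: "corner_in E Cof lA lB LF F" and lC: "lC \<in> Cof"
    and poL: "is_pushout E LF LG LH LK" and po: "is_pushout E F G H K"
    and homs: "lA \<in> Hom E LA A" "lC \<in> Hom E LC C" "LG \<in> Hom E LA LC" "G \<in> Hom E A C"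
      "lP \<in> Hom E (Cod E LH) (Cod E H)"
    and sq: "G \<odot> lA = lC \<odot> LG" "lP \<odot> LH = H \<odot> lB" "lP \<odot> LK = K \<odot> lC"
  shows "corner_in E Cof lC lP LK K"
proof -
  obtain p q u where poS: "is_pushout E lA LF p q" and u: "u \<in> Cof"
    "u \<in> Hom E (Cod E p) (Cod E F)" "u \<odot> p = F" "u \<odot> q = lB"
    using c by (auto simp: corner_in_def)
  obtain LB LP where HL: "LF \<in> Hom E LA LB" "LH \<in> Hom E LB LP" "LK \<in> Hom E LC LP"
    using poL homs by (auto simp: is_pushout_def Hom_iff)
  obtain B P where H: "F \<in> Hom E A B" "H \<in> Hom E B P" "K \<in> Hom E C P"
    using po homs by (auto simp: is_pushout_def Hom_iff)
  have lB: "lB \<in> Hom E LB B" using corner_in_Homs[OF c homs(1)] HL H by (auto simp: Hom_iff)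
  have lP: "lP \<in> Hom E LP P" using homs HL H by (simp add: Hom_iff)
  obtain S where S: "p \<in> Hom E A S" "q \<in> Hom E LB S" "u \<in> Hom E S B"
    using poS homs HL H u(2) by (auto simp: is_pushout_def Hom_iff)
  obtain p' q' T where poT: "is_pushout E lC LK p' q'" and T: "p' \<in> Hom E C T" "q' \<in> Hom E LP T"
    using pushout_ofE[OF lC homs(2) HL(3)] .
  obtain v where v: "v \<in> Hom E T P" "v \<odot> p' = K" "v \<odot> q' = lP"
    using pushout_ex[OF poT T H(3) lP] sq(3) by metis
  note hs = HL H lB lP S T homs v(1)
  have outer: "is_pushout E LF (G \<odot> lA) (q' \<odot> LH) p'"
    using pushout_paste[OF poL pushout_sym[OF poT]] sq(1) by simp
  have "(q' \<odot> LH) \<odot> LF = (p' \<odot> G) \<odot> lA" using pushout_commutes[OF outer] hs by (simp add: cat_simps)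
  then obtain r where r: "r \<in> Hom E S T" "r \<odot> q = q' \<odot> LH" "r \<odot> p = p' \<odot> G"
    using pushout_ex[OF pushout_sym[OF poS] S(2,1), of "q' \<odot> LH" T "p' \<odot> G"] hs
    by (auto simp: cat_simps)
  \<comment> \<open>\<open>LA -> LC -> C\<close> equals \<open>LA -> A -> C\<close>; cancelling the
    pushout \<open>S\<close> from the outer square therefore shows that \<open>T\<close> is also the
    pushout of \<open>S\<close> and \<open>C\<close> over \<open>A\<close>.\<close>
  have po1: "is_pushout E p G r p'"
    using pushout_cancel[OF pushout_sym[OF poS] outer homs(4,1) _ r(2,3)] r(1) hs
      by (simp add: cat_simps)
  have vr: "v \<odot> r = H \<odot> u"
  proof (rule pushout_eqI[OF poS S(1)])
    show "v \<odot> r \<in> Hom E S P" "H \<odot> u \<in> Hom E S P" using hs r(1) by (simp_all add: cat_simps)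
    show "v \<odot> r \<odot> p = H \<odot> u \<odot> p"
      using hs r(1) u(3) pushout_commutes[OF po] by (simp add: cat_simps r(3) Cmp_rewrite[OF v(2)])
    show "v \<odot> r \<odot> q = H \<odot> u \<odot> q"
      using hs r(1) u(4) sq by (simp add: cat_simps r(2) Cmp_rewrite[OF v(3)])
  qed
  \<comment> \<open>\<open>P\<close> is the cobase change of \<open>F = u \<odot> p\<close> along
    \<open>G\<close>, and \<open>T\<close> that of \<open>p\<close>; what remains after cancelling
    is \<open>v\<close> as the cobase change of \<open>u\<close> along \<open>r\<close>.\<close>
  have po2: "is_pushout E G (u \<odot> p) K H" using pushout_sym[OF po] u by simp
  have "is_pushout E r u v H"
    by (rule pushout_cancel[OF pushout_sym[OF po1] po2 S(3,1) _ v(2) vr])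
        (use hs in \<open>simp add: Hom_iff\<close>)
  then have "v \<in> Cof" using pushout_Cof' u(1) by blast
  then show ?thesis by (rule corner_inI[OF poT T(1) H(3) v(1) _ v(2,3)])
qed

text \<open>\<open>sF\<close> is a cobase change of \<open>LF'\<close> followed by one of the corner map of the square \<open>(LF, F)\<close>.\<close>

lemma corner_map_Cof:
  assumes c: "corner_in E Cof lA lB LF F" and LF': "LF' \<in> Cof" "LF' \<in> Hom E LA' LB'"
    and poA: "is_pushout E lA La pA qA" and poB: "is_pushout E lB Lb pB qB"
    and homs: "lA \<in> Hom E LA A" "La \<in> Hom E LA LA'" "pA \<in> Hom E A SA" "pB \<in> Hom E B SB"
      "Lb \<in> Hom E LB LB'" "sF \<in> Hom E SA SB"
    and eqs: "Lb \<odot> LF = LF' \<odot> La" "sF \<odot> pA = pB \<odot> F" "sF \<odot> qA = qB \<odot> LF'"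
  shows "sF \<in> Cof"
proof -
  obtain p q u where poS: "is_pushout E lA LF p q" and u: "u \<in> Cof"
    "u \<in> Hom E (Cod E p) (Cod E F)" "u \<odot> p = F" "u \<odot> q = lB"
    using c by (auto simp: corner_in_def)
  have H1: "qA \<in> Hom E LA' SA" using poA homs by (auto simp: is_pushout_def Hom_iff)
  have H2: "lB \<in> Hom E LB B" "qB \<in> Hom E LB' SB" using poB homs
    by (auto simp: is_pushout_def Hom_iff)
  have H3: "F \<in> Hom E A B" "LF \<in> Hom E LA LB"
    using corner_in_Homs[OF c homs(1)] H2 by (auto simp: Hom_iff)
  obtain S where S: "p \<in> Hom E A S" "q \<in> Hom E LB S" "u \<in> Hom E S B"
    using poS homs H3 u(2) by (auto simp: is_pushout_def Hom_iff)
  \<comment> \<open>\<open>T\<close> is the pushout of \<open>A\<close> and \<open>LB'\<close> over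
    \<open>LA\<close> and lies between \<open>SA\<close> and \<open>SB\<close>: \<open>tq\<close>
    replaces \<open>LA'\<close> by \<open>LB'\<close>, and \<open>z\<close> below replaces
    \<open>A\<close> by \<open>B\<close>.\<close>
  obtain tq tb T where poT: "is_pushout E LF' qA tb tq" and T: "tq \<in> Hom E SA T" "tb \<in> Hom E LB' T"
    using pushout_ofE[OF LF' H1] by metis
  obtain z where z: "z \<in> Hom E T SB" "z \<odot> tb = qB" "z \<odot> tq = sF"
    using pushout_ex[OF poT T(2,1) H2(2) homs(6)] eqs(3) by metis
  note hs = H1 H2 H3 S T LF'(2) homs z(1)
  have "is_pushout E lA (LF' \<odot> La) (tq \<odot> pA) tb"
    using pushout_paste[OF poA pushout_sym[OF poT]] .
  then have outer: "is_pushout E lA (Lb \<odot> LF) (tq \<odot> pA) tb" using eqs(1) by simp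
  have "(tq \<odot> pA) \<odot> lA = (tb \<odot> Lb) \<odot> LF" using pushout_commutes[OF outer] hs
    by (simp add: cat_simps)
  then obtain r where r: "r \<in> Hom E S T" "r \<odot> p = tq \<odot> pA" "r \<odot> q = tb \<odot> Lb"
    using pushout_ex[OF poS S(1,2), of "tq \<odot> pA" T "tb \<odot> Lb"] hs by (auto simp: cat_simps)
  \<comment> \<open>Because \<open>LF' \<odot> La\<close> is also \<open>Lb \<odot> LF\<close>, the
    same \<open>T\<close> is the pushout of \<open>S\<close> and \<open>LB'\<close> over
    \<open>LB\<close>. This makes \<open>z\<close> a cobase change of \<open>u\<close>.\<close>
  have po1: "is_pushout E q Lb r tb"
    using pushout_cancel[OF poS outer homs(5) H3(2) _ r(2,3)] r(1) hs by (simp add: cat_simps)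
  have zr: "z \<odot> r = pB \<odot> u"
  proof (rule pushout_eqI[OF poS S(1)])
    show "z \<odot> r \<in> Hom E S SB" "pB \<odot> u \<in> Hom E S SB" using hs r(1) by (simp_all add: cat_simps)
    show "z \<odot> r \<odot> p = pB \<odot> u \<odot> p"
      using hs r(1) u(3) eqs by (simp add: cat_simps r(2) Cmp_rewrite[OF z(3)])
    show "z \<odot> r \<odot> q = pB \<odot> u \<odot> q"
      using hs r(1) u(4) pushout_commutes[OF poB] by (simp add: cat_simps r(3) Cmp_rewrite[OF z(2)])
  qed
  have po2: "is_pushout E Lb (u \<odot> q) qB pB" using pushout_sym[OF poB] u by simp
  have "is_pushout E r u z pB"
    by (rule pushout_cancel[OF pushout_sym[OF po1] po2 S(3,2) _ z(2) zr])
        (use hs in \<open>simp add: Hom_iff\<close>)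
  then have "z \<in> Cof" using pushout_Cof' u(1) by blast
  moreover have "tq \<in> Cof" using pushout_Cof[OF LF'(1) poT] .
  ultimately have "z \<odot> tq \<in> Cof" using Cof_comp hs by (simp add: Hom_iff)
  then show ?thesis using z by simp
qed

text \<open>The corner map \<open>wP\<close> is the morphism of pushouts induced by
  \<open>wA\<close>, \<open>wB\<close>, \<open>wC\<close>: its source is the square of
  \<open>SA\<close>, \<open>SB\<close>, \<open>SC\<close>, \<open>SP\<close>, a pushout by
  \<open>pushout_of_pushouts\<close>, and its target the square of \<open>A'\<close>,
  \<open>B'\<close>, \<open>C'\<close>, \<open>P'\<close>. The two cofibrations that the gluing
  lemma asks for are \<open>sF\<close>, by \<open>corner_map_Cof\<close>, and \<open>F'\<close>, by
  \<open>corner_in_bottom\<close>.\<close>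

lemma corner_in_gluing:
  assumes Cof: "lA \<in> Cof" "lB \<in> Cof" "lC \<in> Cof" "lA' \<in> Cof" "lB' \<in> Cof" "lC' \<in> Cof"
      "LF \<in> Cof" "LF' \<in> Cof"
    and cF: "corner_in E Cof lA lB LF F" and cF': "corner_in E Cof lA' lB' LF' F'"
    and ca: "corner_in E W lA lA' La a" and cb: "corner_in E W lB lB' Lb b"
    and cc: "corner_in E W lC lC' Lc c"
    and poL: "is_pushout E LF LG LH LK" and poL': "is_pushout E LF' LG' LH' LK'"
    and po: "is_pushout E F G H K" and po': "is_pushout E F' G' H' K'"
    and homs: "lA \<in> Hom E LA A" "lB \<in> Hom E LB B" "lC \<in> Hom E LC C" "lP \<in> Hom E LP P"
      "lA' \<in> Hom E LA' A'" "lB' \<in> Hom E LB' B'" "lC' \<in> Hom E LC' C'" "lP' \<in> Hom E LP' P'"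
      "F \<in> Hom E A B" "G \<in> Hom E A C" "H \<in> Hom E B P" "K \<in> Hom E C P"
      "F' \<in> Hom E A' B'" "G' \<in> Hom E A' C'" "H' \<in> Hom E B' P'" "K' \<in> Hom E C' P'"
      "LF \<in> Hom E LA LB" "LG \<in> Hom E LA LC" "LH \<in> Hom E LB LP" "LK \<in> Hom E LC LP"
      "LF' \<in> Hom E LA' LB'" "LG' \<in> Hom E LA' LC'" "LH' \<in> Hom E LB' LP'" "LK' \<in> Hom E LC' LP'"
      "La \<in> Hom E LA LA'" "Lb \<in> Hom E LB LB'" "Lc \<in> Hom E LC LC'" "Le \<in> Hom E LP LP'"
      "a \<in> Hom E A A'" "b \<in> Hom E B B'" "c \<in> Hom E C C'" "e \<in> Hom E P P'"
    and eqs: "G \<odot> lA = lC \<odot> LG" "lP \<odot> LH = H \<odot> lB" "lP \<odot> LK = K \<odot> lC"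
      "G' \<odot> lA' = lC' \<odot> LG'" "lP' \<odot> LH' = H' \<odot> lB'" "lP' \<odot> LK' = K' \<odot> lC'"
      "b \<odot> F = F' \<odot> a" "c \<odot> G = G' \<odot> a" "e \<odot> H = H' \<odot> b" "e \<odot> K = K' \<odot> c"
      "Lb \<odot> LF = LF' \<odot> La" "Lc \<odot> LG = LG' \<odot> La" "Le \<odot> LH = LH' \<odot> Lb" "Le \<odot> LK = LK' \<odot> Lc"
  shows "corner_in E W lP lP' Le e"
proof -
  note hs = homs[unfolded Hom_iff]
  have FlA: "F \<odot> lA = lB \<odot> LF" and FlA': "F' \<odot> lA' = lB' \<odot> LF'"
    using corner_in_Homs(4)[OF cF homs(1)] corner_in_Homs(4)[OF cF' homs(5)] by auto
  \<comment> \<open>Ensures that the pushout \<open>SP\<close> exists. The square with sides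
    \<open>LK\<close>, \<open>K\<close> has its corner map in C and starts at the cofibration
    \<open>lC\<close>, so its target \<open>lP\<close> is a cofibration.\<close>
  have lP: "lP \<in> Cof"
    using corner_in_target[OF corner_in_pushout_square[OF cF Cof(3) poL po homs(1,3,18,10) _
        eqs(1-3)] Cof(3)]
      hs by (simp add: Hom_iff)
  obtain pA qA wA where poA: "is_pushout E lA La pA qA" and wA: "wA \<in> W"
    "wA \<in> Hom E (Cod E pA) (Cod E a)" "wA \<odot> pA = a" "wA \<odot> qA = lA'"
    using ca by (auto simp: corner_in_def)
  obtain pB qB wB where poB: "is_pushout E lB Lb pB qB" and wB: "wB \<in> W"
    "wB \<in> Hom E (Cod E pB) (Cod E b)" "wB \<odot> pB = b" "wB \<odot> qB = lB'"
    using cb by (auto simp: corner_in_def)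
  obtain pC qC wC where poC: "is_pushout E lC Lc pC qC" and wC: "wC \<in> W"
    "wC \<in> Hom E (Cod E pC) (Cod E c)" "wC \<odot> pC = c" "wC \<odot> qC = lC'"
    using cc by (auto simp: corner_in_def)
  obtain pP qP SP where poP: "is_pushout E lP Le pP qP"
      and SP: "pP \<in> Hom E P SP" "qP \<in> Hom E LP' SP"
    using pushout_ofE[OF lP homs(4,28)] .
  obtain SA where SA: "pA \<in> Hom E A SA" "qA \<in> Hom E LA' SA" using poA hs
    by (auto simp: is_pushout_def Hom_iff)
  obtain SB where SB: "pB \<in> Hom E B SB" "qB \<in> Hom E LB' SB" using poB hs
    by (auto simp: is_pushout_def Hom_iff)
  obtain SC where SC: "pC \<in> Hom E C SC" "qC \<in> Hom E LC' SC" using poC hs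
    by (auto simp: is_pushout_def Hom_iff)
  have w: "wA \<in> Hom E SA A'" "wB \<in> Hom E SB B'" "wC \<in> Hom E SC C'"
    using wA wB wC SA SB SC hs by (simp_all add: Hom_iff)
  note hs = hs SA[unfolded Hom_iff] SB[unfolded Hom_iff] SC[unfolded Hom_iff] SP[unfolded Hom_iff]
  note rw = FlA FlA' eqs FlA[THEN Cmp_rewrite] FlA'[THEN Cmp_rewrite] eqs[THEN Cmp_rewrite]
  have coms: "pA \<odot> lA = qA \<odot> La" "pB \<odot> lB = qB \<odot> Lb" "pC \<odot> lC = qC \<odot> Lc" "pP \<odot> lP = qP \<odot> Le"
    using pushout_commutes poA poB poC poP by auto
  note rw = rw coms coms[THEN Cmp_rewrite]
  obtain sF where sF: "sF \<in> Hom E SA SB" "sF \<odot> pA = pB \<odot> F" "sF \<odot> qA = qB \<odot> LF'"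
  proof (rule pushout_ex[OF poA SA])
    show "pB \<odot> F \<in> Hom E A SB" "qB \<odot> LF' \<in> Hom E LA' SB" "pB \<odot> F \<odot> lA = qB \<odot> LF' \<odot> La"
      using hs by (simp_all add: cat_simps rw)
  qed
  obtain sG where sG: "sG \<in> Hom E SA SC" "sG \<odot> pA = pC \<odot> G" "sG \<odot> qA = qC \<odot> LG'"
  proof (rule pushout_ex[OF poA SA])
    show "pC \<odot> G \<in> Hom E A SC" "qC \<odot> LG' \<in> Hom E LA' SC" "pC \<odot> G \<odot> lA = qC \<odot> LG' \<odot> La"
      using hs by (simp_all add: cat_simps rw)
  qed
  obtain sH where sH: "sH \<in> Hom E SB SP" "sH \<odot> pB = pP \<odot> H" "sH \<odot> qB = qP \<odot> LH'"
  proof (rule pushout_ex[OF poB SB])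
    \<comment> \<open>With the two equations on \<open>LH\<close> read backwards, both sides of the
      last equation become \<open>qP \<odot> (Le \<odot> LH)\<close>.\<close>
    show "pP \<odot> H \<in> Hom E B SP" "qP \<odot> LH' \<in> Hom E LB' SP" "pP \<odot> H \<odot> lB = qP \<odot> LH' \<odot> Lb"
      using hs by (simp_all add: cat_simps rw flip: eqs(2,13))
  qed
  obtain sK where sK: "sK \<in> Hom E SC SP" "sK \<odot> pC = pP \<odot> K" "sK \<odot> qC = qP \<odot> LK'"
  proof (rule pushout_ex[OF poC SC])
    show "pP \<odot> K \<in> Hom E C SP" "qP \<odot> LK' \<in> Hom E LC' SP" "pP \<odot> K \<odot> lC = qP \<odot> LK' \<odot> Lc"
      using hs by (simp_all add: cat_simps rw flip: eqs(3,14))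
  qed
  \<comment> \<open>Tested on the legs of the pushout \<open>LP\<close>, this follows from the
    commuting squares over \<open>B\<close> and \<open>C\<close>.\<close>
  have e: "e \<odot> lP = lP' \<odot> Le"
  proof (rule pushout_eqI[OF poL homs(19)])
    show "e \<odot> lP \<in> Hom E LP P'" "lP' \<odot> Le \<in> Hom E LP P'" using hs by (simp_all add: cat_simps)
    have "b \<odot> lB = lB' \<odot> Lb" "c \<odot> lC = lC' \<odot> Lc"
      using corner_in_Homs(4)[OF cb homs(2)] corner_in_Homs(4)[OF cc homs(3)] by auto
    then show "e \<odot> lP \<odot> LH = lP' \<odot> Le \<odot> LH" "e \<odot> lP \<odot> LK = lP' \<odot> Le \<odot> LK"
      using hs by (simp_all add: cat_simps rw)
  qed
  obtain wP where wP: "wP \<in> Hom E SP P'" "wP \<odot> pP = e" "wP \<odot> qP = lP'"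
    using pushout_ex[OF poP SP homs(32,8) e] .
  note hs = hs sF(1)[unfolded Hom_iff] sG(1)[unfolded Hom_iff] sH(1)[unfolded Hom_iff]
      sK(1)[unfolded Hom_iff]
    w[unfolded Hom_iff] wP(1)[unfolded Hom_iff]
  have poS: "is_pushout E sF sG sH sK"
    by (rule pushout_of_pushouts[OF poA poB poC poP poL poL' po SA(1) SB(1) SC(1) SP(1)
          SA(2) SB(2) SC(2) SP(2) homs(9-12) homs(21-24) homs(19,20) homs(2-4) homs(26-28)
          sF(1) sG(1) sH(1) sK(1) sF(2,3) sG(2,3) sH(2,3) sK(2,3) eqs(2,3) eqs(13,14)])
  have sF_Cof: "sF \<in> Cof"
    by (rule corner_map_Cof[OF cF Cof(8) homs(21) poA poB homs(1,25) SA(1) SB(1) homs(26) sF(1)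
        eqs(11) sF(2,3)])
  have F'_Cof: "F' \<in> Cof" using corner_in_bottom[OF cF' Cof(8)] .
  note ws = wA(3,4) wB(3,4) wC(3,4) wP(2,3)
  note rw = rw sF(2,3) sG(2,3) sH(2,3) sK(2,3) ws ws[THEN Cmp_rewrite]
    sF(2,3)[THEN Cmp_rewrite] sG(2,3)[THEN Cmp_rewrite] sH(2,3)[THEN Cmp_rewrite]
        sK(2,3)[THEN Cmp_rewrite]
  have "wP \<in> W"
  proof (rule gluing[OF sF_Cof F'_Cof poS po' wA(1) wB(1) wC(1)])
    show "wA \<in> Hom E (Dom E sF) (Dom E F')" "wB \<in> Hom E (Cod E sF) (Cod E F')"
      "wC \<in> Hom E (Cod E sG) (Cod E G')" "wP \<in> Hom E (Cod E sH) (Cod E H')"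
      using hs by (simp_all add: Hom_iff)
    show "wB \<odot> sF = F' \<odot> wA"
      by (rule pushout_eqI[OF poA SA(1), of _ B']) (use hs in \<open>simp_all add: cat_simps rw\<close>)
    show "wC \<odot> sG = G' \<odot> wA"
      by (rule pushout_eqI[OF poA SA(1), of _ C']) (use hs in \<open>simp_all add: cat_simps rw\<close>)
    show "wP \<odot> sH = H' \<odot> wB"
      by (rule pushout_eqI[OF poB SB(1), of _ P']) (use hs in \<open>simp_all add: cat_simps rw\<close>)
    show "wP \<odot> sK = K' \<odot> wC"
      by (rule pushout_eqI[OF poC SC(1), of _ P']) (use hs in \<open>simp_all add: cat_simps rw\<close>)
  qed
  then show ?thesis by (rule corner_inI[OF poP SP(1) homs(32) wP(1) _ wP(2,3)])
qed

end

section \<open>Coproducts and weak factorization systems\<close>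

context category
begin

lemma coproduct_Ob: "is_coproduct E I A P \<iota> \<Longrightarrow> P \<in> Ob E"
  and coproduct_Hom: "is_coproduct E I A P \<iota> \<Longrightarrow> i \<in> I \<Longrightarrow> \<iota> i \<in> Hom E (A i) P"
  by (auto simp: is_coproduct_def)

lemma coproduct_ex1:
  assumes "is_coproduct E I A P \<iota>" "D \<in> Ob E" "\<And>i. i \<in> I \<Longrightarrow> \<phi> i \<in> Hom E (A i) D"
  shows "\<exists>!h. h \<in> Hom E P D \<and> (\<forall>i\<in>I. h \<odot> \<iota> i = \<phi> i)"
  using assms by (simp add: is_coproduct_def)

lemma coproduct_ex:
  assumes "is_coproduct E I A P \<iota>" "D \<in> Ob E" "\<And>i. i \<in> I \<Longrightarrow> \<phi> i \<in> Hom E (A i) D"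
  obtains h where "h \<in> Hom E P D" "\<And>i. i \<in> I \<Longrightarrow> h \<odot> \<iota> i = \<phi> i"
  using coproduct_ex1[OF assms] by blast

lemma coproduct_eqI:
  assumes cop: "is_coproduct E I A P \<iota>" and h: "h \<in> Hom E P D" and k: "k \<in> Hom E P D"
    and "\<And>i. i \<in> I \<Longrightarrow> h \<odot> \<iota> i = k \<odot> \<iota> i"
  shows "h = k"
proof -
  have "h \<odot> \<iota> i \<in> Hom E (A i) D" if "i \<in> I" for i
    using Cmp_in_Hom[OF coproduct_Hom[OF cop that] h] .
  then have "\<exists>!h'. h' \<in> Hom E P D \<and> (\<forall>i\<in>I. h' \<odot> \<iota> i = h \<odot> \<iota> i)"
    using coproduct_ex1[OF cop Hom_Ob(2)[OF h], of "\<lambda>i. h \<odot> \<iota> i"] by blast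
  then show ?thesis using assms by metis
qed

lemma coproduct_iso:
  assumes cop: "is_coproduct E I A P \<iota>" and cop': "is_coproduct E I A P' \<iota>'"
  obtains \<theta> where "\<theta> \<in> Hom E P P'" "is_iso E \<theta>" "\<And>i. i \<in> I \<Longrightarrow> \<theta> \<odot> \<iota> i = \<iota>' i"
proof -
  note h = coproduct_Hom[OF cop] and h' = coproduct_Hom[OF cop']
  obtain \<theta> where \<theta>: "\<theta> \<in> Hom E P P'" "\<And>i. i \<in> I \<Longrightarrow> \<theta> \<odot> \<iota> i = \<iota>' i"
    using coproduct_ex[OF cop coproduct_Ob[OF cop'] h'] by blast
  obtain \<eta> where \<eta>: "\<eta> \<in> Hom E P' P" "\<And>i. i \<in> I \<Longrightarrow> \<eta> \<odot> \<iota>' i = \<iota> i"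
    using coproduct_ex[OF cop' coproduct_Ob[OF cop] h] by blast
  note Ob = coproduct_Ob[OF cop] coproduct_Ob[OF cop']
  have "\<eta> \<odot> \<theta> = Idm E P"
    by (rule coproduct_eqI[OF cop, of _ P])
       (use \<theta> \<eta> Ob h in \<open>auto simp: cat_simps\<close>)
  moreover have "\<theta> \<odot> \<eta> = Idm E P'"
    by (rule coproduct_eqI[OF cop', of _ P'])
       (use \<theta> \<eta> Ob h' in \<open>auto simp: cat_simps\<close>)
  ultimately have "is_iso E \<theta>" using is_isoI \<theta>(1) \<eta>(1) by blast
  then show thesis using that \<theta> by blast
qed

text \<open>A cocone on the span of coproducts restricts to a cocone on the span at each index, and
  the morphisms induced on the \<open>P i\<close> assemble to one on \<open>LP\<close>. Applied to
  latching objects, this says that L_i turns vertexwise pushouts into pushouts.\<close>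

lemma coproduct_pushout:
  assumes copA: "is_coproduct E I A LA \<iota>A" and copB: "is_coproduct E I B LB \<iota>B"
    and copC: "is_coproduct E I C LC \<iota>C" and copP: "is_coproduct E I P LP \<iota>P"
    and po: "\<And>i. i \<in> I \<Longrightarrow> is_pushout E (f i) (g i) (p i) (q i)"
    and homs: "\<And>i. i \<in> I \<Longrightarrow> f i \<in> Hom E (A i) (B i)" "\<And>i. i \<in> I \<Longrightarrow> g i \<in> Hom E (A i) (C i)"
      "\<And>i. i \<in> I \<Longrightarrow> p i \<in> Hom E (B i) (P i)" "\<And>i. i \<in> I \<Longrightarrow> q i \<in> Hom E (C i) (P i)"
    and L: "F \<in> Hom E LA LB" "G \<in> Hom E LA LC" "H \<in> Hom E LB LP" "K \<in> Hom E LC LP"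
    and eqs: "\<And>i. i \<in> I \<Longrightarrow> F \<odot> \<iota>A i = \<iota>B i \<odot> f i" "\<And>i. i \<in> I \<Longrightarrow> G \<odot> \<iota>A i = \<iota>C i \<odot> g i"
      "\<And>i. i \<in> I \<Longrightarrow> H \<odot> \<iota>B i = \<iota>P i \<odot> p i" "\<And>i. i \<in> I \<Longrightarrow> K \<odot> \<iota>C i = \<iota>P i \<odot> q i"
  shows "is_pushout E F G H K"
proof -
  note \<iota> = coproduct_Hom[OF copA] coproduct_Hom[OF copB] coproduct_Hom[OF copC]
      coproduct_Hom[OF copP]
  note hs = \<iota> homs
  show ?thesis
  proof (rule is_pushoutI)
    show "F \<in> Hom E LA LB" "G \<in> Hom E LA LC" "H \<in> Hom E LB LP" "K \<in> Hom E LC LP" by fact+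
    show "H \<odot> F = K \<odot> G"
    proof (rule coproduct_eqI[OF copA])
      show "H \<odot> F \<in> Hom E LA LP" "K \<odot> G \<in> Hom E LA LP" using L by (simp_all add: cat_simps)
      fix i assume i: "i \<in> I"
      show "H \<odot> F \<odot> \<iota>A i = K \<odot> G \<odot> \<iota>A i"
        using hs[OF i] L pushout_commutes[OF po[OF i]]
        by (simp add: cat_simps eqs[OF i] eqs[OF i, THEN Cmp_rewrite])
    qed
  next
    fix D r s assume r: "r \<in> Hom E LB D" and s: "s \<in> Hom E LC D" and rs: "r \<odot> F = s \<odot> G"
    have "\<exists>h. h \<in> Hom E (P i) D \<and> h \<odot> p i = r \<odot> \<iota>B i \<and> h \<odot> q i = s \<odot> \<iota>C i" if i: "i \<in> I" for i
    proof -
      have "(r \<odot> \<iota>B i) \<odot> f i = (r \<odot> F) \<odot> \<iota>A i"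
        using hs[OF i] r L by (simp add: cat_simps eqs[OF i])
      also have "\<dots> = (s \<odot> \<iota>C i) \<odot> g i"
        unfolding rs using hs[OF i] s L by (simp add: cat_simps eqs[OF i])
      finally show ?thesis
        using pushout_ex[OF po[OF i] homs(3,4)[OF i], of "r \<odot> \<iota>B i" D "s \<odot> \<iota>C i"]
          Cmp_in_Hom \<iota>[OF i] r s by metis
    qed
    then obtain k where k: "\<And>i. i \<in> I \<Longrightarrow> k i \<in> Hom E (P i) D"
      "\<And>i. i \<in> I \<Longrightarrow> k i \<odot> p i = r \<odot> \<iota>B i" "\<And>i. i \<in> I \<Longrightarrow> k i \<odot> q i = s \<odot> \<iota>C i"
      by metis
    obtain h where h: "h \<in> Hom E LP D" "\<And>i. i \<in> I \<Longrightarrow> h \<odot> \<iota>P i = k i"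
      using coproduct_ex[OF copP Hom_Ob(2)[OF r] k(1)] by blast
    have "h \<odot> H = r"
    proof (rule coproduct_eqI[OF copB _ r])
      show "h \<odot> H \<in> Hom E LB D" using h L by (simp add: cat_simps)
      fix i assume i: "i \<in> I"
      show "h \<odot> H \<odot> \<iota>B i = r \<odot> \<iota>B i"
        using hs[OF i] L h(1) k(2)[OF i]
          by (simp add: cat_simps eqs[OF i] Cmp_rewrite[OF h(2)[OF i]])
    qed
    moreover have "h \<odot> K = s"
    proof (rule coproduct_eqI[OF copC _ s])
      show "h \<odot> K \<in> Hom E LC D" using h L by (simp add: cat_simps)
      fix i assume i: "i \<in> I"
      show "h \<odot> K \<odot> \<iota>C i = s \<odot> \<iota>C i"
        using hs[OF i] L h(1) k(3)[OF i]
          by (simp add: cat_simps eqs[OF i] Cmp_rewrite[OF h(2)[OF i]])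
    qed
    ultimately show "\<exists>h. h \<in> Hom E LP D \<and> h \<odot> H = r \<and> h \<odot> K = s" using h by blast
  next
    fix D h k assume h: "h \<in> Hom E LP D" and k: "k \<in> Hom E LP D"
      and hk: "h \<odot> H = k \<odot> H" "h \<odot> K = k \<odot> K"
    show "h = k"
    proof (rule coproduct_eqI[OF copP h k])
      fix i assume i: "i \<in> I"
      show "h \<odot> \<iota>P i = k \<odot> \<iota>P i"
      proof (rule pushout_eqI[OF po[OF i] homs(3)[OF i]])
        show "h \<odot> \<iota>P i \<in> Hom E (P i) D" "k \<odot> \<iota>P i \<in> Hom E (P i) D"
          using h k \<iota>[OF i] by (simp_all add: cat_simps)
        have "x \<odot> \<iota>P i \<odot> p i = x \<odot> H \<odot> \<iota>B i" "x \<odot> \<iota>P i \<odot> q i = x \<odot> K \<odot> \<iota>C i"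
          if "x \<in> Hom E LP D" for x
          using hs[OF i] L that by (simp_all add: cat_simps eqs[OF i])
        then show "h \<odot> \<iota>P i \<odot> p i = k \<odot> \<iota>P i \<odot> p i" "h \<odot> \<iota>P i \<odot> q i = k \<odot> \<iota>P i \<odot> q i"
          using h k hk by simp_all
      qed
    qed
  qed
qed

lemma initial_eq: "is_initial E Z \<Longrightarrow> f \<in> Hom E Z A \<Longrightarrow> g \<in> Hom E Z A \<Longrightarrow> f = g"
  using Hom_Ob(2)[of f Z A] unfolding is_initial_def by blast

lemma initial_ex:
  assumes "is_initial E Z" "A \<in> Ob E"
  obtains f where "f \<in> Hom E Z A"
  using assms unfolding is_initial_def by blast

lemma initial_iso:
  assumes "is_initial E Z" "is_initial E Z'" "f \<in> Hom E Z Z'"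
  shows "is_iso E f"
proof -
  have Ob: "Z \<in> Ob E" "Z' \<in> Ob E" using assms by (auto simp: is_initial_def)
  obtain g where g: "g \<in> Hom E Z' Z" using initial_ex[OF assms(2) Ob(1)] .
  show ?thesis
    by (rule is_isoI[OF assms(3) g])
       (use initial_eq[OF assms(1)] initial_eq[OF assms(2)] Cmp_in_Hom Idm_in_Hom Ob assms(3) g in
           metis)+
qed

text \<open>The empty family is included, as needed at vertices that are not the target of any
  arrow.\<close>

lemma coproduct_of_initial:
  assumes cop: "is_coproduct E I A P \<iota>" and A: "\<And>i. i \<in> I \<Longrightarrow> is_initial E (A i)"
  shows "is_initial E P"
  unfolding is_initial_def
proof (intro conjI ballI)
  show "P \<in> Ob E" using coproduct_Ob[OF cop] .
  fix D assume D: "D \<in> Ob E"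
  then have "\<forall>i\<in>I. \<exists>f. f \<in> Hom E (A i) D" using A initial_ex by blast
  then obtain \<phi> where "\<forall>i\<in>I. \<phi> i \<in> Hom E (A i) D" by (rule bchoice[THEN exE])
  then obtain h where h: "h \<in> Hom E P D"
    using coproduct_ex[OF cop D] by blast
  moreover have "k = h" if k: "k \<in> Hom E P D" for k
    by (rule coproduct_eqI[OF cop k h], rule initial_eq[OF A])
       (use h k coproduct_Hom[OF cop] Cmp_in_Hom in blast)+
  ultimately show "\<exists>!f. f \<in> Hom E P D" by blast
qed

end

section \<open>Cofibrations as a left lifting class\<close>

context waldhausen_category
begin

context
  assumes wfs: "weak_factorization_system E Cof (rlp E Cof)"
begin

lemma Cof_iff_lifts: "f \<in> Cof \<longleftrightarrow> f \<in> Mor E \<and> (\<forall>g \<in> rlp E Cof. lifts E f g)"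
  using wfs by (auto simp: weak_factorization_system_def llp_def)

lemma liftE:
  assumes "f \<in> Cof" "g \<in> rlp E Cof" "f \<in> Hom E A B" "g \<in> Hom E X Y" "u \<in> Hom E A X" "v \<in> Hom E B Y"
    and "g \<odot> u = v \<odot> f"
  obtains h where "h \<in> Hom E B X" "h \<odot> f = u" "g \<odot> h = v"
proof -
  have "lifts E f g" using assms(1,2) Cof_iff_lifts by blast
  moreover have "Dom E f = A" "Cod E f = B" "Dom E g = X" "Cod E g = Y"
    using assms(3,4) by (auto simp: Hom_iff)
  ultimately show thesis using that assms(5-7) unfolding lifts_def by blast
qed

lemma CofI:
  assumes f: "f \<in> Hom E A B"
    and "\<And>g X Y u v. g \<in> rlp E Cof \<Longrightarrow> g \<in> Hom E X Y \<Longrightarrow> u \<in> Hom E A X \<Longrightarrow> v \<in> Hom E B Y \<Longrightarrow>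
      g \<odot> u = v \<odot> f \<Longrightarrow> \<exists>h. h \<in> Hom E B X \<and> h \<odot> f = u \<and> g \<odot> h = v"
  shows "f \<in> Cof"
  unfolding Cof_iff_lifts
proof (intro conjI ballI)
  show "f \<in> Mor E" using f by (simp add: Hom_iff)
  fix g assume g: "g \<in> rlp E Cof"
  then have "g \<in> Hom E (Dom E g) (Cod E g)" by (simp add: rlp_def Hom_iff)
  note * = assms(2)[OF g this]
  have "Dom E f = A" "Cod E f = B" using f by (auto simp: Hom_iff)
  with * show "lifts E f g" unfolding lifts_def by blast
qed

text \<open>A lifting problem for \<open>m\<close> restricts to one for each \<open>f i\<close>; the
  lifts chosen there assemble by the universal property of the target coproduct.\<close>

lemma coproduct_Cof:
  assumes copA: "is_coproduct E I A P \<iota>" and copB: "is_coproduct E I B P' \<iota>'"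
    and f: "\<And>i. i \<in> I \<Longrightarrow> f i \<in> Cof" "\<And>i. i \<in> I \<Longrightarrow> f i \<in> Hom E (A i) (B i)"
    and m: "m \<in> Hom E P P'" "\<And>i. i \<in> I \<Longrightarrow> m \<odot> \<iota> i = \<iota>' i \<odot> f i"
  shows "m \<in> Cof"
proof (rule CofI[OF m(1)])
  fix g X Y u v
  assume g: "g \<in> rlp E Cof" "g \<in> Hom E X Y" and u: "u \<in> Hom E P X" and v: "v \<in> Hom E P' Y"
    and sq: "g \<odot> u = v \<odot> m"
  note \<iota> = coproduct_Hom[OF copA] coproduct_Hom[OF copB]
  have "\<exists>h. h \<in> Hom E (B i) X \<and> h \<odot> f i = u \<odot> \<iota> i \<and> g \<odot> h = v \<odot> \<iota>' i" if i: "i \<in> I" for i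
  proof -
    note hs = \<iota>[OF i] f(2)[OF i] m(1) g(2) u v
    have "g \<odot> (u \<odot> \<iota> i) = (g \<odot> u) \<odot> \<iota> i" using hs by (simp add: cat_simps)
    also have "\<dots> = (v \<odot> \<iota>' i) \<odot> f i" unfolding sq using hs by (simp add: cat_simps m(2)[OF i])
    finally have sqi: "g \<odot> (u \<odot> \<iota> i) = (v \<odot> \<iota>' i) \<odot> f i" .
    show ?thesis
      by (rule liftE[OF f(1)[OF i] g(1) f(2)[OF i] g(2) Cmp_in_Hom[OF hs(1) u] Cmp_in_Hom[OF hs(2)
          v] sqi]) blast
  qed
  then obtain k where k: "\<And>i. i \<in> I \<Longrightarrow> k i \<in> Hom E (B i) X"
    "\<And>i. i \<in> I \<Longrightarrow> k i \<odot> f i = u \<odot> \<iota> i" "\<And>i. i \<in> I \<Longrightarrow> g \<odot> k i = v \<odot> \<iota>' i"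
    by metis
  obtain h where h: "h \<in> Hom E P' X" "\<And>i. i \<in> I \<Longrightarrow> h \<odot> \<iota>' i = k i"
    using coproduct_ex[OF copB Hom_Ob(2)[OF u] k(1)] by blast
  have "h \<odot> m = u"
  proof (rule coproduct_eqI[OF copA _ u])
    show "h \<odot> m \<in> Hom E P X" using h m by (simp add: cat_simps)
    fix i assume i: "i \<in> I"
    show "h \<odot> m \<odot> \<iota> i = u \<odot> \<iota> i" 
      using h(1) m(1) \<iota>[OF i] f(2)[OF i] k(2)[OF i]
      by (simp add: cat_simps m(2)[OF i] Cmp_rewrite[OF h(2)[OF i]])
  qed
  moreover have "g \<odot> h = v"
  proof (rule coproduct_eqI[OF copB _ v])
    show "g \<odot> h \<in> Hom E P' Y" using h g by (simp add: cat_simps)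
    fix i assume i: "i \<in> I"
    show "g \<odot> h \<odot> \<iota>' i = v \<odot> \<iota>' i" 
      using h(1) g(2) \<iota>[OF i] k(3)[OF i] by (simp add: cat_simps h(2)[OF i])
  qed
  ultimately show "\<exists>h. h \<in> Hom E P' X \<and> h \<odot> m = u \<and> g \<odot> h = v" using h(1) by blast
qed

text \<open>A lift is built componentwise: it is \<open>u\<close> at \<open>i\<close>, and at any
  other \<open>j\<close> a lift for the cofibration from the initial object to
  \<open>A j\<close>.\<close>

lemma coproduct_inclusion_Cof:
  assumes cop: "is_coproduct E I A P \<iota>" and A: "\<And>i. i \<in> I \<Longrightarrow> A i \<in> Ob E" and i: "i \<in> I"
  shows "\<iota> i \<in> Cof"
proof (rule CofI[OF coproduct_Hom[OF cop i]])
  fix g X Y u v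
  assume g: "g \<in> rlp E Cof" "g \<in> Hom E X Y" and u: "u \<in> Hom E (A i) X" and v: "v \<in> Hom E P Y"
    and sq: "g \<odot> u = v \<odot> \<iota> i"
  note \<iota> = coproduct_Hom[OF cop]
  obtain Z where Z: "is_initial E Z" using ex_initial by blast
  have "\<exists>h. h \<in> Hom E (A j) X \<and> g \<odot> h = v \<odot> \<iota> j \<and> (j = i \<longrightarrow> h = u)" if j: "j \<in> I" for j
  proof (cases "j = i")
    case True
    then show ?thesis using u sq by blast
  next
    case False
    obtain z where z: "z \<in> Hom E Z (A j)" using initial_ex[OF Z A[OF j]] .
    obtain t where t: "t \<in> Hom E Z X" using initial_ex[OF Z Hom_Ob(2)[OF u]] .
    have "z \<in> Cof" using initial_Cof[OF Z] z by (simp add: Hom_iff)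
    moreover have v\<iota>: "v \<odot> \<iota> j \<in> Hom E (A j) Y" using \<iota>[OF j] v Cmp_in_Hom by blast
    moreover have "g \<odot> t = (v \<odot> \<iota> j) \<odot> z"
      using initial_eq[OF Z Cmp_in_Hom[OF t g(2)] Cmp_in_Hom[OF z v\<iota>]] .
    ultimately show ?thesis using liftE[OF _ g(1) z g(2) t] False by metis
  qed
  then obtain k where k: "\<And>j. j \<in> I \<Longrightarrow> k j \<in> Hom E (A j) X" "\<And>j. j \<in> I \<Longrightarrow> g \<odot> k j = v \<odot> \<iota> j"
    "k i = u"
    using i by metis
  obtain h where h: "h \<in> Hom E P X" "\<And>i. i \<in> I \<Longrightarrow> h \<odot> \<iota> i = k i"
    using coproduct_ex[OF cop Hom_Ob(2)[OF u] k(1)] by blast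
  have "g \<odot> h = v"
  proof (rule coproduct_eqI[OF cop _ v])
    show "g \<odot> h \<in> Hom E P Y" using h g by (simp add: cat_simps)
    fix j assume j: "j \<in> I"
    show "g \<odot> h \<odot> \<iota> j = v \<odot> \<iota> j" 
      using h(1) g(2) \<iota>[OF j] k(2)[OF j] by (simp add: cat_simps h(2)[OF j])
  qed
  then show "\<exists>h. h \<in> Hom E P X \<and> h \<odot> \<iota> i = u \<and> g \<odot> h = v" using h i k(3) by auto
qed

end

end

section \<open>Representations\<close>

lemma full_subcategory_simps:
  "Ob (full_subcategory E S) = Ob E \<inter> S"
  "f \<in> Mor (full_subcategory E S) \<longleftrightarrow> f \<in> Mor E \<and> Dom E f \<in> S \<and> Cod E f \<in> S"
  "Dom (full_subcategory E S) = Dom E" "Cod (full_subcategory E S) = Cod E"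
  "Idm (full_subcategory E S) = Idm E" "Cmp (full_subcategory E S) = Cmp E"
  by (simp_all add: full_subcategory_def)

lemma full_subcategory_Hom:
  "f \<in> Hom (full_subcategory E S) A B \<longleftrightarrow> f \<in> Hom E A B \<and> A \<in> S \<and> B \<in> S"
  by (auto simp: Hom_def full_subcategory_simps)

lemma Rep_simps:
  "X \<in> Ob (Rep Q E) \<longleftrightarrow> rep_ob X \<in> verts Q \<rightarrow>\<^sub>E Ob E \<and>
     rep_map X \<in> (\<Pi>\<^sub>E \<alpha>\<in>arcs Q. Hom E (rep_ob X (tail Q \<alpha>)) (rep_ob X (head Q \<alpha>)))"
  "Dom (Rep Q E) = rep_dom" "Cod (Rep Q E) = rep_cod"
  "Idm (Rep Q E) X = \<lparr>rep_dom = X, rep_cod = X, rep_comp = (\<lambda>i\<in>verts Q. Idm E (rep_ob X i))\<rparr>"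
  "Cmp (Rep Q E) g f = \<lparr>rep_dom = rep_dom f, rep_cod = rep_cod g,
     rep_comp = (\<lambda>i\<in>verts Q. rep_comp g i \<odot>\<^bsub>E\<^esub> rep_comp f i)\<rparr>"
  by (simp_all add: Rep_def)

lemma Rep_Hom:
  "f \<in> Hom (Rep Q E) X Y \<longleftrightarrow> X \<in> Ob (Rep Q E) \<and> Y \<in> Ob (Rep Q E) \<and> rep_dom f = X \<and> rep_cod f = Y \<and>
     rep_comp f \<in> (\<Pi>\<^sub>E i\<in>verts Q. Hom E (rep_ob X i) (rep_ob Y i)) \<and>
     (\<forall>\<alpha>\<in>arcs Q. rep_comp f (head Q \<alpha>) \<odot>\<^bsub>E\<^esub> rep_map X \<alpha> = rep_map Y \<alpha> \<odot>\<^bsub>E\<^esub> rep_comp f (tail Q \<alpha>))"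
  by (auto simp: Hom_def Rep_def Let_def)

text \<open>Agreement on the vertices is enough, because both families of components are
  \<open>undefined\<close> elsewhere.\<close>

lemma Rep_mor_eqI:
  assumes "f \<in> Hom (Rep Q E) X Y" "g \<in> Hom (Rep Q E) X Y"
    and "\<And>i. i \<in> verts Q \<Longrightarrow> rep_comp f i = rep_comp g i"
  shows "f = g"
proof -
  have "rep_comp f = rep_comp g"
    using assms unfolding Rep_Hom by (blast intro: PiE_ext)
  then show ?thesis using assms(1,2) by (simp add: Rep_Hom)
qed

context category
begin

lemma full_subcategory_category: "category (full_subcategory E S)"
proof (unfold_locales, goal_cases)
  case (7 f A B g D h F)
  then show ?case using Cmp_assoc[of f A B g D h F]
    by (simp add: full_subcategory_Hom full_subcategory_simps)
qed (auto simp: full_subcategory_Hom full_subcategory_simps Dom_in_Ob Cod_in_Ob Idm_in_Hom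
    Cmp_in_Hom Cmp_Idm Idm_Cmp)

lemma Rep_category:
  assumes "wf_digraph Q"
  shows "category (Rep Q E)"
proof -
  interpret Q: wf_digraph Q by fact
  have comp: "rep_comp f i \<in> Hom E (rep_ob X i) (rep_ob Y i)"
    if "f \<in> Hom (Rep Q E) X Y" "i \<in> verts Q" for f X Y i
    using that by (auto simp: Rep_Hom)
  have maps: "rep_map X \<alpha> \<in> Hom E (rep_ob X (tail Q \<alpha>)) (rep_ob X (head Q \<alpha>))"
    if "X \<in> Ob (Rep Q E)" "\<alpha> \<in> arcs Q" for X \<alpha>
    using that by (auto simp: Rep_simps)
  have nat: "rep_comp f (head Q \<alpha>) \<odot> rep_map X \<alpha> = rep_map Y \<alpha> \<odot> rep_comp f (tail Q \<alpha>)"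
    if "f \<in> Hom (Rep Q E) X Y" "\<alpha> \<in> arcs Q" for f X Y \<alpha>
    using that by (auto simp: Rep_Hom)
  have Id: "Idm (Rep Q E) X \<in> Hom (Rep Q E) X X" if X: "X \<in> Ob (Rep Q E)" for X
    using X by (auto simp: Rep_Hom Rep_simps(4) Idm_in_Hom Cmp_Idm Idm_Cmp intro!:
        restrict_PiE_iff[THEN iffD2])
      (auto simp: Rep_simps(1) Idm_in_Hom Cmp_Idm Idm_Cmp dest!: PiE_mem intro: Q.head_in_verts
          Q.tail_in_verts)
  have Cm: "Cmp (Rep Q E) g f \<in> Hom (Rep Q E) X Z"
    if f: "f \<in> Hom (Rep Q E) X Y" and g: "g \<in> Hom (Rep Q E) Y Z" for X Y Z f g
  proof -
    have XYZ: "X \<in> Ob (Rep Q E)" "Y \<in> Ob (Rep Q E)" "Z \<in> Ob (Rep Q E)" "rep_dom f = X"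
        "rep_cod g = Z"
      using f g by (auto simp: Rep_Hom)
    have "rep_comp g (head Q \<alpha>) \<odot> rep_comp f (head Q \<alpha>) \<odot> rep_map X \<alpha> =
        rep_map Z \<alpha> \<odot> (rep_comp g (tail Q \<alpha>) \<odot> rep_comp f (tail Q \<alpha>))" if \<alpha>: "\<alpha> \<in> arcs Q" for \<alpha>
    proof -
      note v = Q.head_in_verts[OF \<alpha>] Q.tail_in_verts[OF \<alpha>]
      show ?thesis
        using comp[OF f v(1)] comp[OF g v(1)] comp[OF f v(2)] comp[OF g v(2)]
          maps[OF XYZ(1) \<alpha>] maps[OF XYZ(2) \<alpha>] maps[OF XYZ(3) \<alpha>]
        by (simp add: cat_simps nat[OF f \<alpha>] nat[OF g \<alpha>] Cmp_rewrite[OF nat[OF g \<alpha>]])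
    qed
    then show ?thesis
      using XYZ comp[OF f] comp[OF g] by
          (auto simp: Rep_Hom Rep_simps(5) Q.head_in_verts Q.tail_in_verts intro: Cmp_in_Hom)
  qed
  show ?thesis
  proof
    fix f g h A B D F
    show "f \<in> Mor (Rep Q E) \<Longrightarrow> Dom (Rep Q E) f \<in> Ob (Rep Q E)"
      and "f \<in> Mor (Rep Q E) \<Longrightarrow> Cod (Rep Q E) f \<in> Ob (Rep Q E)"
      by (auto simp: Rep_def Let_def)
    show "A \<in> Ob (Rep Q E) \<Longrightarrow> Idm (Rep Q E) A \<in> Hom (Rep Q E) A A" using Id .
    assume f: "f \<in> Hom (Rep Q E) A B"
    then have AB: "A \<in> Ob (Rep Q E)" "B \<in> Ob (Rep Q E)" by (auto simp: Rep_Hom)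
    show "Cmp (Rep Q E) f (Idm (Rep Q E) A) = f"
      by (rule Rep_mor_eqI[OF Cm[OF Id[OF AB(1)] f] f])
         (use Cmp_Idm[OF comp[OF f]] in \<open>simp add: Rep_simps\<close>)
    show "Cmp (Rep Q E) (Idm (Rep Q E) B) f = f"
      by (rule Rep_mor_eqI[OF Cm[OF f Id[OF AB(2)]] f])
         (use Idm_Cmp[OF comp[OF f]] in \<open>simp add: Rep_simps\<close>)
    assume g: "g \<in> Hom (Rep Q E) B D"
    show "Cmp (Rep Q E) g f \<in> Hom (Rep Q E) A D" using Cm[OF f g] .
    assume h: "h \<in> Hom (Rep Q E) D F"
    show "Cmp (Rep Q E) h (Cmp (Rep Q E) g f) = Cmp (Rep Q E) (Cmp (Rep Q E) h g) f"
      by (rule Rep_mor_eqI[OF Cm[OF Cm[OF f g] h] Cm[OF f Cm[OF g h]]])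
         (use Cmp_assoc[OF comp[OF f] comp[OF g] comp[OF h]] in \<open>simp add: Rep_simps\<close>)
  qed
qed

end

text \<open>\<open>arcs_ends Q\<close> relates the source of an arrow to its target. A property
  inherited along arrows holds on every stage, by induction on the ordinal: in a successor stage all
  arrows into \<open>i\<close> start in earlier stages, and in any other stage \<open>i\<close>
  itself lies in an earlier one.\<close>

lemma left_rooted_imp_wf:
  fixes Q :: "('v, 'e) pre_digraph"
  assumes Q: "wf_digraph Q" and "left_rooted TYPE('w::wellorder) Q"
  shows "wf (arcs_ends Q)"
proof (rule wfUNIVI)
  fix P :: "'v \<Rightarrow> bool" and x
  assume ind: "\<forall>x. (\<forall>y. (y, x) \<in> arcs_ends Q \<longrightarrow> P y) \<longrightarrow> P x"
  have step: "P x" if "\<And>\<alpha>. \<alpha> \<in> arcs Q \<Longrightarrow> head Q \<alpha> = x \<Longrightarrow> P (tail Q \<alpha>)" for x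
  proof -
    have "P y" if "(y, x) \<in> arcs_ends Q" for y
      using that \<open>\<And>\<alpha>. \<alpha> \<in> arcs Q \<Longrightarrow> head Q \<alpha> = x \<Longrightarrow> P (tail Q \<alpha>)\<close>
      by (auto simp: arcs_ends_def arc_to_ends_def)
    then show ?thesis using ind by blast
  qed
  have stage: "\<forall>i \<in> rooted_stage Q \<nu>. P i" for \<nu> :: 'w
  proof (induction \<nu> rule: less_induct)
    case (less \<nu>)
    then have IH: "P i" if "i \<in> (\<Union>\<gamma>\<in>{..<\<nu>}. rooted_stage Q \<gamma>)" for i using that by auto
    show ?case
    proof
      fix i assume i: "i \<in> rooted_stage Q \<nu>"
      show "P i"
      proof (cases "\<exists>\<mu>. {..<\<nu>} = {..\<mu>}")
        case True
        with i have "\<not> (\<exists>\<alpha> \<in> arcs Q. head Q \<alpha> = i \<and> tail Q \<alpha> \<notin> (\<Union>\<gamma>\<in>{..<\<nu>}. rooted_stage Q \<gamma>))"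
          by (subst (asm) rooted_stage.simps) simp
        then show ?thesis using IH step by blast
      next
        case False
        with i have "i \<in> (\<Union>\<gamma>\<in>{..<\<nu>}. rooted_stage Q \<gamma>)"
          by (subst (asm) rooted_stage.simps) simp
        then show ?thesis using IH by blast
      qed
    qed
  qed
  then have "P i" if "i \<in> verts Q" for i
    using that assms(2) unfolding left_rooted_def by blast
  \<comment> \<open>\<open>x\<close> may be any element of the type; the sources of arrows into it
    are vertices in any case.\<close>
  then show "P x" using step wf_digraph.tail_in_verts[OF Q] by blast
qed

section \<open>Latching morphisms\<close>

text \<open>Left rootedness enters in the form of \<open>wf_arcs\<close>, so the type of ordinals
  does not occur in the locale.\<close>

locale latching_category = waldhausen_category E Cof W + Q: wf_digraph Q
  for E :: "('o, 'm) category" (structure) and Cof W and Q :: "('v, 'e) pre_digraph" +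
  assumes coproducts: "has_small_coproducts TYPE('e) E"
    and wfs: "weak_factorization_system E Cof (rlp E Cof)"
    and wf_arcs: "wf (arcs_ends Q)"
begin

abbreviation "R \<equiv> full_subcategory (Rep_in Q E Cof) {X. latching_mors_in Q E Cof X}"

text \<open>Object and inclusions come from a single choice, because two separate ones need not
  belong to the same coproduct.\<close>

definition latching_choice :: "('v, 'e, 'o, 'm) rep \<Rightarrow> 'v \<Rightarrow> 'o \<times> ('e \<Rightarrow> 'm)" where
  "latching_choice X i = (SOME c. is_latching_ob Q E X i (fst c) (snd c))"

definition "Lob X i = fst (latching_choice X i)"
definition "Lin X i = snd (latching_choice X i)"
definition "lat X i = (THE l. is_latching_mor Q E X i (Lob X i) (Lin X i) l)"
definition "Lmap f i = (THE m. m \<in> Hom E (Lob (rep_dom f) i) (Lob (rep_cod f) i) \<and>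
  (\<forall>\<alpha>\<in>in_arcs Q i. m \<odot> Lin (rep_dom f) i \<alpha> = Lin (rep_cod f) i \<alpha> \<odot> rep_comp f (tail Q \<alpha>)))"

lemma Rep_cat: "category (Rep Q E)"
  using Rep_category Q.wf_digraph_axioms .

lemma R_cat: "category R"
  unfolding Rep_in_def by (intro category.full_subcategory_category Rep_cat)

lemma R_simps: "Dom R = rep_dom" "Cod R = rep_cod" "Idm R = Idm (Rep Q E)" "Cmp R = Cmp (Rep Q E)"
  by (simp_all add: Rep_in_def Rep_simps full_subcategory_simps fun_eq_iff)

lemma R_Ob: "X \<in> Ob R \<longleftrightarrow> X \<in> Ob (Rep Q E) \<and> (\<forall>\<alpha>\<in>arcs Q. rep_map X \<alpha> \<in> Cof) \<and>
    latching_mors_in Q E Cof X"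
  by (simp add: Rep_in_def full_subcategory_simps)

lemma R_Hom: "f \<in> Hom R X Y \<longleftrightarrow> f \<in> Hom (Rep Q E) X Y \<and> X \<in> Ob R \<and> Y \<in> Ob R"
  unfolding Rep_in_def by (auto simp: full_subcategory_simps full_subcategory_Hom Rep_Hom)

lemma R_HomD:
  assumes "f \<in> Hom R X Y"
  shows "f \<in> Hom (Rep Q E) X Y" "X \<in> Ob R" "Y \<in> Ob R" "X \<in> Ob (Rep Q E)" "Y \<in> Ob (Rep Q E)"
    "rep_dom f = X" "rep_cod f = Y" "f \<in> Mor R"
proof -
  show "f \<in> Mor R" using assms by (simp add: Hom_def)
qed (use assms in \<open>auto simp: R_Hom R_Ob Rep_Hom\<close>)

lemma rep_ob_Ob: "X \<in> Ob (Rep Q E) \<Longrightarrow> i \<in> verts Q \<Longrightarrow> rep_ob X i \<in> Ob E"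
  by (auto simp: Rep_simps)

lemma rep_map_Hom:
  "X \<in> Ob (Rep Q E) \<Longrightarrow> \<alpha> \<in> arcs Q \<Longrightarrow> rep_map X \<alpha> \<in> Hom E (rep_ob X (tail Q \<alpha>)) (rep_ob X (head Q \<alpha>))"
  by (auto simp: Rep_simps)

lemma rep_comp_Hom:
  "f \<in> Hom (Rep Q E) X Y \<Longrightarrow> i \<in> verts Q \<Longrightarrow> rep_comp f i \<in> Hom E (rep_ob X i) (rep_ob Y i)"
  by (auto simp: Rep_Hom)

lemma rep_comp_natural:
  "f \<in> Hom (Rep Q E) X Y \<Longrightarrow> \<alpha> \<in> arcs Q \<Longrightarrow>
    rep_comp f (head Q \<alpha>) \<odot> rep_map X \<alpha> = rep_map Y \<alpha> \<odot> rep_comp f (tail Q \<alpha>)"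
  by (auto simp: Rep_Hom)

section \<open>The chosen latching objects and their functoriality\<close>

lemma Lob_coproduct:
  assumes "X \<in> Ob (Rep Q E)"
  shows "is_coproduct E (in_arcs Q i) (\<lambda>\<alpha>. rep_ob X (tail Q \<alpha>)) (Lob X i) (Lin X i)"
proof -
  have "\<forall>\<alpha>\<in>in_arcs Q i. rep_ob X (tail Q \<alpha>) \<in> Ob E" using rep_ob_Ob[OF assms] by auto
  with coproducts have "\<exists>P \<iota>. is_latching_ob Q E X i P \<iota>"
    unfolding has_small_coproducts_def is_latching_ob_def by (elim allE impE) assumption+
  then obtain P \<iota> where "is_latching_ob Q E X i P \<iota>" by blast
  then have "is_latching_ob Q E X i (fst (P, \<iota>)) (snd (P, \<iota>))" by simp
  then have "is_latching_ob Q E X i (Lob X i) (Lin X i)"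
    unfolding Lob_def Lin_def latching_choice_def by (rule someI)
  then show ?thesis by (simp add: is_latching_ob_def)
qed

lemma Lin_Hom:
  "X \<in> Ob (Rep Q E) \<Longrightarrow> \<alpha> \<in> in_arcs Q i \<Longrightarrow> Lin X i \<alpha> \<in> Hom E (rep_ob X (tail Q \<alpha>)) (Lob X i)"
  using coproduct_Hom[OF Lob_coproduct] .

lemma lat_latching_mor:
  assumes X: "X \<in> Ob (Rep Q E)" and i: "i \<in> verts Q"
  shows "is_latching_mor Q E X i (Lob X i) (Lin X i) (lat X i)"
proof -
  have "\<exists>!l. l \<in> Hom E (Lob X i) (rep_ob X i) \<and> (\<forall>\<alpha>\<in>in_arcs Q i. l \<odot> Lin X i \<alpha> = rep_map X \<alpha>)"
    using rep_map_Hom[OF X] by (intro coproduct_ex1[OF Lob_coproduct[OF X] rep_ob_Ob[OF X i]]) auto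
  then have "\<exists>!l. is_latching_mor Q E X i (Lob X i) (Lin X i) l"
    using Lob_coproduct[OF X] by (simp add: is_latching_mor_def is_latching_ob_def)
  then show ?thesis unfolding lat_def by (rule theI')
qed

lemma lat_Hom: "X \<in> Ob (Rep Q E) \<Longrightarrow> i \<in> verts Q \<Longrightarrow> lat X i \<in> Hom E (Lob X i) (rep_ob X i)"
  and lat_Lin: "X \<in> Ob (Rep Q E) \<Longrightarrow> i \<in> verts Q \<Longrightarrow> \<alpha> \<in> in_arcs Q i \<Longrightarrow>
      lat X i \<odot> Lin X i \<alpha> = rep_map X \<alpha>"
  using lat_latching_mor by (auto simp: is_latching_mor_def)

lemma Lmap_ex1:
  assumes f: "f \<in> Hom (Rep Q E) X Y"
  shows "\<exists>!m. m \<in> Hom E (Lob X i) (Lob Y i) \<and>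
    (\<forall>\<alpha>\<in>in_arcs Q i. m \<odot> Lin X i \<alpha> = Lin Y i \<alpha> \<odot> rep_comp f (tail Q \<alpha>))"
proof -
  have XY: "X \<in> Ob (Rep Q E)" "Y \<in> Ob (Rep Q E)" using f by (auto simp: Rep_Hom)
  have "Lin Y i \<alpha> \<odot> rep_comp f (tail Q \<alpha>) \<in> Hom E (rep_ob X (tail Q \<alpha>)) (Lob Y i)"
    if \<alpha>: "\<alpha> \<in> in_arcs Q i" for \<alpha>
    using Cmp_in_Hom[OF rep_comp_Hom[OF f] Lin_Hom[OF XY(2) \<alpha>]] \<alpha> by auto
  then show ?thesis
    by (rule coproduct_ex1[OF Lob_coproduct[OF XY(1)] coproduct_Ob[OF Lob_coproduct[OF XY(2)]]])
qed

lemma Lmap_Hom: "f \<in> Hom (Rep Q E) X Y \<Longrightarrow> Lmap f i \<in> Hom E (Lob X i) (Lob Y i)"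
  and Lmap_Lin: "f \<in> Hom (Rep Q E) X Y \<Longrightarrow> \<alpha> \<in> in_arcs Q i \<Longrightarrow>
    Lmap f i \<odot> Lin X i \<alpha> = Lin Y i \<alpha> \<odot> rep_comp f (tail Q \<alpha>)"
proof -
  assume f: "f \<in> Hom (Rep Q E) X Y"
  then have "rep_dom f = X" "rep_cod f = Y" by (auto simp: Rep_Hom)
  then have *: "Lmap f i \<in> Hom E (Lob X i) (Lob Y i) \<and>
      (\<forall>\<alpha>\<in>in_arcs Q i. Lmap f i \<odot> Lin X i \<alpha> = Lin Y i \<alpha> \<odot> rep_comp f (tail Q \<alpha>))"
    unfolding Lmap_def using theI'[OF Lmap_ex1[OF f]] by simp
  then show "Lmap f i \<in> Hom E (Lob X i) (Lob Y i)" by blast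
  show "Lmap f i \<odot> Lin X i \<alpha> = Lin Y i \<alpha> \<odot> rep_comp f (tail Q \<alpha>)" if "\<alpha> \<in> in_arcs Q i"
    using * that by blast
qed

lemma Lmap_eqI:
  assumes f: "f \<in> Hom (Rep Q E) X Y" and m: "m \<in> Hom E (Lob X i) (Lob Y i)"
    and "\<And>\<alpha>. \<alpha> \<in> in_arcs Q i \<Longrightarrow> m \<odot> Lin X i \<alpha> = Lin Y i \<alpha> \<odot> rep_comp f (tail Q \<alpha>)"
  shows "Lmap f i = m"
  using Lmap_ex1[OF f, of i] Lmap_Hom[OF f] Lmap_Lin[OF f] assms(2,3) by blast

lemma Lmap_Idm:
  assumes X: "X \<in> Ob (Rep Q E)"
  shows "Lmap (Idm (Rep Q E) X) i = Idm E (Lob X i)"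
proof (rule Lmap_eqI)
  show "Idm (Rep Q E) X \<in> Hom (Rep Q E) X X" using category.Idm_in_Hom[OF Rep_cat X] .
  show "Idm E (Lob X i) \<in> Hom E (Lob X i) (Lob X i)"
    using Idm_in_Hom coproduct_Ob[OF Lob_coproduct[OF X]] by blast
  fix \<alpha> assume \<alpha>: "\<alpha> \<in> in_arcs Q i"
  then show "Idm E (Lob X i) \<odot> Lin X i \<alpha> = Lin X i \<alpha> \<odot> rep_comp (Idm (Rep Q E) X) (tail Q \<alpha>)"
    using Lin_Hom[OF X \<alpha>] by (auto simp: Rep_simps Cmp_Idm Idm_Cmp)
qed

lemma Lmap_Cmp:
  assumes f: "f \<in> Hom (Rep Q E) X Y" and g: "g \<in> Hom (Rep Q E) Y Z"
  shows "Lmap (Cmp (Rep Q E) g f) i = Lmap g i \<odot> Lmap f i"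
proof (rule Lmap_eqI)
  show "Cmp (Rep Q E) g f \<in> Hom (Rep Q E) X Z" using category.Cmp_in_Hom[OF Rep_cat f g] .
  show "Lmap g i \<odot> Lmap f i \<in> Hom E (Lob X i) (Lob Z i)"
    using Cmp_in_Hom[OF Lmap_Hom[OF f] Lmap_Hom[OF g]] .
  fix \<alpha> assume \<alpha>: "\<alpha> \<in> in_arcs Q i"
  then have t: "tail Q \<alpha> \<in> verts Q" by auto
  have Ob: "X \<in> Ob (Rep Q E)" "Y \<in> Ob (Rep Q E)" "Z \<in> Ob (Rep Q E)" using f g
    by (auto simp: Rep_Hom)
  show "Lmap g i \<odot> Lmap f i \<odot> Lin X i \<alpha> = Lin Z i \<alpha> \<odot> rep_comp (Cmp (Rep Q E) g f) (tail Q \<alpha>)"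
    using Lin_Hom[OF Ob(1) \<alpha>] Lin_Hom[OF Ob(2) \<alpha>] Lin_Hom[OF Ob(3) \<alpha>] Lmap_Hom[OF f, of i]
        Lmap_Hom[OF g, of i]
      rep_comp_Hom[OF f t] rep_comp_Hom[OF g t] t
    by (simp add: cat_simps Rep_simps Lmap_Lin[OF f \<alpha>] Cmp_rewrite[OF Lmap_Lin[OF g \<alpha>]])
qed

lemma lat_natural:
  assumes f: "f \<in> Hom (Rep Q E) X Y" and i: "i \<in> verts Q"
  shows "rep_comp f i \<odot> lat X i = lat Y i \<odot> Lmap f i"
proof -
  have XY: "X \<in> Ob (Rep Q E)" "Y \<in> Ob (Rep Q E)" using f by (auto simp: Rep_Hom)
  note hs = lat_Hom[OF XY(1) i] lat_Hom[OF XY(2) i] Lmap_Hom[OF f, of i] rep_comp_Hom[OF f i]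
  show ?thesis
  proof (rule coproduct_eqI[OF Lob_coproduct[OF XY(1)]])
    show "rep_comp f i \<odot> lat X i \<in> Hom E (Lob X i) (rep_ob Y i)"
      "lat Y i \<odot> Lmap f i \<in> Hom E (Lob X i) (rep_ob Y i)" using hs by (simp_all add: cat_simps)
    fix \<alpha> assume \<alpha>: "\<alpha> \<in> in_arcs Q i"
    then have t: "tail Q \<alpha> \<in> verts Q" by auto
    have "rep_comp f i \<odot> rep_map X \<alpha> = rep_map Y \<alpha> \<odot> rep_comp f (tail Q \<alpha>)"
      using rep_comp_natural[OF f, of \<alpha>] \<alpha> by simp
    then show "rep_comp f i \<odot> lat X i \<odot> Lin X i \<alpha> = lat Y i \<odot> Lmap f i \<odot> Lin X i \<alpha>"
      using hs Lin_Hom[OF XY(1) \<alpha>] Lin_Hom[OF XY(2) \<alpha>] rep_comp_Hom[OF f t]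
      by (simp add: cat_simps lat_Lin[OF XY(1) i \<alpha>] Lmap_Lin[OF f \<alpha>] Cmp_rewrite[OF lat_Lin[OF XY(2)
          i \<alpha>]])
  qed
qed

section \<open>Independence of the chosen latching objects\<close>

lemma latching_mor_compare:
  assumes X: "X \<in> Ob (Rep Q E)" and i: "i \<in> verts Q" and l: "is_latching_mor Q E X i L \<iota> l"
  obtains \<theta> where "\<theta> \<in> Hom E (Lob X i) L" "is_iso E \<theta>" "\<And>\<alpha>. \<alpha> \<in> in_arcs Q i \<Longrightarrow> \<theta> \<odot> Lin X i \<alpha> = \<iota> \<alpha>"
    "l \<odot> \<theta> = lat X i"
proof -
  have cop: "is_coproduct E (in_arcs Q i) (\<lambda>\<alpha>. rep_ob X (tail Q \<alpha>)) L \<iota>"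
      and lH: "l \<in> Hom E L (rep_ob X i)"
    and l\<iota>: "\<And>\<alpha>. \<alpha> \<in> in_arcs Q i \<Longrightarrow> l \<odot> \<iota> \<alpha> = rep_map X \<alpha>"
    using l by (auto simp: is_latching_mor_def is_latching_ob_def)
  obtain \<theta> where \<theta>: "\<theta> \<in> Hom E (Lob X i) L" "is_iso E \<theta>" "\<And>\<alpha>. \<alpha> \<in> in_arcs Q i \<Longrightarrow> \<theta> \<odot> Lin X i \<alpha> = \<iota> \<alpha>"
    using coproduct_iso[OF Lob_coproduct[OF X] cop] by blast
  have "l \<odot> \<theta> = lat X i"
  proof (rule coproduct_eqI[OF Lob_coproduct[OF X] _ lat_Hom[OF X i]])
    show "l \<odot> \<theta> \<in> Hom E (Lob X i) (rep_ob X i)" using \<theta> lH by (simp add: cat_simps)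
    fix \<alpha> assume \<alpha>: "\<alpha> \<in> in_arcs Q i"
    show "l \<odot> \<theta> \<odot> Lin X i \<alpha> = lat X i \<odot> Lin X i \<alpha>"
      using \<theta>(1) lH Lin_Hom[OF X \<alpha>] by (simp add: cat_simps \<theta>(3)[OF \<alpha>] l\<iota>[OF \<alpha>] lat_Lin[OF X i \<alpha>])
  qed
  then show thesis using that \<theta> by blast
qed

lemma latching_mors_in_iff:
  assumes X: "X \<in> Ob (Rep Q E)"
  shows "latching_mors_in Q E Cof X \<longleftrightarrow> (\<forall>i \<in> verts Q. lat X i \<in> Cof)"
proof
  assume *: "latching_mors_in Q E Cof X"
  show "\<forall>i \<in> verts Q. lat X i \<in> Cof"
  proof
    fix i assume i: "i \<in> verts Q"
    then obtain L \<iota> l where l: "is_latching_mor Q E X i L \<iota> l" "l \<in> Cof"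
      using * by (auto simp: latching_mors_in_def)
    obtain \<theta> where \<theta>: "\<theta> \<in> Hom E (Lob X i) L" "is_iso E \<theta>" "l \<odot> \<theta> = lat X i"
      using latching_mor_compare[OF X i l(1)] by metis
    moreover have "l \<in> Hom E L (rep_ob X i)" using l by (simp add: is_latching_mor_def)
    ultimately show "lat X i \<in> Cof" using Cof_comp[OF iso_Cof[OF \<theta>(2)] l(2)] by (simp add: Hom_iff)
  qed
next
  assume "\<forall>i \<in> verts Q. lat X i \<in> Cof"
  then show "latching_mors_in Q E Cof X"
    using lat_latching_mor[OF X] unfolding latching_mors_in_def by blast
qed

lemma lat_Cof: "X \<in> Ob R \<Longrightarrow> i \<in> verts Q \<Longrightarrow> lat X i \<in> Cof"
  using latching_mors_in_iff by (auto simp: R_Ob)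

text \<open>Each \<open>rep_map X \<alpha>\<close> is a coproduct inclusion, which is a cofibration,
  followed by a latching morphism. So the condition on the latching morphisms already gives the one
  on the arrows.\<close>

lemma R_ObI:
  assumes X: "X \<in> Ob (Rep Q E)" and lat: "\<And>i. i \<in> verts Q \<Longrightarrow> lat X i \<in> Cof"
  shows "X \<in> Ob R"
proof -
  have "rep_map X \<alpha> \<in> Cof" if \<alpha>: "\<alpha> \<in> arcs Q" for \<alpha>
  proof -
    let ?i = "head Q \<alpha>"
    have i: "?i \<in> verts Q" "\<alpha> \<in> in_arcs Q ?i" using \<alpha> by auto
    have "Lin X ?i \<alpha> \<in> Cof"
      by (rule coproduct_inclusion_Cof[OF wfs Lob_coproduct[OF X]]) (use i rep_ob_Ob[OF X] in auto)
    then have "lat X ?i \<odot> Lin X ?i \<alpha> \<in> Cof"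
      using Cof_comp[OF _ lat[OF i(1)]] Lin_Hom[OF X i(2)] lat_Hom[OF X i(1)] by (simp add: Hom_iff)
    then show ?thesis using lat_Lin[OF X i] by simp
  qed
  then show ?thesis using X lat latching_mors_in_iff[OF X] by (simp add: R_Ob)
qed

text \<open>For other coproducts than the chosen ones, the square of \<open>f\<close> at
  \<open>i\<close> is put between two squares of isomorphisms that compare them with the chosen
  ones. By \<open>corner_in_iso\<close> and \<open>corner_in_comp\<close> the composite has its
  corner map in \<open>K\<close>, and it is the square of \<open>lat\<close> and
  \<open>Lmap\<close>.\<close>

lemma latching_class_iff:
  assumes K: "corner_class K" and f: "f \<in> Hom R X Y"
  shows "f \<in> latching_class Q E R K \<longleftrightarrow>
    (\<forall>i\<in>verts Q. corner_in E K (lat X i) (lat Y i) (Lmap f i) (rep_comp f i))"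
proof -
  note fD = R_HomD[OF f]
  have "(\<exists>u \<in> K. is_relative_latching_mor Q E f i u) \<longleftrightarrow>
      corner_in E K (lat X i) (lat Y i) (Lmap f i) (rep_comp f i)" if i: "i \<in> verts Q" for i
  proof
    assume "\<exists>u \<in> K. is_relative_latching_mor Q E f i u"
    then obtain u L \<iota> l L' \<iota>' l' m p q where u: "u \<in> K"
      and l: "is_latching_mor Q E X i L \<iota> l" and l': "is_latching_mor Q E Y i L' \<iota>' l'"
      and m: "m \<in> Hom E L L'" "\<And>\<alpha>. \<alpha> \<in> in_arcs Q i \<Longrightarrow> m \<odot> \<iota> \<alpha> = \<iota>' \<alpha> \<odot> rep_comp f (tail Q \<alpha>)"
      and po: "is_pushout E l m p q" and uH: "u \<in> Hom E (Cod E p) (rep_ob Y i)"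
      and up: "u \<odot> p = rep_comp f i" "u \<odot> q = l'"
      by (auto simp: is_relative_latching_mor_def fD)
    obtain \<theta> where \<theta>: "\<theta> \<in> Hom E (Lob X i) L" "is_iso E \<theta>"
      "\<And>\<alpha>. \<alpha> \<in> in_arcs Q i \<Longrightarrow> \<theta> \<odot> Lin X i \<alpha> = \<iota> \<alpha>" "l \<odot> \<theta> = lat X i"
      using latching_mor_compare[OF fD(4) i l] by metis
    obtain \<theta>' where \<theta>': "\<theta>' \<in> Hom E (Lob Y i) L'" "is_iso E \<theta>'"
      "\<And>\<alpha>. \<alpha> \<in> in_arcs Q i \<Longrightarrow> \<theta>' \<odot> Lin Y i \<alpha> = \<iota>' \<alpha>" "l' \<odot> \<theta>' = lat Y i"
      using latching_mor_compare[OF fD(5) i l'] by metis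
    obtain \<eta> where \<eta>: "\<eta> \<in> Hom E L (Lob X i)" "\<eta> \<odot> \<theta> = Idm E (Lob X i)" "\<theta> \<odot> \<eta> = Idm E L"
      using is_isoE[OF \<theta>(2,1)] .
    obtain \<eta>' where \<eta>': "\<eta>' \<in> Hom E L' (Lob Y i)" "\<eta>' \<odot> \<theta>' = Idm E (Lob Y i)" "\<theta>' \<odot> \<eta>' = Idm E L'"
      using is_isoE[OF \<theta>'(2,1)] .
    have iso: "is_iso E \<eta>" "is_iso E \<eta>'" using is_isoI \<theta> \<eta> \<theta>' \<eta>' by metis+
    have lH: "l \<in> Hom E L (rep_ob X i)" "l' \<in> Hom E L' (rep_ob Y i)"
      using l l' by (auto simp: is_latching_mor_def)
    have Ob: "rep_ob X i \<in> Ob E" "rep_ob Y i \<in> Ob E" using rep_ob_Ob fD i by auto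
    note Id = is_iso_Idm[OF Ob(1)] Idm_in_Hom[OF Ob(1)] is_iso_Idm[OF Ob(2)] Idm_in_Hom[OF Ob(2)]
    have l\<eta>: "l = lat X i \<odot> \<eta>" "l' = lat Y i \<odot> \<eta>'"
      using lH \<theta>(1) \<theta>'(1) \<eta> \<eta>' by (simp_all add: cat_simps flip: \<theta>(4) \<theta>'(4))
    \<comment> \<open>The composition passes through \<open>l\<close> and \<open>l'\<close>, so both
      have to be cofibrations; they differ from \<open>lat X i\<close> and \<open>lat Y i\<close> by
      isomorphisms.\<close>
    have lC: "l \<in> Cof" "l' \<in> Cof"
      unfolding l\<eta> using iso_Cof iso lat_Cof i fD(2,3) \<eta>(1) \<eta>'(1) lat_Hom[OF fD(4) i]
          lat_Hom[OF fD(5) i]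
      by (auto intro!: Cof_comp simp: Hom_iff)
    note latH = lat_Hom[OF fD(4) i] lat_Hom[OF fD(5) i]
    have fi: "rep_comp f i \<in> Hom E (rep_ob X i) (rep_ob Y i)" using rep_comp_Hom[OF fD(1) i] .
    have c1: "corner_in E K (lat X i) l \<theta> (Idm E (rep_ob X i))"
      using corner_in_iso[OF K lat_Cof[OF fD(2) i] latH(1) lH(1) \<theta>(2,1) Id(1,2)]
        Idm_Cmp[OF latH(1)] \<theta>(4) by simp
    have "p \<in> Hom E (rep_ob X i) (Cod E p)" using po lH(1) by (auto simp: is_pushout_def Hom_iff)
    then have c2: "corner_in E K l l' m (rep_comp f i)"
      by (rule corner_inI[OF po _ fi uH u up])
    have c3: "corner_in E K l' (lat Y i) \<eta>' (Idm E (rep_ob Y i))"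
      using corner_in_iso[OF K lC(2) lH(2) latH(2) iso(2) \<eta>'(1) Id(3,4)] Idm_Cmp[OF lH(2)] l\<eta>(2)
        by simp
    have c: "corner_in E K (lat X i) (lat Y i) (\<eta>' \<odot> (m \<odot> \<theta>)) (Idm E (rep_ob Y i) \<odot> (rep_comp f i \<odot>
        Idm E (rep_ob X i)))"
      by (rule corner_in_comp[OF K lat_Cof[OF fD(2) i] lC(2) corner_in_comp[OF K lat_Cof[OF fD(2) i]
          lC(1) c1 c2] c3])
    have "Lmap f i = \<eta>' \<odot> (m \<odot> \<theta>)"
    proof (rule Lmap_eqI[OF fD(1)])
      show "\<eta>' \<odot> (m \<odot> \<theta>) \<in> Hom E (Lob X i) (Lob Y i)" using \<eta>' m \<theta> by (simp add: cat_simps)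
      fix \<alpha> assume \<alpha>: "\<alpha> \<in> in_arcs Q i"
      then have t: "tail Q \<alpha> \<in> verts Q" by auto
      have "\<iota>' \<alpha> \<in> Hom E (rep_ob Y (tail Q \<alpha>)) L'" "\<iota> \<alpha> \<in> Hom E (rep_ob X (tail Q \<alpha>)) L"
        using \<theta>(3)[OF \<alpha>] \<theta>'(3)[OF \<alpha>] \<theta>(1) \<theta>'(1) Lin_Hom[OF fD(4) \<alpha>] Lin_Hom[OF fD(5) \<alpha>] Cmp_in_Hom
          by metis+
      moreover have "\<eta>' \<odot> \<iota>' \<alpha> = Lin Y i \<alpha>"
        using \<eta>' \<theta>'(1) Lin_Hom[OF fD(5) \<alpha>]
          by (simp add: cat_simps Cmp_rewrite[OF \<eta>'(2)] flip: \<theta>'(3)[OF \<alpha>])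
      ultimately show "\<eta>' \<odot> (m \<odot> \<theta>) \<odot> Lin X i \<alpha> = Lin Y i \<alpha> \<odot> rep_comp f (tail Q \<alpha>)"
        using \<eta>'(1) m(1) \<theta>(1) Lin_Hom[OF fD(4) \<alpha>] Lin_Hom[OF fD(5) \<alpha>] rep_comp_Hom[OF fD(1) t]
        by (simp add: cat_simps \<theta>(3)[OF \<alpha>] m(2)[OF \<alpha>] Cmp_rewrite[of \<eta>' "\<iota>' \<alpha>"])
    qed
    moreover have "Idm E (rep_ob Y i) \<odot> (rep_comp f i \<odot> Idm E (rep_ob X i)) = rep_comp f i"
      using fi by (simp add: Cmp_Idm Idm_Cmp)
    ultimately show "corner_in E K (lat X i) (lat Y i) (Lmap f i) (rep_comp f i)" using c by simp
  next
    assume "corner_in E K (lat X i) (lat Y i) (Lmap f i) (rep_comp f i)"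
    then obtain p q u where "is_pushout E (lat X i) (Lmap f i) p q" "u \<in> K"
      "u \<in> Hom E (Cod E p) (Cod E (rep_comp f i))" "u \<odot> p = rep_comp f i" "u \<odot> q = lat Y i"
      by (auto simp: corner_in_def)
    moreover have "Cod E (rep_comp f i) = rep_ob Y i"
      using rep_comp_Hom[OF fD(1) i] by (simp add: Hom_iff)
    ultimately show "\<exists>u \<in> K. is_relative_latching_mor Q E f i u"
      using lat_latching_mor[OF fD(4) i] lat_latching_mor[OF fD(5) i] Lmap_Hom[OF fD(1), of i]
          Lmap_Lin[OF fD(1), of _ i]
      unfolding is_relative_latching_mor_def fD(6,7) by metis
  qed
  then show ?thesis using fD(8) by (simp add: latching_class_def)
qed

section \<open>Vertexwise cofibrations and vertexwise pushouts\<close>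

lemma Lmap_Cof:
  assumes f: "f \<in> Hom (Rep Q E) X Y" and "\<And>\<alpha>. \<alpha> \<in> in_arcs Q i \<Longrightarrow> rep_comp f (tail Q \<alpha>) \<in> Cof"
  shows "Lmap f i \<in> Cof"
proof -
  have XY: "X \<in> Ob (Rep Q E)" "Y \<in> Ob (Rep Q E)" using f by (auto simp: Rep_Hom)
  show ?thesis
    by (rule coproduct_Cof[OF wfs Lob_coproduct[OF XY(1)] Lob_coproduct[OF XY(2)], of i
        "\<lambda>\<alpha>. rep_comp f (tail Q \<alpha>)"])
      (use assms Lmap_Hom[OF f] Lmap_Lin[OF f] rep_comp_Hom[OF f] in auto)
qed

text \<open>If the components at the sources of all arrows into \<open>i\<close> are cofibrations,
  then so is their coproduct L_i(f), and \<open>corner_in_bottom\<close> passes this on to the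
  component at \<open>i\<close>.\<close>

lemma corner_imp_pointwise_Cof:
  assumes f: "f \<in> Hom (Rep Q E) X Y"
    and c: "\<And>i. i \<in> verts Q \<Longrightarrow> corner_in E Cof (lat X i) (lat Y i) (Lmap f i) (rep_comp f i)"
  shows "i \<in> verts Q \<Longrightarrow> rep_comp f i \<in> Cof"
proof (induction i rule: wf_induct_rule[OF wf_arcs])
  case (1 i)
  have "rep_comp f (tail Q \<alpha>) \<in> Cof" if "\<alpha> \<in> in_arcs Q i" for \<alpha>
    using that 1(1)[of "tail Q \<alpha>"] by (auto simp: arcs_ends_def arc_to_ends_def)
  then show ?case using corner_in_bottom[OF c[OF 1(2)] Lmap_Cof[OF f]] by blast
qed

lemma Lmap_pushout:
  assumes f: "f \<in> Hom (Rep Q E) A B" and g: "g \<in> Hom (Rep Q E) A C"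
    and p: "p \<in> Hom (Rep Q E) B P" and q: "q \<in> Hom (Rep Q E) C P"
    and po: "\<And>i. i \<in> verts Q \<Longrightarrow> is_pushout E (rep_comp f i) (rep_comp g i) (rep_comp p i) (rep_comp q
        i)"
  shows "is_pushout E (Lmap f i) (Lmap g i) (Lmap p i) (Lmap q i)"
proof -
  have Ob: "A \<in> Ob (Rep Q E)" "B \<in> Ob (Rep Q E)" "C \<in> Ob (Rep Q E)" "P \<in> Ob (Rep Q E)"
    using f g p q by (auto simp: Rep_Hom)
  show ?thesis
    by (rule coproduct_pushout[OF Ob[THEN Lob_coproduct], of i "\<lambda>\<alpha>. rep_comp f (tail Q \<alpha>)"
          "\<lambda>\<alpha>. rep_comp g (tail Q \<alpha>)" "\<lambda>\<alpha>. rep_comp p (tail Q \<alpha>)" "\<lambda>\<alpha>. rep_comp q (tail Q \<alpha>)"])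
       (use f g p q in \<open>auto simp: po Lmap_Hom Lmap_Lin rep_comp_Hom\<close>)
qed

text \<open>\<open>P\<close> is only assumed to be a representation, since this lemma serves to show
  that the constructed pushout lies in \<open>R\<close>.\<close>

lemma pointwise_pushout_corner:
  assumes f: "f \<in> Hom (Rep Q E) A B" and g: "g \<in> Hom (Rep Q E) A C"
    and p: "p \<in> Hom (Rep Q E) B P" and q: "q \<in> Hom (Rep Q E) C P"
    and po: "\<And>i. i \<in> verts Q \<Longrightarrow> is_pushout E (rep_comp f i) (rep_comp g i) (rep_comp p i) (rep_comp q
        i)"
    and i: "i \<in> verts Q"
    and c: "corner_in E Cof (lat A i) (lat B i) (Lmap f i) (rep_comp f i)" and C: "lat C i \<in> Cof"
  shows "corner_in E Cof (lat C i) (lat P i) (Lmap q i) (rep_comp q i)"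
proof -
  have Ob: "A \<in> Ob (Rep Q E)" "B \<in> Ob (Rep Q E)" "C \<in> Ob (Rep Q E)" "P \<in> Ob (Rep Q E)"
    using f g p q by (auto simp: Rep_Hom)
  have "Cod E (Lmap p i) = Lob P i" "Cod E (rep_comp p i) = rep_ob P i"
    using Lmap_Hom[OF p, of i] rep_comp_Hom[OF p i] by (auto simp: Hom_iff)
  then show ?thesis
    using corner_in_pushout_square[OF c C Lmap_pushout[OF f g p q po] po[OF i] lat_Hom[OF Ob(1) i]
        lat_Hom[OF Ob(3) i]
        Lmap_Hom[OF g] rep_comp_Hom[OF g i]] lat_Hom[OF Ob(4) i] lat_natural[OF g i] lat_natural[OF
            p i] lat_natural[OF q i]
    by simp
qed

lemma pointwise_pushout_imp:
  assumes f: "f \<in> Hom R A B" and g: "g \<in> Hom R A C" and p: "p \<in> Hom R B P" and q: "q \<in> Hom R C P"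
    and po: "\<And>i. i \<in> verts Q \<Longrightarrow> is_pushout E (rep_comp f i) (rep_comp g i) (rep_comp p i) (rep_comp q
        i)"
  shows "is_pushout R f g p q"
proof (rule category.is_pushoutI[OF R_cat f g p q])
  note fH = R_HomD(1)[OF f] and gH = R_HomD(1)[OF g] and pH = R_HomD(1)[OF p]
      and qH = R_HomD(1)[OF q]
  note Ob = R_HomD(4)[OF f] R_HomD(5)[OF f] R_HomD(5)[OF g] R_HomD(5)[OF p]
  show "Cmp R p f = Cmp R q g" unfolding R_simps
    by (rule Rep_mor_eqI[OF category.Cmp_in_Hom[OF Rep_cat fH pH] category.Cmp_in_Hom[OF Rep_cat gH
        qH]])
       (use po pushout_commutes in \<open>auto simp: Rep_simps\<close>)
  {
    fix D r s assume r: "r \<in> Hom R B D" and s: "s \<in> Hom R C D" and rs: "Cmp R r f = Cmp R s g"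
    note rH = R_HomD(1)[OF r] and sH = R_HomD(1)[OF s]
    have D: "D \<in> Ob (Rep Q E)" using R_HomD(5)[OF r] .
    have rs': "rep_comp r i \<odot> rep_comp f i = rep_comp s i \<odot> rep_comp g i" if i: "i \<in> verts Q" for i
      using arg_cong[OF rs, of "\<lambda>h. rep_comp h i"] i by (simp add: R_simps Rep_simps)
    have "\<forall>i\<in>verts Q. \<exists>h. h \<in> Hom E (rep_ob P i) (rep_ob D i) \<and>
        h \<odot> rep_comp p i = rep_comp r i \<and> h \<odot> rep_comp q i = rep_comp s i"
      using pushout_ex[OF po rep_comp_Hom[OF pH] rep_comp_Hom[OF qH] rep_comp_Hom[OF rH]
          rep_comp_Hom[OF sH] rs'] by metis
    then obtain h where h: "\<forall>i\<in>verts Q. h i \<in> Hom E (rep_ob P i) (rep_ob D i) \<and>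
        h i \<odot> rep_comp p i = rep_comp r i \<and> h i \<odot> rep_comp q i = rep_comp s i"
      by (rule bchoice[THEN exE])
    let ?h = "\<lparr>rep_dom = P, rep_cod = D, rep_comp = (\<lambda>i\<in>verts Q. h i)\<rparr>"
    \<comment> \<open>Both sides start at the pushout over \<open>tail Q \<alpha>\<close>, so
      naturality is tested on its two legs, where it reduces to the naturality of \<open>r\<close>
      and \<open>s\<close>.\<close>
    have nat: "h (head Q \<alpha>) \<odot> rep_map P \<alpha> = rep_map D \<alpha> \<odot> h (tail Q \<alpha>)" if \<alpha>: "\<alpha> \<in> arcs Q" for \<alpha>
    proof (rule pushout_eqI[OF po rep_comp_Hom[OF pH]])
      have v: "tail Q \<alpha> \<in> verts Q" "head Q \<alpha> \<in> verts Q" using \<alpha> by auto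
      then show "tail Q \<alpha> \<in> verts Q" "tail Q \<alpha> \<in> verts Q" by auto
      have hH: "h (head Q \<alpha>) \<in> Hom E (rep_ob P (head Q \<alpha>)) (rep_ob D (head Q \<alpha>))"
        "h (tail Q \<alpha>) \<in> Hom E (rep_ob P (tail Q \<alpha>)) (rep_ob D (tail Q \<alpha>))" using h v by auto
      have hp: "h (head Q \<alpha>) \<odot> rep_comp p (head Q \<alpha>) = rep_comp r (head Q \<alpha>)"
        "h (tail Q \<alpha>) \<odot> rep_comp p (tail Q \<alpha>) = rep_comp r (tail Q \<alpha>)"
        "h (head Q \<alpha>) \<odot> rep_comp q (head Q \<alpha>) = rep_comp s (head Q \<alpha>)"
        "h (tail Q \<alpha>) \<odot> rep_comp q (tail Q \<alpha>) = rep_comp s (tail Q \<alpha>)" using h v by auto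
      note hs = hH rep_map_Hom[OF Ob(2) \<alpha>] rep_map_Hom[OF Ob(3) \<alpha>] rep_map_Hom[OF Ob(4) \<alpha>]
          rep_map_Hom[OF D \<alpha>]
        rep_comp_Hom[OF pH v(1)] rep_comp_Hom[OF pH v(2)] rep_comp_Hom[OF qH v(1)]
            rep_comp_Hom[OF qH v(2)]
      show "h (head Q \<alpha>) \<odot> rep_map P \<alpha> \<in> Hom E (rep_ob P (tail Q \<alpha>)) (rep_ob D (head Q \<alpha>))"
        "rep_map D \<alpha> \<odot> h (tail Q \<alpha>) \<in> Hom E (rep_ob P (tail Q \<alpha>)) (rep_ob D (head Q \<alpha>))"
        using hs by (simp_all add: cat_simps)
      show "h (head Q \<alpha>) \<odot> rep_map P \<alpha> \<odot> rep_comp p (tail Q \<alpha>) = rep_map D \<alpha> \<odot> h (tail Q \<alpha>) \<odot>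
          rep_comp p (tail Q \<alpha>)"
        "h (head Q \<alpha>) \<odot> rep_map P \<alpha> \<odot> rep_comp q (tail Q \<alpha>) = rep_map D \<alpha> \<odot> h (tail Q \<alpha>) \<odot> rep_comp
            q (tail Q \<alpha>)"
        using hs by (simp_all add: cat_simps hp hp[THEN Cmp_rewrite] rep_comp_natural[OF rH \<alpha>]
            rep_comp_natural[OF sH \<alpha>]
            rep_comp_natural[OF pH \<alpha>, symmetric] rep_comp_natural[OF qH \<alpha>, symmetric])
    qed
    have hH: "?h \<in> Hom (Rep Q E) P D" using h nat Ob(4) D by (auto simp: Rep_Hom)
    then have "?h \<in> Hom R P D" using R_HomD(3)[OF p] R_HomD(3)[OF r] by (simp add: R_Hom)
    moreover have "Cmp R ?h p = r" unfolding R_simps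
      by (rule Rep_mor_eqI[OF category.Cmp_in_Hom[OF Rep_cat pH hH] rH])
          (use h in \<open>simp add: Rep_simps\<close>)
    moreover have "Cmp R ?h q = s" unfolding R_simps
      by (rule Rep_mor_eqI[OF category.Cmp_in_Hom[OF Rep_cat qH hH] sH])
          (use h in \<open>simp add: Rep_simps\<close>)
    ultimately show "\<exists>h. h \<in> Hom R P D \<and> Cmp R h p = r \<and> Cmp R h q = s" by blast
  next
    fix D h k assume h: "h \<in> Hom R P D" and k: "k \<in> Hom R P D"
      and hk: "Cmp R h p = Cmp R k p" "Cmp R h q = Cmp R k q"
    show "h = k"
    proof (rule Rep_mor_eqI[OF R_HomD(1)[OF h] R_HomD(1)[OF k]])
      fix i assume i: "i \<in> verts Q"
      show "rep_comp h i = rep_comp k i"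
        by (rule pushout_eqI[OF po[OF i] rep_comp_Hom[OF pH i] rep_comp_Hom[OF R_HomD(1)[OF h] i]
            rep_comp_Hom[OF R_HomD(1)[OF k] i]])
           (use arg_cong[OF hk(1), of "\<lambda>h. rep_comp h i"] arg_cong[OF hk(2), of
               "\<lambda>h. rep_comp h i"] i
             in \<open>simp_all add: R_simps Rep_simps\<close>)
    qed
  }
qed

lemma pointwise_pushout_ex:
  assumes f: "f \<in> Hom R A B" and g: "g \<in> Hom R A C" and fC: "f \<in> latching_class Q E R Cof"
  obtains p q P where "p \<in> Hom R B P" "q \<in> Hom R C P"
    "\<And>i. i \<in> verts Q \<Longrightarrow> is_pushout E (rep_comp f i) (rep_comp g i) (rep_comp p i) (rep_comp q i)"
proof -
  note fD = R_HomD[OF f] and gD = R_HomD[OF g]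
  have c: "corner_in E Cof (lat A i) (lat B i) (Lmap f i) (rep_comp f i)" if "i \<in> verts Q" for i
    using latching_class_iff[OF corner_class_Cof f] fC that by blast
  \<comment> \<open>The two legs and the apex are packed into one triple, so that a single choice
    over the vertices suffices.\<close>
  have "\<forall>i\<in>verts Q. \<exists>c. is_pushout E (rep_comp f i) (rep_comp g i) (fst c) (fst (snd c)) \<and>
      fst c \<in> Hom E (rep_ob B i) (snd (snd c)) \<and> fst (snd c) \<in> Hom E (rep_ob C i) (snd (snd c))"
  proof
    fix i assume i: "i \<in> verts Q"
    obtain p q P where "is_pushout E (rep_comp f i) (rep_comp g i) p q" "p \<in> Hom E (rep_ob B i) P"
        "q \<in> Hom E (rep_ob C i) P"
      using pushout_ofE[OF corner_imp_pointwise_Cof[OF fD(1) c i] rep_comp_Hom[OF fD(1) i]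
          rep_comp_Hom[OF gD(1) i]] .
    then show "\<exists>c. is_pushout E (rep_comp f i) (rep_comp g i) (fst c) (fst (snd c)) \<and>
      fst c \<in> Hom E (rep_ob B i) (snd (snd c)) \<and> fst (snd c) \<in> Hom E (rep_ob C i) (snd (snd c))"
      by (intro exI[of _ "(p, q, P)"]) simp
  qed
  then obtain ch
      where ch: "\<forall>i\<in>verts Q. is_pushout E (rep_comp f i) (rep_comp g i) (fst (ch i)) (fst (snd (ch
      i))) \<and>
      fst (ch i) \<in> Hom E (rep_ob B i) (snd (snd (ch i))) \<and> fst (snd (ch i)) \<in> Hom E (rep_ob C i)
          (snd (snd (ch i)))"
    by (rule bchoice[THEN exE])
  define p0 q0 P0 where "p0 i = fst (ch i)" and "q0 i = fst (snd (ch i))"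
      and "P0 i = snd (snd (ch i))" for i
  have po: "is_pushout E (rep_comp f i) (rep_comp g i) (p0 i) (q0 i)"
    and p0: "p0 i \<in> Hom E (rep_ob B i) (P0 i)" and q0: "q0 i \<in> Hom E (rep_ob C i) (P0 i)"
        if "i \<in> verts Q" for i
    using ch that unfolding p0_def q0_def P0_def by auto
  \<comment> \<open>The arrow of the pushout at \<open>\<alpha>\<close> is induced by the arrows of
    \<open>B\<close> and \<open>C\<close>; the two equations say that the legs become morphisms of
    representations.\<close>
  have "\<forall>\<alpha>\<in>arcs Q. \<exists>h. h \<in> Hom E (P0 (tail Q \<alpha>)) (P0 (head Q \<alpha>)) \<and>
      h \<odot> p0 (tail Q \<alpha>) = p0 (head Q \<alpha>) \<odot> rep_map B \<alpha> \<and> h \<odot> q0 (tail Q \<alpha>) = q0 (head Q \<alpha>) \<odot> rep_map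
          C \<alpha>"
  proof
    fix \<alpha> assume \<alpha>: "\<alpha> \<in> arcs Q"
    then have v: "tail Q \<alpha> \<in> verts Q" "head Q \<alpha> \<in> verts Q" by auto
    note hs = p0[OF v(1)] p0[OF v(2)] q0[OF v(1)] q0[OF v(2)] rep_map_Hom[OF fD(4) \<alpha>]
        rep_map_Hom[OF fD(5) \<alpha>]
      rep_map_Hom[OF gD(5) \<alpha>] rep_comp_Hom[OF fD(1) v(1)] rep_comp_Hom[OF fD(1) v(2)]
      rep_comp_Hom[OF gD(1) v(1)] rep_comp_Hom[OF gD(1) v(2)]
    have "p0 (head Q \<alpha>) \<odot> rep_map B \<alpha> \<in> Hom E (rep_ob B (tail Q \<alpha>)) (P0 (head Q \<alpha>))"
      "q0 (head Q \<alpha>) \<odot> rep_map C \<alpha> \<in> Hom E (rep_ob C (tail Q \<alpha>)) (P0 (head Q \<alpha>))"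
      using hs by (simp_all add: cat_simps)
    moreover have "p0 (head Q \<alpha>) \<odot> rep_map B \<alpha> \<odot> rep_comp f (tail Q \<alpha>) = q0 (head Q \<alpha>) \<odot> rep_map C \<alpha>
        \<odot> rep_comp g (tail Q \<alpha>)"
      using hs pushout_commutes[OF po[OF v(2)]]
      by (simp add: cat_simps Cmp_rewrite[OF pushout_commutes[OF po[OF v(2)]]]
          flip: rep_comp_natural[OF fD(1) \<alpha>] rep_comp_natural[OF gD(1) \<alpha>])
    ultimately show "\<exists>h. h \<in> Hom E (P0 (tail Q \<alpha>)) (P0 (head Q \<alpha>)) \<and>
      h \<odot> p0 (tail Q \<alpha>) = p0 (head Q \<alpha>) \<odot> rep_map B \<alpha> \<and> h \<odot> q0 (tail Q \<alpha>) = q0 (head Q \<alpha>) \<odot> rep_map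
          C \<alpha>"
      using pushout_ex[OF po[OF v(1)] p0[OF v(1)] q0[OF v(1)]] by metis
  qed
  then obtain h where h: "\<forall>\<alpha>\<in>arcs Q. h \<alpha> \<in> Hom E (P0 (tail Q \<alpha>)) (P0 (head Q \<alpha>)) \<and>
      h \<alpha> \<odot> p0 (tail Q \<alpha>) = p0 (head Q \<alpha>) \<odot> rep_map B \<alpha> \<and> h \<alpha> \<odot> q0 (tail Q \<alpha>) = q0 (head Q \<alpha>) \<odot>
          rep_map C \<alpha>"
    by (rule bchoice[THEN exE])
  let ?P = "\<lparr>rep_ob = (\<lambda>i\<in>verts Q. P0 i), rep_map = (\<lambda>\<alpha>\<in>arcs Q. h \<alpha>)\<rparr>"
  let ?p = "\<lparr>rep_dom = B, rep_cod = ?P, rep_comp = (\<lambda>i\<in>verts Q. p0 i)\<rparr>"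
  let ?q = "\<lparr>rep_dom = C, rep_cod = ?P, rep_comp = (\<lambda>i\<in>verts Q. q0 i)\<rparr>"
  have P: "?P \<in> Ob (Rep Q E)" using h Hom_Ob(2)[OF p0] by (auto simp: Rep_simps)
  have pH: "?p \<in> Hom (Rep Q E) B ?P" using P fD(5) h p0 by (auto simp: Rep_Hom)
  have qH: "?q \<in> Hom (Rep Q E) C ?P" using P gD(5) h q0 by (auto simp: Rep_Hom)
  have po': "is_pushout E (rep_comp f i) (rep_comp g i) (rep_comp ?p i) (rep_comp ?q i)"
      if "i \<in> verts Q" for i
    using po[OF that] that by simp
  \<comment> \<open>The corner map of \<open>?q\<close> at \<open>i\<close> is a cofibration by
    cobase change from \<open>f\<close>, and \<open>lat C i\<close> is one because \<open>C\<close>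
    lies in \<open>R\<close>.\<close>
  have "lat ?P i \<in> Cof" if i: "i \<in> verts Q" for i
    using corner_in_target[OF pointwise_pushout_corner[OF fD(1) gD(1) pH qH po' i c[OF i] lat_Cof[OF
        gD(3) i]]
        lat_Cof[OF gD(3) i]] .
  then have "?P \<in> Ob R" using R_ObI[OF P] by blast
  then have "?p \<in> Hom R B ?P" "?q \<in> Hom R C ?P" using pH qH fD(3) gD(3) by (simp_all add: R_Hom)
  then show thesis using that po' by blast
qed

lemma R_iso_pointwise:
  assumes f: "f \<in> Hom R X Y" and iso: "is_iso R f"
  shows "i \<in> verts Q \<Longrightarrow> is_iso E (rep_comp f i)" "is_iso E (Lmap f i)"
proof -
  obtain g where g: "g \<in> Hom R Y X" "Cmp R g f = Idm R X" "Cmp R f g = Idm R Y"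
    using category.is_isoE[OF R_cat iso f] .
  note fD = R_HomD[OF f] and gD = R_HomD[OF g(1)]
  show "is_iso E (rep_comp f i)" if i: "i \<in> verts Q"
    by (rule is_isoI[OF rep_comp_Hom[OF fD(1) i] rep_comp_Hom[OF gD(1) i]])
       (use arg_cong[OF g(2), of "\<lambda>h. rep_comp h i"] arg_cong[OF g(3), of "\<lambda>h. rep_comp h i"] i
         in \<open>simp_all add: R_simps Rep_simps\<close>)
  show "is_iso E (Lmap f i)"
    by (rule is_isoI[OF Lmap_Hom[OF fD(1)] Lmap_Hom[OF gD(1)]])
       (use g(2,3) in \<open>simp_all add: R_simps Lmap_Idm fD(4,5)
           flip: Lmap_Cmp[OF fD(1) gD(1)] Lmap_Cmp[OF gD(1) fD(1)]\<close>)
qed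

text \<open>Pushouts in \<open>R\<close> are unique up to isomorphism, one of them is vertexwise by
  construction, and an isomorphism of representations is an isomorphism at each vertex.\<close>

lemma R_pushout_pointwise:
  assumes f: "f \<in> Hom R A B" and g: "g \<in> Hom R A C" and fC: "f \<in> latching_class Q E R Cof"
    and po: "is_pushout R f g p q" and i: "i \<in> verts Q"
  shows "is_pushout E (rep_comp f i) (rep_comp g i) (rep_comp p i) (rep_comp q i)"
proof -
  obtain p0 q0 P0 where p0: "p0 \<in> Hom R B P0" and q0: "q0 \<in> Hom R C P0" and
    pw: "\<And>i. i \<in> verts Q \<Longrightarrow> is_pushout E (rep_comp f i) (rep_comp g i) (rep_comp p0 i) (rep_comp q0
        i)"
    using pointwise_pushout_ex[OF f g fC] by metis
  have po0: "is_pushout R f g p0 q0" using pointwise_pushout_imp[OF f g p0 q0 pw] .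
  have pD: "p \<in> Hom R B (Cod R p)" and qD: "q \<in> Hom R C (Cod R p)"
    using po f g by (auto simp: is_pushout_def Hom_def)
  obtain \<theta> where \<theta>: "\<theta> \<in> Hom R P0 (Cod R p)" "Cmp R \<theta> p0 = p" "Cmp R \<theta> q0 = q"
    using category.pushout_ex[OF R_cat po0 p0 q0 pD qD category.pushout_commutes[OF R_cat po]] .
  have "\<theta> \<in> Hom R (Cod R p0) (Cod R p)" using \<theta>(1) p0 by (auto simp: Hom_def)
  then have "is_iso R \<theta>" using category.pushout_unique[OF R_cat po0 po _ \<theta>(2,3)] by blast
  then have iso: "is_iso E (rep_comp \<theta> i)" using R_iso_pointwise[OF \<theta>(1)] i by blast
  have "rep_comp p i = rep_comp \<theta> i \<odot> rep_comp p0 i" "rep_comp q i = rep_comp \<theta> i \<odot> rep_comp q0 i"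
    using i by (simp_all add: R_simps Rep_simps flip: \<theta>(2,3))
  then show ?thesis
    using pushout_iso_cocone[OF pw[OF i] iso rep_comp_Hom[OF R_HomD(1)[OF \<theta>(1)] i] rep_comp_Hom[OF
        R_HomD(1)[OF p0] i]]
    by simp
qed

section \<open>The Waldhausen axioms for representations\<close>

lemma latching_class_comp:
  assumes K: "corner_class K"
  shows "closed_under_composition R (latching_class Q E R K)"
  unfolding closed_under_composition_def
proof (intro ballI impI)
  fix f g assume f: "f \<in> latching_class Q E R K" and g: "g \<in> latching_class Q E R K"
      and fg: "Cod R f = Dom R g"
  have fH: "f \<in> Hom R (Dom R f) (Dom R g)" and gH: "g \<in> Hom R (Dom R g) (Cod R g)"
    using f g fg by (auto simp: latching_class_def Hom_def)
  note fD = R_HomD[OF fH] and gD = R_HomD[OF gH]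
  have gf: "Cmp R g f \<in> Hom R (Dom R f) (Cod R g)" using category.Cmp_in_Hom[OF R_cat fH gH] .
  show "Cmp R g f \<in> latching_class Q E R K"
    unfolding latching_class_iff[OF K gf]
  proof
    fix i assume i: "i \<in> verts Q"
    have "rep_comp (Cmp R g f) i = rep_comp g i \<odot> rep_comp f i" using i
      by (simp add: R_simps Rep_simps)
    moreover have "Lmap (Cmp R g f) i = Lmap g i \<odot> Lmap f i" using Lmap_Cmp[OF fD(1) gD(1)]
      by (simp add: R_simps)
    ultimately show "corner_in E K (lat (Dom R f) i) (lat (Cod R g) i) (Lmap (Cmp R g f) i)
        (rep_comp (Cmp R g f) i)"
      using corner_in_comp[OF K lat_Cof[OF fD(2) i] lat_Cof[OF gD(2) i]] f g i
      unfolding latching_class_iff[OF K fH] latching_class_iff[OF K gH] by simp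
  qed
qed

lemma latching_class_iso:
  assumes K: "corner_class K" and f: "is_iso R f"
  shows "f \<in> latching_class Q E R K"
proof -
  have fH: "f \<in> Hom R (Dom R f) (Cod R f)" using f by (auto simp: is_iso_def Hom_def)
  note fD = R_HomD[OF fH]
  show ?thesis
    unfolding latching_class_iff[OF K fH]
  proof
    fix i assume i: "i \<in> verts Q"
    show "corner_in E K (lat (Dom R f) i) (lat (Cod R f) i) (Lmap f i) (rep_comp f i)"
      by (rule corner_in_iso[OF K lat_Cof[OF fD(2) i] lat_Hom[OF fD(4) i] lat_Hom[OF fD(5) i]
            R_iso_pointwise(2)[OF fH f] Lmap_Hom[OF fD(1)] R_iso_pointwise(1)[OF fH f i]
                rep_comp_Hom[OF fD(1) i]
            lat_natural[OF fD(1) i]])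
  qed
qed

text \<open>The constant representation at an initial object \<open>z\<close> serves: its latching
  objects are coproducts of initial objects, hence initial, so its latching morphisms are
  isomorphisms.\<close>

lemma R_initial_ex:
  obtains Z where "is_initial R Z" "\<And>f X. f \<in> Hom R Z X \<Longrightarrow> f \<in> latching_class Q E R Cof"
proof -
  obtain z where z: "is_initial E z" using ex_initial by blast
  then have zOb: "z \<in> Ob E" by (simp add: is_initial_def)
  let ?Z = "\<lparr>rep_ob = (\<lambda>i\<in>verts Q. z), rep_map = (\<lambda>\<alpha>\<in>arcs Q. Idm E z)\<rparr>"
  have Z: "?Z \<in> Ob (Rep Q E)" using zOb Idm_in_Hom by (auto simp: Rep_simps)
  have Lz: "is_initial E (Lob ?Z i)" for i
    by (rule coproduct_of_initial[OF Lob_coproduct[OF Z]]) (use z in auto)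
  have lz: "lat ?Z i \<in> Hom E (Lob ?Z i) z" if "i \<in> verts Q" for i
    using lat_Hom[OF Z that] that by simp
  have ZR: "?Z \<in> Ob R"
    by (rule R_ObI[OF Z]) (use initial_iso[OF Lz z lz] iso_Cof in blast)
  have "\<exists>!f. f \<in> Hom R ?Z X" if X: "X \<in> Ob R" for X
  proof -
    have XR: "X \<in> Ob (Rep Q E)" using X by (simp add: R_Ob)
    have "\<forall>i\<in>verts Q. \<exists>f. f \<in> Hom E z (rep_ob X i)" using initial_ex[OF z] rep_ob_Ob[OF XR] by metis
    then obtain h where h: "\<forall>i\<in>verts Q. h i \<in> Hom E z (rep_ob X i)" by (rule bchoice[THEN exE])
    let ?f = "\<lparr>rep_dom = ?Z, rep_cod = X, rep_comp = (\<lambda>i\<in>verts Q. h i)\<rparr>"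
    have "h (head Q \<alpha>) \<odot> Idm E z = rep_map X \<alpha> \<odot> h (tail Q \<alpha>)" if \<alpha>: "\<alpha> \<in> arcs Q" for \<alpha>
      by (rule initial_eq[OF z, of _ "rep_ob X (head Q \<alpha>)"])
         (use h \<alpha> zOb rep_map_Hom[OF XR \<alpha>] in \<open>auto simp: cat_simps\<close>)
    then have "?f \<in> Hom (Rep Q E) ?Z X" using Z XR h by (auto simp: Rep_Hom)
    then have f: "?f \<in> Hom R ?Z X" using ZR X by (simp add: R_Hom)
    moreover have "g = ?f" if g: "g \<in> Hom R ?Z X" for g
      by (rule Rep_mor_eqI[OF R_HomD(1)[OF g] R_HomD(1)[OF f]], rule initial_eq[OF z])
         (use rep_comp_Hom[OF R_HomD(1)[OF g]] h in auto)
    ultimately show ?thesis by blast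
  qed
  then have "is_initial R ?Z" using ZR unfolding is_initial_def by blast
  moreover have "f \<in> latching_class Q E R Cof" if f: "f \<in> Hom R ?Z X" for f X
    unfolding latching_class_iff[OF corner_class_Cof f]
  proof
    fix i assume i: "i \<in> verts Q"
    note fD = R_HomD[OF f]
    have L: "Lob X i \<in> Ob E" using coproduct_Ob[OF Lob_coproduct[OF fD(5)]] .
    have m: "Lmap f i \<in> Hom E (Lob ?Z i) (Lob X i)" using Lmap_Hom[OF fD(1)] .
    have fi: "rep_comp f i \<in> Hom E z (rep_ob X i)" using rep_comp_Hom[OF fD(1) i] i by simp
    obtain p where p: "p \<in> Hom E z (Lob X i)" using initial_ex[OF z L] .
    \<comment> \<open>As \<open>z\<close> and the latching object of \<open>?Z\<close> are both
      initial, the pushout is the latching object of \<open>X\<close>. The corner map is then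
      \<open>lat X i\<close>, a cofibration because \<open>X\<close> lies in
      \<open>R\<close>.\<close>
    have po: "is_pushout E (lat ?Z i) (Lmap f i) p (Idm E (Lob X i))"
    proof (rule is_pushoutI[OF lz[OF i] m p Idm_in_Hom[OF L]])
      show "p \<odot> lat ?Z i = Idm E (Lob X i) \<odot> Lmap f i"
        by (rule initial_eq[OF Lz]) (use p lz[OF i] m L Idm_in_Hom Cmp_in_Hom in blast)+
    next
      fix D r s assume r: "r \<in> Hom E z D" and s: "s \<in> Hom E (Lob X i) D"
      have "s \<odot> p = r" by (rule initial_eq[OF z Cmp_in_Hom[OF p s] r])
      then show "\<exists>h. h \<in> Hom E (Lob X i) D \<and> h \<odot> p = r \<and> h \<odot> Idm E (Lob X i) = s"
        using s Cmp_Idm[OF s] by blast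
    next
      fix D h k assume "h \<in> Hom E (Lob X i) D" "k \<in> Hom E (Lob X i) D"
          "h \<odot> Idm E (Lob X i) = k \<odot> Idm E (Lob X i)"
      then show "h = k" by (simp add: Cmp_Idm)
    qed
    have lX: "lat X i \<in> Hom E (Lob X i) (rep_ob X i)" using lat_Hom[OF fD(5) i] .
    show "corner_in E Cof (lat ?Z i) (lat X i) (Lmap f i) (rep_comp f i)"
      by (rule corner_inI[OF po p fi lX lat_Cof[OF fD(3) i] initial_eq[OF z Cmp_in_Hom[OF p lX] fi]
          Cmp_Idm[OF lX]])
  qed
  ultimately show thesis using that by blast
qed

text \<open>The axiom concerns every initial object. A morphism out of \<open>Z\<close> factors
  through the isomorphism from \<open>Z\<close> to the constructed initial object.\<close>

lemma R_initial_Cof: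
  assumes Z: "is_initial R Z" and f: "f \<in> Hom R Z X"
  shows "f \<in> latching_class Q E R Cof"
proof -
  obtain Z0 where Z0: "is_initial R Z0" "\<And>f X. f \<in> Hom R Z0 X \<Longrightarrow> f \<in> latching_class Q E R Cof"
    using R_initial_ex by blast
  have Ob: "Z0 \<in> Ob R" "X \<in> Ob R" using Z0(1) R_HomD[OF f] by (auto simp: is_initial_def)
  obtain \<phi> where \<phi>: "\<phi> \<in> Hom R Z Z0" using category.initial_ex[OF R_cat Z Ob(1)] .
  obtain g where g: "g \<in> Hom R Z0 X" using category.initial_ex[OF R_cat Z0(1) Ob(2)] .
  have "f = Cmp R g \<phi>"
    using category.initial_eq[OF R_cat Z f category.Cmp_in_Hom[OF R_cat \<phi> g]] .
  moreover have "\<phi> \<in> latching_class Q E R Cof"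
    using latching_class_iso[OF corner_class_Cof category.initial_iso[OF R_cat Z Z0(1) \<phi>]] .
  moreover have "Cod R \<phi> = Dom R g" using \<phi> g by (simp add: Hom_def)
  ultimately show ?thesis
    using latching_class_comp[OF corner_class_Cof] Z0(2)[OF g]
      unfolding closed_under_composition_def by blast
qed

lemma R_pushout_Homs:
  assumes "is_pushout R f g p q"
  obtains A B C P where "f \<in> Hom R A B" "g \<in> Hom R A C" "p \<in> Hom R B P" "q \<in> Hom R C P"
  using category.pushout_Homs[OF R_cat assms] by metis

lemma R_pushout_Cof:
  assumes fC: "f \<in> latching_class Q E R Cof" and po: "is_pushout R f g p q"
  shows "q \<in> latching_class Q E R Cof"
proof -
  obtain A B C P where H: "f \<in> Hom R A B" "g \<in> Hom R A C" "p \<in> Hom R B P" "q \<in> Hom R C P"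
    using R_pushout_Homs[OF po] by metis
  have "corner_in E Cof (lat C i) (lat P i) (Lmap q i) (rep_comp q i)" if i: "i \<in> verts Q" for i
    by (rule pointwise_pushout_corner[OF H[THEN R_HomD(1)] R_pushout_pointwise[OF H(1,2) fC po] i _
        lat_Cof[OF R_HomD(3)[OF H(2)] i]])
       (use fC i in \<open>simp_all add: latching_class_iff[OF corner_class_Cof H(1)]\<close>)
  then show ?thesis by (simp add: latching_class_iff[OF corner_class_Cof H(4)])
qed

text \<open>Both given pushouts are vertexwise, and applying L_i to them gives pushouts of latching
  objects; this is the input of \<open>corner_in_gluing\<close> at each vertex.\<close>

lemma R_gluing:
  assumes fC: "f \<in> latching_class Q E R Cof" "f' \<in> latching_class Q E R Cof"
    and po: "is_pushout R f g p q" "is_pushout R f' g' p' q'"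
    and w: "a \<in> latching_class Q E R W" "b \<in> latching_class Q E R W" "c \<in> latching_class Q E R W"
    and h: "a \<in> Hom R (Dom R f) (Dom R f')" "b \<in> Hom R (Cod R f) (Cod R f')"
        "c \<in> Hom R (Cod R g) (Cod R g')" "u \<in> Hom R (Cod R p) (Cod R p')"
    and eq: "Cmp R b f = Cmp R f' a" "Cmp R c g = Cmp R g' a" "Cmp R u p = Cmp R p' b"
        "Cmp R u q = Cmp R q' c"
  shows "u \<in> latching_class Q E R W"
proof -
  obtain A B C P where H: "f \<in> Hom R A B" "g \<in> Hom R A C" "p \<in> Hom R B P" "q \<in> Hom R C P"
    using R_pushout_Homs[OF po(1)] by metis
  obtain A' B' C' P' where H': "f' \<in> Hom R A' B'" "g' \<in> Hom R A' C'" "p' \<in> Hom R B' P'"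
      "q' \<in> Hom R C' P'"
    using R_pushout_Homs[OF po(2)] by metis
  have V: "a \<in> Hom R A A'" "b \<in> Hom R B B'" "c \<in> Hom R C C'" "u \<in> Hom R P P'"
    using h H H' by (auto simp: Hom_def)
  note D = H[THEN R_HomD(1)] and D' = H'[THEN R_HomD(1)] and V' = V[THEN R_HomD(1)]
  have Ob: "A \<in> Ob R" "B \<in> Ob R" "C \<in> Ob R" "P \<in> Ob R" "A' \<in> Ob R" "B' \<in> Ob R" "C' \<in> Ob R"
      "P' \<in> Ob R"
    using R_HomD(2,3) H H' by blast+
  have Ob': "A \<in> Ob (Rep Q E)" "B \<in> Ob (Rep Q E)" "C \<in> Ob (Rep Q E)" "P \<in> Ob (Rep Q E)"
    "A' \<in> Ob (Rep Q E)" "B' \<in> Ob (Rep Q E)" "C' \<in> Ob (Rep Q E)" "P' \<in> Ob (Rep Q E)"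
    using Ob by (auto simp: R_Ob)
  note pw = R_pushout_pointwise[OF H(1,2) fC(1) po(1)]
      and pw' = R_pushout_pointwise[OF H'(1,2) fC(2) po(2)]
  note com = category.pushout_commutes[OF R_cat po(1)] category.pushout_commutes[OF R_cat po(2)]
  note iffC = latching_class_iff[OF corner_class_Cof]
      and iffW = latching_class_iff[OF corner_class_W]
  show ?thesis unfolding iffW[OF V(4)]
  proof
    fix i assume i: "i \<in> verts Q"
    \<comment> \<open>Makes L_i(f) and L_i(f') cofibrations, as coproducts of components at the
      sources of arrows into \<open>i\<close>.\<close>
    have tails: "rep_comp k (tail Q \<alpha>) \<in> Cof"
      if "k \<in> latching_class Q E R Cof" "k \<in> Hom R X Y" "\<alpha> \<in> in_arcs Q i" for k X Y \<alpha>
      using corner_imp_pointwise_Cof[OF R_HomD(1)[OF that(2)]] that by (auto simp: iffC[OF that(2)])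
    have cmp: "rep_comp k i \<odot> rep_comp l i = rep_comp k' i \<odot> rep_comp l' i"
        if "Cmp R k l = Cmp R k' l'" for k l k' l'
      using arg_cong[OF that, of "\<lambda>h. rep_comp h i"] i by (simp add: R_simps Rep_simps)
    \<comment> \<open>Functoriality of L_i turns commuting squares of representations into commuting
      squares of latching objects.\<close>
    have Lcmp: "Lmap k i \<odot> Lmap l i = Lmap k' i \<odot> Lmap l' i"
      if "Cmp R k l = Cmp R k' l'" "l \<in> Hom (Rep Q E) X Y" "k \<in> Hom (Rep Q E) Y Z"
        "l' \<in> Hom (Rep Q E) X Y'" "k' \<in> Hom (Rep Q E) Y' Z" for k l k' l' X Y Z Y'
      using that(1) Lmap_Cmp[OF that(2,3), of i] Lmap_Cmp[OF that(4,5), of i] by (simp add: R_simps)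
    show "corner_in E W (lat P i) (lat P' i) (Lmap u i) (rep_comp u i)"
    proof (rule corner_in_gluing)
      show "lat A i \<in> Cof" "lat B i \<in> Cof" "lat C i \<in> Cof" "lat A' i \<in> Cof" "lat B' i \<in> Cof"
          "lat C' i \<in> Cof"
        using Ob lat_Cof i by blast+
      show "Lmap f i \<in> Cof" "Lmap f' i \<in> Cof"
        using Lmap_Cof[OF D(1)] Lmap_Cof[OF D'(1)] tails[OF fC(1) H(1)] tails[OF fC(2) H'(1)]
          by blast+
      show "corner_in E Cof (lat A i) (lat B i) (Lmap f i) (rep_comp f i)"
        "corner_in E Cof (lat A' i) (lat B' i) (Lmap f' i) (rep_comp f' i)"
        "corner_in E W (lat A i) (lat A' i) (Lmap a i) (rep_comp a i)"
        "corner_in E W (lat B i) (lat B' i) (Lmap b i) (rep_comp b i)"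
        "corner_in E W (lat C i) (lat C' i) (Lmap c i) (rep_comp c i)"
        using iffC[OF H(1)] iffC[OF H'(1)] iffW[OF V(1)] iffW[OF V(2)] iffW[OF V(3)] fC w i
          by blast+
      show "is_pushout E (Lmap f i) (Lmap g i) (Lmap p i) (Lmap q i)"
        using Lmap_pushout[OF D pw] .
      show "is_pushout E (Lmap f' i) (Lmap g' i) (Lmap p' i) (Lmap q' i)"
        using Lmap_pushout[OF D' pw'] .
      show "is_pushout E (rep_comp f i) (rep_comp g i) (rep_comp p i) (rep_comp q i)"
        "is_pushout E (rep_comp f' i) (rep_comp g' i) (rep_comp p' i) (rep_comp q' i)"
        using pw pw' i by blast+
      show "lat A i \<in> Hom E (Lob A i) (rep_ob A i)" "lat B i \<in> Hom E (Lob B i) (rep_ob B i)"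
        "lat C i \<in> Hom E (Lob C i) (rep_ob C i)" "lat P i \<in> Hom E (Lob P i) (rep_ob P i)"
        "lat A' i \<in> Hom E (Lob A' i) (rep_ob A' i)" "lat B' i \<in> Hom E (Lob B' i) (rep_ob B' i)"
        "lat C' i \<in> Hom E (Lob C' i) (rep_ob C' i)" "lat P' i \<in> Hom E (Lob P' i) (rep_ob P' i)"
        using Ob' lat_Hom i by blast+
    \<comment> \<open>There remain the types of the components and of the \<open>Lmap\<close>, and
      the fourteen equations: six from naturality of latching, four at the vertex, four between
      latching objects.\<close>
    qed (fact D[THEN rep_comp_Hom, OF i] D'[THEN rep_comp_Hom, OF i] V'[THEN rep_comp_Hom, OF i]
        D[THEN Lmap_Hom] D'[THEN Lmap_Hom] V'[THEN Lmap_Hom]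
        lat_natural[OF D(2) i] lat_natural[OF D'(2) i]
        lat_natural[OF D(3) i, symmetric] lat_natural[OF D'(3) i, symmetric]
        lat_natural[OF D(4) i, symmetric] lat_natural[OF D'(4) i, symmetric]
        eq[THEN cmp] Lcmp[OF eq(1) D(1) V'(2) V'(1) D'(1)] Lcmp[OF eq(2) D(2) V'(3) V'(1) D'(2)]
        Lcmp[OF eq(3) D(3) V'(4) V'(2) D'(3)] Lcmp[OF eq(4) D(4) V'(4) V'(3) D'(4)])+
  qed
qed

lemma R_waldhausen: "waldhausen_category R (latching_class Q E R Cof) (latching_class Q E R W)"
proof (intro waldhausen_category.intro waldhausen_category_axioms.intro)
  show "category R" by (rule R_cat)
  show "\<exists>Z. is_initial R Z" using R_initial_ex by blast
  show "latching_class Q E R Cof \<subseteq> Mor R" "latching_class Q E R W \<subseteq> Mor R"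
    unfolding latching_class_def by blast+
  show "closed_under_composition R (latching_class Q E R Cof)"
      "closed_under_composition R (latching_class Q E R W)"
    using latching_class_comp corner_class_Cof corner_class_W by blast+
  show "f \<in> latching_class Q E R Cof" "f \<in> latching_class Q E R W" if "is_iso R f" for f
    using latching_class_iso that corner_class_Cof corner_class_W by blast+
  show "f \<in> latching_class Q E R Cof" if "is_initial R Z" "f \<in> Mor R" "Dom R f = Z" for f Z
    using R_initial_Cof[OF that(1), of f "Cod R f"] category.Mor_Hom[OF R_cat that(2)] that(3)
      by simp
  show "\<exists>p q. is_pushout R f g p q"
    if f: "f \<in> latching_class Q E R Cof" and g: "g \<in> Mor R" and fg: "Dom R g = Dom R f" for f g
  proof -
    have "f \<in> Mor R" using f by (simp add: latching_class_def)
    then have H: "f \<in> Hom R (Dom R f) (Cod R f)" "g \<in> Hom R (Dom R f) (Cod R g)"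
      using category.Mor_Hom[OF R_cat] g fg by metis+
    then show ?thesis using pointwise_pushout_ex[OF H f] pointwise_pushout_imp[OF H] by metis
  qed
  show "q \<in> latching_class Q E R Cof" if "f \<in> latching_class Q E R Cof" "is_pushout R f g p q"
      for f g p q
    using R_pushout_Cof[OF that] .
qed (rule R_gluing)

end

theorem theorem2:
  fixes Q :: "('v, 'e) pre_digraph"
    and E :: "('o, 'm) category"
    and Cof W :: "'m set"
  assumes "wf_digraph Q"
    and "left_rooted TYPE('w::wellorder) Q"
    and "waldhausen_category E Cof W"
    and "has_small_coproducts TYPE('e) E"
    and "weak_factorization_system E Cof (rlp E Cof)"
  shows
    "((\<forall>X \<in> Ob (Rep_in Q E Cof). latching_mors_in Q E Cof X) \<longrightarrow>
      (let R = Rep_in Q E Cof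
       in waldhausen_category R (latching_class Q E R Cof) (latching_class Q E R W))) \<and>
     (let R = full_subcategory (Rep_in Q E Cof) {X. latching_mors_in Q E Cof X}
      in waldhausen_category R (latching_class Q E R Cof) (latching_class Q E R W))"
proof -
  interpret latching_category E Cof W Q
    using assms left_rooted_imp_wf[OF assms(1,2)]
    by (intro latching_category.intro latching_category_axioms.intro)
  \<comment> \<open>The records are equal, not just isomorphic: passing to a full subcategory
    changes only \<open>Ob\<close> and \<open>Mor\<close>, and no morphism is lost since domains and
    codomains are objects.\<close>
  have eq: "R = Rep_in Q E Cof" if "\<forall>X \<in> Ob (Rep_in Q E Cof). latching_mors_in Q E Cof X"
  proof -
    have "category (Rep_in Q E Cof)"
      unfolding Rep_in_def by (intro category.full_subcategory_category Rep_cat)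
    then have "Mor R = Mor (Rep_in Q E Cof)"
      using that category.Dom_in_Ob category.Cod_in_Ob by (fastforce simp: full_subcategory_simps)
    moreover have "Ob R = Ob (Rep_in Q E Cof)" using that by (auto simp: full_subcategory_simps)
    ultimately show ?thesis unfolding full_subcategory_def by simp
  qed
  show ?thesis
    unfolding Let_def using R_waldhausen by (auto dest: eq)
qed

end
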